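(* For every prime power $q$ with $5 \leq q \leq 101$, the projective space $\mathrm{PG}(3,q)$ contains maximal partial spreads of size less than \[ \left(\left\lceil 2\log_{2}q\right\rceil+1\right)q+1-3q. \]
   Context: $\mathrm{PG}(3,q)$ denotes the three-dimensional projective space over the finite field $\mathrm{GF}(q)$. A spread of $\mathrm{PG}(3,q)$ is a set of mutually skew (pairwise disjoint) lines covering every point of the space. A partial spread is a set of mutually skew lines which is not a spread. A partial spread is maximal if it is not properly contained in a spread or in another partial spread, i.e. no line of $\mathrm{PG}(3,q)$ is skew to all of its lines. The size of a partial spread is its number of lines. *)

theory Defs
  imports "HOL-Analysis.Analysis" "HOL-Number_Theory.Prime_Powers"
begin

text \<open>
  The projective space \<open>PG(3,q)\<close> is coordinatised by the vector space \<open>'a^4\<close> over a field \<open>'a\<close>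
  with \<open>q\<close> elements: points and lines are the subspaces of vector-space dimension 1 and 2,
  and incidence is inclusion.  Note that two lines, being subspaces, always share the zero vector;
  skewness therefore has to be expressed through projective points.
\<close>

definition pg_points :: "('a::field ^ 4) set set" where
  "pg_points = {P. vec.subspace P \<and> vec.dim P = 1}"

definition pg_lines :: "('a::field ^ 4) set set" where
  "pg_lines = {L. vec.subspace L \<and> vec.dim L = 2}"

definition skew_lines :: "('a::field ^ 4) set \<Rightarrow> ('a ^ 4) set \<Rightarrow> bool" where
  "skew_lines L M \<longleftrightarrow> \<not> (\<exists>P\<in>pg_points. P \<subseteq> L \<and> P \<subseteq> M)"

definition mutually_skew :: "('a::field ^ 4) set set \<Rightarrow> bool" where
  "mutually_skew S \<longleftrightarrow> S \<subseteq> pg_lines \<and> pairwise skew_lines S"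

definition is_spread :: "('a::field ^ 4) set set \<Rightarrow> bool" where
  "is_spread S \<longleftrightarrow> mutually_skew S \<and> (\<forall>P\<in>pg_points. \<exists>L\<in>S. P \<subseteq> L)"

definition partial_spread :: "('a::field ^ 4) set set \<Rightarrow> bool" where
  "partial_spread S \<longleftrightarrow> mutually_skew S \<and> \<not> is_spread S"

definition maximal_partial_spread :: "('a::field ^ 4) set set \<Rightarrow> bool" where
  "maximal_partial_spread S \<longleftrightarrow>
     partial_spread S \<and> \<not> (\<exists>T. (is_spread T \<or> partial_spread T) \<and> S \<subset> T)"

end

theory Submission
  imports Defs
begin

text \<open>
  Fix the line at infinity \<open>P = {(0,0,z,w)}\<close>.  The lines skew to \<open>P\<close> are the graphs of the \<open>2 \<times> 2\<close> matrices,
  and two graphs meet iff the difference of the matrices is singular.  The binary quadratic form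
  \<open>v \<mapsto> det(v, M v)\<close> determines \<open>M\<close> up to adding a scalar matrix, and \<open>M\<close> meets the graph of some matrix with
  form \<open>f\<close> iff its own form agrees with \<open>f\<close> at a nonzero vector.  Let \<open>N(x,y) = x\<^sup>2 + xy + \<eta>y\<^sup>2\<close> be anisotropic and
  \<open>T\<close> a set of \<open>k\<close> scalars.  We take the \<open>kq\<close> graphs whose form is \<open>\<sigma>N\<close> with \<open>\<sigma> \<in> T\<close>, and \<open>q + 1\<close> lines through the
  points of \<open>P\<close>; the line through the point \<open>v\<close> blocks exactly the forms with a prescribed value \<open>s\<^sub>v\<close> at \<open>v\<close>.

  Identifying vectors with the elements of the quadratic extension with norm \<open>N\<close>, every form is
  \<open>t N(v) + \<tau>(b v\<^sup>2)\<close>, and Hilbert 90 shows that it meets \<open>T\<close> iff \<open>N(b) = N(z)\<close> for some \<open>z\<close> with \<open>\<tau>(z) \<in> T - t\<close>.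
  Hence maximality follows from about \<open>q\<^sup>2\<close> conditions on \<open>T\<close> alone.  For most \<open>q\<close> there is a suitable \<open>T\<close> with
  \<open>k = \<lceil>2 log\<^sub>2 q\<rceil> - 4\<close>.  For the remaining \<open>q\<close> the few uncovered forms are blocked by choosing the \<open>s\<^sub>v\<close>, and for
  \<open>q = 5, 7, 8\<close> also by at most \<open>q - 1\<close> additional graphs.  The sets were found by computer search.
\<close>

section \<open>Partial spreads from matrices\<close>

text \<open>The number 2 log_2 q has a probabilistic origin. For fixed \<sigma> - t \<noteq> 0 the
  norms of the z with \<tau>(z) = \<sigma> - t make up about half of the field, so one condition
  should fail for a random k-set \<open>T\<close> with probability about 2^(-k). With about q^2
  conditions, k near 2 log_2 q is to be expected; searching saves a little more. For the stated k
  the size must be less than (k + 2) q + 1, while the kq graphs and the point lines number (k + 1) q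
  + 1: room for at most q - 1 additional graphs.

  Below, \<omega> denotes a root of \<omega>^2 = \<omega> - \<eta>, so N(x,y) is the norm of x + y
  \<omega>, and \<tau> is the coordinate at \<omega>. The extension is never constructed: its
  arithmetic appears only as polynomial identities in coordinates.

  The field is an arbitrary type with q elements, whereas the data found by search are explicit.
  They are transported along a bijection from codes to the field, which for proper prime powers
  requires a root of the chosen polynomial inside the given field.\<close>

definition vec4 :: "'a \<Rightarrow> 'a \<Rightarrow> 'a \<Rightarrow> 'a \<Rightarrow> 'a ^ 4" where
  "vec4 a b c d = (\<chi> i. if i = 1 then a else if i = 2 then b else if i = 3 then c else d)"

lemma vec4_nth [simp]:
  "vec4 a b c d $ 1 = a" "vec4 a b c d $ 2 = b" "vec4 a b c d $ 3 = c" "vec4 a b c d $ 4 = d"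
  by (simp_all add: vec4_def)

lemma vec4_eq_iff: "(x :: 'a ^ 4) = y \<longleftrightarrow> x $ 1 = y $ 1 \<and> x $ 2 = y $ 2 \<and> x $ 3 = y $ 3 \<and> x $ 4 = y $ 4"
  by (simp add: vec_eq_iff forall_4)

definition join :: "'a::field ^ 4 \<Rightarrow> 'a ^ 4 \<Rightarrow> ('a ^ 4) set" where
  "join u v = {\<alpha> *s u + \<beta> *s v | \<alpha> \<beta>. True}"

lemma joinI: "x = \<alpha> *s u + \<beta> *s v \<Longrightarrow> x \<in> join u v"
  by (auto simp: join_def)

lemma join_eq_span: "join u v = vec.span {u, v}"
proof -
  have "x \<in> vec.span {u, v} \<longleftrightarrow> (\<exists>\<alpha> \<beta>. x = \<alpha> *s u + \<beta> *s v)" for x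
  proof -
    have "x - \<alpha> *s u - \<beta> *s v = 0 \<longleftrightarrow> x = \<alpha> *s u + \<beta> *s v" for \<alpha> \<beta>
      by (simp add: diff_diff_eq)
    then show ?thesis by (simp add: vec.span_breakdown_eq)
  qed
  then show ?thesis by (auto simp: join_def)
qed

lemma join_line:
  assumes ind: "\<And>\<alpha> \<beta>. \<alpha> *s u + \<beta> *s v = 0 \<Longrightarrow> \<alpha> = 0 \<and> \<beta> = 0"
  shows "join u v \<in> pg_lines"
proof -
  have v0: "v \<noteq> 0" using ind[of 0 1] by auto
  have u: "u \<notin> vec.span {v}"
  proof
    assume "u \<in> vec.span {v}"
    then obtain k where "u = k *s v"
      by (auto simp: vec.span_breakdown_eq)
    then show False using ind[of 1 "-k"] by auto
  qed
  then have "vec.independent {u, v}"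
    using v0 by (simp add: vec.independent_insert)
  moreover have "u \<noteq> v" using u by (auto simp: vec.span_base)
  ultimately have "vec.dim (join u v) = 2"
    by (simp add: join_eq_span vec.dim_eq_card_independent)
  then show ?thesis
    by (simp add: pg_lines_def join_eq_span)
qed

lemma line_join:
  assumes "L \<in> pg_lines"
  obtains u v where "L = join u v" "\<And>\<alpha> \<beta>. \<alpha> *s u + \<beta> *s v = 0 \<Longrightarrow> \<alpha> = 0 \<and> \<beta> = 0"
proof -
  have L: "vec.subspace L" "vec.dim L = 2" using assms by (auto simp: pg_lines_def)
  obtain B where B: "B \<subseteq> L" "vec.independent B" "L \<subseteq> vec.span B" "card B = vec.dim L"
    using vec.basis_exists by blast
  then obtain u v where uv: "B = {u, v}" "u \<noteq> v"
    using L by (metis card_2_iff)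
  have "L = join u v"
    using B L uv by (metis join_eq_span vec.span_subspace)
  moreover have "\<alpha> = 0 \<and> \<beta> = 0" if e: "\<alpha> *s u + \<beta> *s v = 0" for \<alpha> \<beta>
  proof -
    have "v \<noteq> 0" "u \<notin> vec.span {v}"
      using B uv by (auto simp: vec.independent_insert)
    have "\<alpha> = 0"
    proof (rule ccontr)
      assume a: "\<alpha> \<noteq> 0"
      have "\<alpha> *s u = (-\<beta>) *s v" using e by (simp add: eq_neg_iff_add_eq_0)
      then have "inverse \<alpha> *s (\<alpha> *s u) = inverse \<alpha> *s ((-\<beta>) *s v)" by simp
      then have "u = (inverse \<alpha> * (-\<beta>)) *s v" using a by (simp add: vector_smult_assoc)
      then show False using \<open>u \<notin> vec.span {v}\<close>
        by (metis vec.span_base vec.span_scale insertI1)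
    qed
    with e \<open>v \<noteq> 0\<close> show ?thesis by simp
  qed
  ultimately show ?thesis using that by blast
qed

lemma skew_lines_iff:
  assumes "L \<in> pg_lines" "M \<in> pg_lines"
  shows "skew_lines L M \<longleftrightarrow> L \<inter> M \<subseteq> {0}"
proof
  assume s: "skew_lines L M"
  show "L \<inter> M \<subseteq> {0}"
  proof
    fix x assume x: "x \<in> L \<inter> M"
    show "x \<in> {0}"
    proof (rule ccontr)
      assume "x \<notin> {0}"
      then have "vec.independent {x}" by simp
      then have "vec.dim (vec.span {x}) = 1"
        by (subst vec.dim_span_eq_card_independent) auto
      then have "vec.span {x} \<in> pg_points"
        by (simp add: pg_points_def)
      moreover have "vec.span {x} \<subseteq> L" "vec.span {x} \<subseteq> M"
        using x assms by (simp_all add: pg_lines_def vec.span_minimal)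
      ultimately show False using s by (auto simp: skew_lines_def)
    qed
  qed
next
  assume i: "L \<inter> M \<subseteq> {0}"
  show "skew_lines L M"
    unfolding skew_lines_def
  proof
    assume "\<exists>P\<in>pg_points. P \<subseteq> L \<and> P \<subseteq> M"
    then obtain P where P: "vec.dim P = 1" "P \<subseteq> L" "P \<subseteq> M" by (auto simp: pg_points_def)
    then have "P \<subseteq> {0}" using i by auto
    then show False using P(1) by (metis vec.dim_eq_0 zero_neq_one)
  qed
qed

lemma card_line:
  fixes L :: "('a::{field,finite} ^ 4) set"
  assumes "L \<in> pg_lines"
  shows "card L \<le> CARD('a)\<^sup>2" "0 \<in> L"
proof -
  obtain u v where L: "L = join u v" using assms line_join by blast
  have "L = (\<lambda>(\<alpha>, \<beta>). \<alpha> *s u + \<beta> *s v) ` UNIV" by (auto simp: L join_def)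
  then have "card L \<le> card (UNIV :: ('a \<times> 'a) set)" by (simp only: card_image_le finite)
  then show "card L \<le> CARD('a)\<^sup>2" by (simp add: power2_eq_square)
  show "0 \<in> L" unfolding L by (rule joinI[of _ 0 _ 0]) simp
qed

text \<open>A spread must cover q^4 - 1 nonzero vectors and a line contains at most q^2 - 1 of them,
  so q^2 lines are too few. A proper extension would contain a new line meeting one of
  \<open>S\<close>.\<close>

lemma maximal_partial_spreadI:
  fixes S :: "('a::{field,finite} ^ 4) set set"
  assumes lines: "S \<subseteq> pg_lines"
    and disj: "\<And>L M. L \<in> S \<Longrightarrow> M \<in> S \<Longrightarrow> L \<noteq> M \<Longrightarrow> L \<inter> M \<subseteq> {0}"
    and card: "card S < CARD('a)\<^sup>2 + 1"
    and block: "\<And>L. L \<in> pg_lines \<Longrightarrow> \<exists>M\<in>S. \<not> L \<inter> M \<subseteq> {0}"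
  shows "maximal_partial_spread S"
proof -
  let ?q = "CARD('a)"
  have skew: "mutually_skew S"
    unfolding mutually_skew_def pairwise_def using lines disj skew_lines_iff by (metis subsetD)
  have q1: "?q > 1" 
    using card_mono[of UNIV "{0, 1 :: 'a}"] by simp
  have "\<not> is_spread S"
  proof
    assume sp: "is_spread S"
    have sub: "UNIV - {0} \<subseteq> (\<Union>L\<in>S. L - {0 :: 'a ^ 4})"
    proof
      fix x :: "'a ^ 4" assume x: "x \<in> UNIV - {0}"
      then have "vec.dim (vec.span {x}) = 1"
        by (subst vec.dim_span_eq_card_independent) auto
      then have "vec.span {x} \<in> pg_points" by (simp add: pg_points_def)
      then obtain L where "L \<in> S" "vec.span {x} \<subseteq> L" using sp by (auto simp: is_spread_def)
      then show "x \<in> (\<Union>L\<in>S. L - {0 :: 'a ^ 4})" using x by (auto intro: vec.span_base)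
    qed
    have "card (UNIV - {0 :: 'a ^ 4}) \<le> card (\<Union>L\<in>S. L - {0 :: 'a ^ 4})"
      using sub by (intro card_mono) auto
    also have "\<dots> \<le> (\<Sum>L\<in>S. card (L - {0}))" by (rule card_UN_le) simp
    also have "\<dots> \<le> (\<Sum>L\<in>S. ?q\<^sup>2 - 1)"
      using lines by (intro sum_mono) (auto simp: card_Diff_singleton card_line diff_le_mono subsetD)
    also have "\<dots> \<le> ?q\<^sup>2 * (?q\<^sup>2 - 1)" using card by simp
    finally have "?q ^ 4 - 1 \<le> ?q\<^sup>2 * (?q\<^sup>2 - 1)"
      by (simp add: card_Diff_singleton)
    moreover have "?q ^ 4 = ?q\<^sup>2 * ?q\<^sup>2" by (simp flip: power_add)
    moreover have "?q\<^sup>2 > 1" using q1 by (intro one_less_power) auto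
    moreover have "?q\<^sup>2 * (?q\<^sup>2 - 1) + ?q\<^sup>2 = ?q\<^sup>2 * ?q\<^sup>2"
    by (metis Suc_pred' add.commute calculation(3) mult_Suc_right order_less_trans zero_less_one diff_Suc_1 One_nat_def)
  ultimately show False by linarith
  qed
  then have "partial_spread S" using skew by (simp add: partial_spread_def)
  moreover have "\<not> S \<subset> T" if "is_spread T \<or> partial_spread T" for T
  proof
    assume "S \<subset> T"
    then obtain L where L: "L \<in> T" "L \<notin> S" by auto
    have T: "T \<subseteq> pg_lines" "pairwise skew_lines T"
      using that by (auto simp: is_spread_def partial_spread_def mutually_skew_def)
    obtain M where M: "M \<in> S" "\<not> L \<inter> M \<subseteq> {0}" using block L T by blast
    then have "L \<noteq> M" "M \<in> T" using L \<open>S \<subset> T\<close> by auto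
    then have "skew_lines L M" using T L by (auto simp: pairwise_def)
    then show False using M L T \<open>M \<in> T\<close> by (metis skew_lines_iff subsetD)
  qed
  ultimately show ?thesis by (auto simp: maximal_partial_spread_def)
qed


text \<open>The norm of x + y \<omega>. The middle coefficient 1 lets the same form serve odd
  characteristic and characteristic 2.\<close>

definition nrm :: "'a::field \<Rightarrow> 'a \<Rightarrow> 'a \<Rightarrow> 'a" where
  "nrm \<eta> x y = x * x + x * y + \<eta> * y * y"

fun qf :: "'a::field \<times> 'a \<times> 'a \<times> 'a \<Rightarrow> 'a \<Rightarrow> 'a \<Rightarrow> 'a" where
  "qf (a, b, c, d) x y = c * x * x + (d - a) * x * y - b * y * y"

fun sing :: "'a::field \<times> 'a \<times> 'a \<times> 'a \<Rightarrow> 'a \<times> 'a \<times> 'a \<times> 'a \<Rightarrow> bool" where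
  "sing (a, b, c, d) (a', b', c', d') \<longleftrightarrow> (a - a') * (d - d') = (b - b') * (c - c')"

text \<open>The graph of v \<mapsto> M v for M with rows (a, b) and (c, d), spanned by the vectors
  over the two unit vectors.\<close>

fun mline :: "'a::field \<times> 'a \<times> 'a \<times> 'a \<Rightarrow> ('a ^ 4) set" where
  "mline (a, b, c, d) = join (vec4 1 0 a c) (vec4 0 1 b d)"

lemma sing_sym: "sing M M' \<Longrightarrow> sing M' M"
proof -
  have "(b - a) * (d - c) = (a - b) * (c - d)" for a b c d :: 'a
    by (metis minus_diff_eq minus_mult_minus)
  then show "sing M M' \<Longrightarrow> sing M' M" by (cases M; cases M') simp
qed

text \<open>A line through the point (0, 0, 1, y) of the line at infinity, attached to v = (1, y).
  The second generator encodes the blocked value s at v.\<close>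

definition pline :: "'a::field \<Rightarrow> 'a \<Rightarrow> ('a ^ 4) set" where
  "pline s y = join (vec4 0 0 1 y) (vec4 1 y 0 s)"

text \<open>The analogue for v = (0, 1). The sign comes from \<open>qf M 0 1\<close> being
  -b.\<close>

definition pline_inf :: "'a::field \<Rightarrow> ('a ^ 4) set" where
  "pline_inf s = join (vec4 0 0 0 1) (vec4 0 1 (- s) 0)"

definition tmat :: "'a::field \<Rightarrow> 'a \<Rightarrow> 'a \<Rightarrow> 'a \<times> 'a \<times> 'a \<times> 'a" where
  "tmat \<eta> \<sigma> \<tau> = (\<tau>, - (\<sigma> * \<eta>), \<sigma>, \<sigma> + \<tau>)"

lemma qf_tmat: "qf (tmat \<eta> \<sigma> \<tau>) x y = \<sigma> * nrm \<eta> x y"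
  by (simp add: tmat_def nrm_def algebra_simps)

lemma mem_mline: "x \<in> mline (a, b, c, d) \<longleftrightarrow> x $ 3 = a * x $ 1 + b * x $ 2 \<and> x $ 4 = c * x $ 1 + d * x $ 2"
  by (auto simp: join_def vec4_eq_iff algebra_simps)

lemma mem_pline: "x \<in> pline s y \<longleftrightarrow> x $ 2 = x $ 1 * y \<and> x $ 4 = x $ 3 * y + x $ 1 * s"
  by (auto simp: pline_def join_def vec4_eq_iff algebra_simps)

lemma mem_pline_inf: "x \<in> pline_inf s \<longleftrightarrow> x $ 1 = 0 \<and> x $ 3 = - (x $ 2 * s)"
  by (auto simp: pline_inf_def join_def vec4_eq_iff algebra_simps)

lemma mline_in_pg_lines: "mline M \<in> pg_lines"
  by (cases M) (auto simp: vec4_eq_iff intro!: join_line)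

lemma pline_in_pg_lines: "pline s y \<in> pg_lines" "pline_inf s \<in> pg_lines"
  by (auto simp: pline_def pline_inf_def vec4_eq_iff intro!: join_line)

lemma not_sub_zeroI: "x \<in> A \<Longrightarrow> x \<noteq> (0 :: 'a::zero ^ 4) \<Longrightarrow> \<not> A \<subseteq> {0}"
  by auto

text \<open>A common nonzero vector has the form (v, M v) = (v, M' v). Thus M - M' kills v, and
  det(v, M v) = det(v, M' v).\<close>

lemma mline_meets_mline:
  assumes "\<not> mline M \<inter> mline M' \<subseteq> {0}"
  shows "sing M M'" "\<exists>x y. (x \<noteq> 0 \<or> y \<noteq> 0) \<and> qf M x y = qf M' x y"
proof -
  obtain a b c d where M: "M = (a, b, c, d)" by (cases M)
  obtain a' b' c' d' where M': "M' = (a', b', c', d')" by (cases M')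
  obtain z where z: "z \<in> mline M" "z \<in> mline M'" "z \<noteq> 0" using assms by auto
  define x y where "x = z $ 1" and "y = z $ 2"
  have e: "a * x + b * y = a' * x + b' * y" "c * x + d * y = c' * x + d' * y"
    using z by (auto simp: M M' mem_mline x_def y_def simp del: mline.simps)
  have nz: "x \<noteq> 0 \<or> y \<noteq> 0"
    using z by (auto simp: M M' mem_mline x_def y_def vec4_eq_iff simp del: mline.simps)
  define p q r t where "p = a - a'" and "q = b - b'" and "r = c - c'" and "t = d - d'"
  have f: "p * x + q * y = 0" "r * x + t * y = 0"
    using e by (auto simp: p_def q_def r_def t_def algebra_simps)
  \<comment> \<open>The adjugate times the matrix is the determinant, so the determinant annihilates
    the nonzero vector (x, y).\<close>
  have "(p * t - q * r) * x = t * (p * x + q * y) - q * (r * x + t * y)"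
    "(p * t - q * r) * y = p * (r * x + t * y) - r * (p * x + q * y)" by algebra+
  then have "p * t = q * r" using nz f by auto
  then show "sing M M'" by (simp add: M M' p_def q_def r_def t_def)
  have "x * (c * x + d * y) - y * (a * x + b * y) = x * (c' * x + d' * y) - y * (a' * x + b' * y)"
    using e by simp
  then have "qf M x y = qf M' x y" by (simp add: M M' algebra_simps)
  then show "\<exists>x y. (x \<noteq> 0 \<or> y \<noteq> 0) \<and> qf M x y = qf M' x y" using nz by blast
qed

lemma sing_meets:
  assumes "sing M M'"
  shows "\<not> mline M \<inter> mline M' \<subseteq> {0}"
proof -
  obtain a b c d where M: "M = (a, b, c, d)" by (cases M)
  obtain a' b' c' d' where M': "M' = (a', b', c', d')" by (cases M')
  have ex: "\<exists>x y. (x \<noteq> 0 \<or> y \<noteq> 0) \<and> p * x + q * y = 0 \<and> r * x + t * y = 0"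
    if "p * t = q * r" for p q r t :: 'a
  proof (cases "p = 0 \<and> q = 0")
    case True
    then show ?thesis
      \<comment> \<open>The kernel of the row (r, t) contains (t, -r). The default 1 replaces this
        by (1, 0) for the zero matrix.\<close>
      by (intro exI[of _ "if r = 0 \<and> t = 0 then 1 else t"] exI[of _ "- r"]) auto
  next
    case False
    then show ?thesis using that
      by (intro exI[of _ "q"] exI[of _ "- p"]) (auto simp: algebra_simps)
  qed
  obtain x y where xy: "x \<noteq> 0 \<or> y \<noteq> 0" "(a - a') * x + (b - b') * y = 0" "(c - c') * x + (d - d') * y = 0"
    using ex[of "a - a'" "d - d'" "b - b'" "c - c'"] assms by (auto simp: M M')
  show ?thesis
    using xy by (intro not_sub_zeroI[of "vec4 x y (a * x + b * y) (c * x + d * y)"])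
      (auto simp: M M' mem_mline vec4_eq_iff algebra_simps simp del: mline.simps)
qed

text \<open>Agreement of the forms at v makes the image of v under M -
  \<open>tmat \<eta> \<sigma> 0\<close> parallel to v. The factor is the \<tau> to be added as a
  scalar matrix.\<close>

lemma qf_eq_shift:
  assumes "qf M x y = \<sigma> * nrm \<eta> x y" "x \<noteq> 0 \<or> y \<noteq> 0"
  shows "\<exists>\<tau>. \<not> mline M \<inter> mline (tmat \<eta> \<sigma> \<tau>) \<subseteq> {0}"
proof -
  obtain a b c d where M: "M = (a, b, c, d)" by (cases M)
  define u v where "u = a * x + (b + \<sigma> * \<eta>) * y" and "v = (c - \<sigma>) * x + (d - \<sigma>) * y"
  have e: "x * v = y * u"
    using assms(1) by (simp add: M u_def v_def nrm_def algebra_simps)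
  obtain \<tau> where \<tau>: "u = \<tau> * x" "v = \<tau> * y"
  proof (cases "x = 0")
    case True
    then show ?thesis using e assms(2) that[of "v / y"] by auto
  next
    case False
    then show ?thesis using e that[of "u / x"] by (auto simp: field_simps)
  qed
  then show ?thesis using assms(2)
    by (intro exI[of _ \<tau>] not_sub_zeroI[of "vec4 x y (a * x + b * y) (c * x + d * y)"])
      (auto simp: M tmat_def mem_mline vec4_eq_iff u_def v_def algebra_simps simp del: mline.simps)
qed

lemma mline_pline: "\<not> mline M \<inter> pline s y \<subseteq> {0} \<longleftrightarrow> qf M 1 y = s"
proof -
  obtain a b c d where M: "M = (a, b, c, d)" by (cases M)
  show ?thesis
  proof
    assume "\<not> mline M \<inter> pline s y \<subseteq> {0}"
    then obtain z where z: "z \<in> mline M" "z \<in> pline s y" "z \<noteq> 0" by auto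
    then have "z $ 1 \<noteq> 0"
      by (auto simp: M mem_mline mem_pline vec4_eq_iff simp del: mline.simps)
    moreover have "z $ 1 * (c + d * y) = z $ 1 * ((a + b * y) * y + s)"
      using z by (auto simp: M mem_mline mem_pline algebra_simps simp del: mline.simps)
    ultimately have "c + d * y = (a + b * y) * y + s" by simp
    then show "qf M 1 y = s" by (simp add: M algebra_simps)
  next
    assume "qf M 1 y = s"
    then show "\<not> mline M \<inter> pline s y \<subseteq> {0}"
      by (intro not_sub_zeroI[of "vec4 1 y (a + b * y) (c + d * y)"])
        (auto simp: M mem_mline mem_pline vec4_eq_iff algebra_simps simp del: mline.simps)
  qed
qed

lemma mline_pline_inf: "\<not> mline M \<inter> pline_inf s \<subseteq> {0} \<longleftrightarrow> qf M 0 1 = s"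
proof -
  obtain a b c d where M: "M = (a, b, c, d)" by (cases M)
  show ?thesis
  proof
    assume "\<not> mline M \<inter> pline_inf s \<subseteq> {0}"
    then obtain z where z: "z \<in> mline M" "z \<in> pline_inf s" "z \<noteq> 0" by auto
    then have "z $ 2 \<noteq> 0"
      by (auto simp: M mem_mline mem_pline_inf vec4_eq_iff simp del: mline.simps)
    moreover have "z $ 2 * b = z $ 2 * (- s)"
      using z by (auto simp: M mem_mline mem_pline_inf algebra_simps simp del: mline.simps)
    ultimately have "b = - s" by (metis mult_left_cancel)
    then show "qf M 0 1 = s" by (simp add: M)
  next
    assume "qf M 0 1 = s"
    then show "\<not> mline M \<inter> pline_inf s \<subseteq> {0}"
      by (intro not_sub_zeroI[of "vec4 0 1 b d"])
        (auto simp: M mem_mline mem_pline_inf vec4_eq_iff simp del: mline.simps)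
  qed
qed

text \<open>The projection of \<open>L\<close> to the first two coordinates either has a kernel,
  which is a point of the line at infinity, or is bijective, and then \<open>L\<close> is a
  graph.\<close>

lemma pg_line_cases:
  assumes "L \<in> pg_lines"
  obtains x where "x \<in> L" "x \<noteq> 0" "x $ 1 = 0" "x $ 2 = 0" | M where "mline M \<subseteq> L"
proof -
  obtain u v where L: "L = join u v" and ind: "\<And>\<alpha> \<beta>. \<alpha> *s u + \<beta> *s v = 0 \<Longrightarrow> \<alpha> = 0 \<and> \<beta> = 0"
    using line_join[OF assms] by metis
  define D where "D = u $ 1 * v $ 2 - u $ 2 * v $ 1"
  show ?thesis
  proof (cases "D = 0")
    case True
    have "\<exists>\<alpha> \<beta>. (\<alpha> \<noteq> 0 \<or> \<beta> \<noteq> 0) \<and> \<alpha> * u $ 1 + \<beta> * v $ 1 = 0 \<and> \<alpha> * u $ 2 + \<beta> * v $ 2 = 0"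
    proof (cases "u $ 2 = 0 \<and> v $ 2 = 0")
      case T2: True
      then show ?thesis
        by (intro exI[of _ "if u $ 1 = 0 \<and> v $ 1 = 0 then 1 else v $ 1"] exI[of _ "- u $ 1"]) auto
    next
      case False
      then show ?thesis using True
        by (intro exI[of _ "v $ 2"] exI[of _ "- u $ 2"]) (auto simp: D_def algebra_simps)
    qed
    then obtain \<alpha> \<beta> where "\<alpha> \<noteq> 0 \<or> \<beta> \<noteq> 0" "\<alpha> * u $ 1 + \<beta> * v $ 1 = 0" "\<alpha> * u $ 2 + \<beta> * v $ 2 = 0"
      by blast
    then show ?thesis using ind[of \<alpha> \<beta>]
      by (intro that(1)[of "\<alpha> *s u + \<beta> *s v"]) (auto simp: L intro: joinI)
  next
    case False
    \<comment> \<open>Cramer's rule: \<open>e1\<close> and \<open>e2\<close> are the vectors of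
      \<open>L\<close> over the unit vectors (1, 0) and (0, 1).\<close>
    define e1 where "e1 = (v $ 2 / D) *s u + (- u $ 2 / D) *s v"
    define e2 where "e2 = (- v $ 1 / D) *s u + (u $ 1 / D) *s v"
    have c: "e1 $ 1 = 1" "e1 $ 2 = 0" "e2 $ 1 = 0" "e2 $ 2 = 1"
      using False by (simp_all add: e1_def e2_def D_def divide_simps)
    have "mline (e1 $ 3, e2 $ 3, e1 $ 4, e2 $ 4) \<subseteq> L"
    proof
      fix x assume x: "x \<in> mline (e1 $ 3, e2 $ 3, e1 $ 4, e2 $ 4)"
      have "x = x $ 1 *s e1 + x $ 2 *s e2"
        using x by (simp add: vec4_eq_iff c mem_mline algebra_simps del: mline.simps)
      also have "\<dots> = (x $ 1 * (v $ 2 / D) + x $ 2 * (- v $ 1 / D)) *s u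
          + (x $ 1 * (- u $ 2 / D) + x $ 2 * (u $ 1 / D)) *s v"
        by (simp add: e1_def e2_def vec4_eq_iff algebra_simps)
      finally show "x \<in> L" unfolding L by (rule joinI)
    qed
    then show ?thesis by (rule that(2))
  qed
qed

text \<open>\<open>T\<close> gives the families of graphs with forms \<sigma>N, \<open>s\<close> and
  \<open>si\<close> the point lines, \<open>E\<close> the additional graphs. \<open>sT\<close>,
  \<open>EE\<close>, \<open>ET\<close> and \<open>Es\<close> ensure skewness. \<open>cov\<close>
  blocks the lines skew to the line at infinity; all other lines are blocked because each point at
  infinity lies on a point line.\<close>

theorem spread_criterion:
  fixes \<eta> :: "'a::{field,finite}"
  assumes aniso: "\<And>x y. nrm \<eta> x y = 0 \<Longrightarrow> x = 0 \<and> y = 0"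
    and sT: "\<And>\<sigma> y. \<sigma> \<in> T \<Longrightarrow> s y \<noteq> \<sigma> * nrm \<eta> 1 y" "\<And>\<sigma>. \<sigma> \<in> T \<Longrightarrow> si \<noteq> \<sigma> * nrm \<eta> 0 1"
    and EE: "\<And>e e'. e \<in> E \<Longrightarrow> e' \<in> E \<Longrightarrow> sing e e' \<Longrightarrow> e = e'"
    and ET: "\<And>e \<sigma> x y. e \<in> E \<Longrightarrow> \<sigma> \<in> T \<Longrightarrow> qf e x y = \<sigma> * nrm \<eta> x y \<Longrightarrow> x = 0 \<and> y = 0"
    and Es: "\<And>e y. e \<in> E \<Longrightarrow> qf e 1 y \<noteq> s y" "\<And>e. e \<in> E \<Longrightarrow> qf e 0 1 \<noteq> si"
    and cov: "\<And>M. (\<exists>\<sigma>\<in>T. \<exists>x y. (x \<noteq> 0 \<or> y \<noteq> 0) \<and> qf M x y = \<sigma> * nrm \<eta> x y)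
        \<or> (\<exists>y. qf M 1 y = s y) \<or> qf M 0 1 = si \<or> (\<exists>e\<in>E. sing M e)"
    and bound: "card T * CARD('a) + CARD('a) + 1 + card E \<le> CARD('a)\<^sup>2"
  shows "\<exists>S :: ('a ^ 4) set set. maximal_partial_spread S \<and> card S \<le> card T * CARD('a) + CARD('a) + 1 + card E"
proof -
  define A where "A = (\<lambda>(\<sigma>, \<tau>). mline (tmat \<eta> \<sigma> \<tau>)) ` (T \<times> UNIV)"
  define B where "B = range (\<lambda>y. pline (s y) y)"
  define S where "S = A \<union> (mline ` E) \<union> B \<union> {pline_inf si}"
  have "card A \<le> card T * CARD('a)"
    unfolding A_def by (rule order_trans[OF card_image_le]) auto
  moreover have "card B \<le> CARD('a)" unfolding B_def by (rule card_image_le) simp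
  moreover have "card (mline ` E) \<le> card E" by (rule card_image_le) simp
  moreover have "card S \<le> card A + card (mline ` E) + card B + 1"
    unfolding S_def by (intro order_trans[OF card_Un_le] add_mono) auto
  ultimately have cardS: "card S \<le> card T * CARD('a) + CARD('a) + 1 + card E" by linarith
  define G where "G = (\<lambda>(\<sigma>, \<tau>). tmat \<eta> \<sigma> \<tau>) ` (T \<times> UNIV) \<union> E"
  have SG: "S = mline ` G \<union> B \<union> {pline_inf si}"
    unfolding S_def G_def A_def by (auto simp: image_Un image_image case_prod_unfold)
  have GG: "mline g \<inter> mline g' \<subseteq> {0}" if gg: "g \<in> G" "g' \<in> G" "g \<noteq> g'" for g g'
  proof (rule ccontr)
    assume m: "\<not> ?thesis"
    have sg: "sing g g'" and ex: "\<exists>x y. (x \<noteq> 0 \<or> y \<noteq> 0) \<and> qf g x y = qf g' x y"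
      using mline_meets_mline[OF m] by auto
    then obtain x y where xy: "x \<noteq> 0 \<or> y \<noteq> 0" "qf g x y = qf g' x y" by blast
    from gg(1) consider (t) \<sigma> \<tau> where "\<sigma> \<in> T" "g = tmat \<eta> \<sigma> \<tau>" | (e) "g \<in> E"
      unfolding G_def by auto
    then show False
    proof cases
      case t
      from gg(2) consider (t') \<sigma>' \<tau>' where "\<sigma>' \<in> T" "g' = tmat \<eta> \<sigma>' \<tau>'" | (e') "g' \<in> E"
        unfolding G_def by auto
      then show False
      proof cases
        case t'
        have "\<sigma> = \<sigma>'" using xy t t' aniso[of x y] by (auto simp: qf_tmat)
        \<comment> \<open>Graphs with equal forms differ by the scalar matrix \<tau> - \<tau>',
          which is singular only when zero.\<close>
        with sg t t' have "(\<tau> - \<tau>') * (\<tau> - \<tau>') = 0" by (simp add: tmat_def)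
        with \<open>\<sigma> = \<sigma>'\<close> t t' gg show False by simp
      next
        case e'
        then show False using ET[OF e' \<open>\<sigma> \<in> T\<close>, of x y] xy t by (auto simp: qf_tmat)
      qed
    next
      case e
      from gg(2) consider (t') \<sigma>' \<tau>' where "\<sigma>' \<in> T" "g' = tmat \<eta> \<sigma>' \<tau>'" | (e') "g' \<in> E"
        unfolding G_def by auto
      then show False
      proof cases
        case t'
        then show False using ET[OF e, of \<sigma>' x y] xy by (auto simp: qf_tmat)
      next
        case e'
        then show False using EE[OF e e' sg] gg by simp
      qed
    qed
  qed
  have GB: "mline g \<inter> pline (s y) y \<subseteq> {0}" "mline g \<inter> pline_inf si \<subseteq> {0}" if "g \<in> G" for g y
  proof -
    have "qf g 1 y \<noteq> s y \<and> qf g 0 1 \<noteq> si"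
    proof (cases "g \<in> E")
      case True
      then show ?thesis using Es by simp
    next
      case False
      then obtain \<sigma> \<tau> where "\<sigma> \<in> T" "g = tmat \<eta> \<sigma> \<tau>" using \<open>g \<in> G\<close> unfolding G_def by auto
      then show ?thesis using sT[of \<sigma>] by (metis qf_tmat)
    qed
    then show "mline g \<inter> pline (s y) y \<subseteq> {0}" "mline g \<inter> pline_inf si \<subseteq> {0}"
      using mline_pline mline_pline_inf by blast+
  qed
  have BB: "pline a y \<inter> pline b y' \<subseteq> {0}" if "y \<noteq> y'" for a b y y' :: 'a
    using that by (auto simp: mem_pline vec4_eq_iff)
  have BI: "pline a y \<inter> pline_inf b \<subseteq> {0}" for a b y :: 'a
    by (auto simp: mem_pline mem_pline_inf vec4_eq_iff)
  have "maximal_partial_spread S"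
  proof (rule maximal_partial_spreadI)
    show "S \<subseteq> pg_lines"
      unfolding SG B_def using mline_in_pg_lines pline_in_pg_lines by auto
    show "L \<inter> M \<subseteq> {0}" if LM: "L \<in> S" "M \<in> S" "L \<noteq> M" for L M
    proof -
      have gg: "L \<inter> M \<subseteq> {0}" if "L \<in> mline ` G" "M \<in> mline ` G" "L \<noteq> M" for L M
        using that GG by blast
      have gb: "L \<inter> M \<subseteq> {0}" if "L \<in> mline ` G" "M \<in> B \<union> {pline_inf si}" for L M
        using that GB unfolding B_def by blast
      have bb: "L \<inter> M \<subseteq> {0}" if LM: "L \<in> B" "M \<in> B" "L \<noteq> M" for L M
      proof -
        obtain y y' where "L = pline (s y) y" "M = pline (s y') y'" using LM unfolding B_def by auto
        then show ?thesis using LM BB[of y y'] by blast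
      qed
      have bi: "L \<inter> pline_inf si \<subseteq> {0}" if "L \<in> B" for L
        using that BI unfolding B_def by blast
      have L: "L \<in> mline ` G \<or> L \<in> B \<or> L = pline_inf si" and M: "M \<in> mline ` G \<or> M \<in> B \<or> M = pline_inf si"
        using LM unfolding SG by blast+
      have "L \<inter> M \<subseteq> {0} \<or> M \<inter> L \<subseteq> {0}"
        using L M
      proof (elim disjE)
        assume "L \<in> mline ` G" "M \<in> mline ` G"
        then show ?thesis using gg LM by simp
      next
        assume "L \<in> B" "M \<in> B"
        then show ?thesis using bb LM by simp
      qed (use gb bi LM in simp_all)
      then show ?thesis by (simp add: Int_commute)
    qed
    show "card S < CARD('a)\<^sup>2 + 1" using cardS bound by linarith
    show "\<exists>M\<in>S. \<not> L \<inter> M \<subseteq> {0}" if L: "L \<in> pg_lines" for L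
      using L
    proof (cases rule: pg_line_cases)
      case (1 x)
      \<comment> \<open>The point (0, 0, x3, x4) at infinity belongs to the direction (1, x4/x3), or
        to (0, 1) if x3 = 0.\<close>
      have "x \<in> (if x $ 3 = 0 then pline_inf si else pline (s (x $ 4 / x $ 3)) (x $ 4 / x $ 3))"
        using 1 by (auto simp: mem_pline mem_pline_inf)
      moreover have "(if x $ 3 = 0 then pline_inf si else pline (s (x $ 4 / x $ 3)) (x $ 4 / x $ 3)) \<in> S"
        unfolding SG B_def by auto
      ultimately show ?thesis using 1 by blast
    next
      case (2 M)
      have "\<exists>M'\<in>S. \<not> mline M \<inter> M' \<subseteq> {0}"
      proof -
        show ?thesis
          using cov[of M]
        proof (elim disjE bexE exE)
          fix \<sigma> x y assume \<sigma>: "\<sigma> \<in> T" and xy: "(x \<noteq> 0 \<or> y \<noteq> 0) \<and> qf M x y = \<sigma> * nrm \<eta> x y"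
          obtain \<tau> where "\<not> mline M \<inter> mline (tmat \<eta> \<sigma> \<tau>) \<subseteq> {0}"
            using qf_eq_shift[of M x y \<sigma> \<eta>] xy by blast
          then show ?thesis using \<sigma> unfolding S_def A_def
            by (intro bexI[of _ "mline (tmat \<eta> \<sigma> \<tau>)"]) auto
        next
          fix y assume "qf M 1 y = s y"
          then have "\<not> mline M \<inter> pline (s y) y \<subseteq> {0}" by (simp only: mline_pline)
          then show ?thesis unfolding S_def B_def by blast
        next
          assume "qf M 0 1 = si"
          then have "\<not> mline M \<inter> pline_inf si \<subseteq> {0}" by (simp only: mline_pline_inf)
          then show ?thesis unfolding S_def by blast
        next
          fix e assume "e \<in> E" "sing M e"
          then show ?thesis using sing_meets unfolding S_def by blast
        qed
      qed
      then show ?thesis using 2 by blast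
    qed
  qed
  then show ?thesis using cardS by blast
qed

section \<open>The norm form\<close>

text \<open>The \<omega>-coordinate of b v^2 for b = w + u \<omega> and v = x + y \<omega>. Here v^2
  has coordinates x^2 - \<eta>y^2 and 2xy + y^2.\<close>

definition tau :: "'a::field \<Rightarrow> 'a \<Rightarrow> 'a \<Rightarrow> 'a \<Rightarrow> 'a \<Rightarrow> 'a" where
  "tau \<eta> u w x y = u * (x * x - \<eta> * y * y) + (u + w) * (2 * x * y + y * y)"

text \<open>The matrix with upper left entry a and form t N(v) + \<tau>(b v^2). As a varies, this
  runs through all matrices with that form.\<close>

definition umat :: "'a::field \<Rightarrow> 'a \<Rightarrow> 'a \<Rightarrow> 'a \<Rightarrow> 'a \<Rightarrow> 'a \<times> 'a \<times> 'a \<times> 'a" where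
  "umat \<eta> a t u w = (a, - (\<eta> * t - \<eta> * u + u + w), t + u, a + (t + 2 * (u + w)))"

lemma qf_umat: "qf (umat \<eta> a t u w) x y = t * nrm \<eta> x y + tau \<eta> u w x y"
  by (simp add: umat_def nrm_def tau_def algebra_simps)

text \<open>Finding t, u, w from the coefficients of the form is a linear system governed by the
  discriminant D = 1 - 4\<eta>. It is nonzero because N(-1, 2) = 4\<eta> - 1.\<close>

lemma umat_exhaust:
  assumes aniso: "\<And>x y. nrm \<eta> x y = 0 \<Longrightarrow> x = 0 \<and> y = 0"
  obtains a t u w where "M = umat \<eta> a t u w"
proof -
  obtain a b c d where M: "M = (a, b, c, d)" by (cases M)
  define D where "D = 1 - 4 * \<eta>"
  have D: "D \<noteq> 0" using aniso[of "-1" 2] by (auto simp: nrm_def D_def)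
  define n where "n = - 2 * b - (d - a) - (2 * \<eta> - 1) * c"
  define u where "u = n / D"
  define t where "t = c - u"
  define w where "w = - b - \<eta> * t + \<eta> * u - u"
  have uD: "u * D = n" using D by (simp add: u_def)
  have "t + 2 * (u + w) = d - a" using uD unfolding n_def D_def t_def w_def by algebra
  then have "M = umat \<eta> a t u w" by (simp add: M umat_def t_def w_def)
  then show ?thesis by (rule that)
qed

text \<open>Since v^2 = N(v) v/v', with v' the conjugate, the equation says that b v/v' has
  \<omega>-coordinate d. By Hilbert 90 the elements b v/v' are exactly those with norm N(b), in
  particular Z = z + d \<omega>. The proof uses explicit v with v/v' = Z/b.\<close>

lemma tau_eq:
  assumes aniso: "\<And>x y. nrm \<eta> x y = 0 \<Longrightarrow> x = 0 \<and> y = 0"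
    and nz: "u \<noteq> 0 \<or> w \<noteq> 0" and N: "nrm \<eta> z d = nrm \<eta> w u"
  shows "\<exists>x y. (x \<noteq> 0 \<or> y \<noteq> 0) \<and> tau \<eta> u w x y = d * nrm \<eta> x y"
proof (cases "d = u \<and> z = - w - u")
  case False
  \<comment> \<open>The witness is v = Z + b': then v b = Z b + N(b) = Z v', using N(Z) =
    N(b).\<close>
  have "tau \<eta> u w (z + w + u) (d - u) = d * nrm \<eta> (z + w + u) (d - u)"
    using N unfolding tau_def nrm_def by algebra
  moreover have "z + w + u \<noteq> 0 \<or> d - u \<noteq> 0" using False by (auto simp: algebra_simps eq_neg_iff_add_eq_0)
  ultimately show ?thesis by blast
next
  case True
  \<comment> \<open>Now Z = -b' and the previous witness vanishes. Instead v = b'(1 - 2\<omega>),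
    where 1 - 2\<omega> is the negative of its conjugate.\<close>
  have "tau \<eta> u w (w + u - 2 * \<eta> * u) (- (2 * w + u)) = u * nrm \<eta> (w + u - 2 * \<eta> * u) (- (2 * w + u))"
    unfolding tau_def nrm_def by algebra
  moreover have "w + u - 2 * \<eta> * u \<noteq> 0 \<or> - (2 * w + u) \<noteq> 0"
  proof (rule ccontr)
    assume a: "\<not> ?thesis"
    then have u: "u = - 2 * w" by (metis add.commute add_eq_0_iff mult_minus_left neg_equal_0_iff_equal)
    have "w * (4 * \<eta> - 1) = 0" using a unfolding u by (auto simp: algebra_simps)
    moreover have "4 * \<eta> - 1 \<noteq> 0" using aniso[of "-1" 2] by (auto simp: nrm_def)
    ultimately show False using nz u by auto
  qed
  ultimately show ?thesis using True by blast
qed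

text \<open>The form t N(v) + \<tau>(b v^2) meets \<sigma>N iff \<tau>(b v^2) = (\<sigma> - t) N(v)
  for some nonzero v, and \<open>tau_eq\<close> supplies such a v from a norm equation. The case b =
  0 consists of the multiples tN: those with t outside \<open>T\<close> are left to the point lines
  by \<open>surj\<close>.\<close>

theorem spread_criterion_norm:
  fixes \<eta> :: "'a::{field,finite}"
  assumes aniso: "\<And>x y. nrm \<eta> x y = 0 \<Longrightarrow> x = 0 \<and> y = 0"
    and sT: "\<And>\<sigma> y. \<sigma> \<in> T \<Longrightarrow> s y \<noteq> \<sigma> * nrm \<eta> 1 y" "\<And>\<sigma>. \<sigma> \<in> T \<Longrightarrow> si \<noteq> \<sigma> * nrm \<eta> 0 1"
    and surj: "\<And>t. t \<notin> T \<Longrightarrow> (\<exists>y. t * nrm \<eta> 1 y = s y) \<or> t * nrm \<eta> 0 1 = si"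
    and EE: "\<And>e e'. e \<in> E \<Longrightarrow> e' \<in> E \<Longrightarrow> sing e e' \<Longrightarrow> e = e'"
    and ET: "\<And>e \<sigma> x y. e \<in> E \<Longrightarrow> \<sigma> \<in> T \<Longrightarrow> qf e x y = \<sigma> * nrm \<eta> x y \<Longrightarrow> x = 0 \<and> y = 0"
    and Es: "\<And>e y. e \<in> E \<Longrightarrow> qf e 1 y \<noteq> s y" "\<And>e. e \<in> E \<Longrightarrow> qf e 0 1 \<noteq> si"
    and cov: "\<And>t u w. u \<noteq> 0 \<or> w \<noteq> 0 \<Longrightarrow> (\<exists>\<sigma>\<in>T. \<exists>z. nrm \<eta> z (\<sigma> - t) = nrm \<eta> w u)
        \<or> (\<exists>y. t * nrm \<eta> 1 y + tau \<eta> u w 1 y = s y) \<or> t * nrm \<eta> 0 1 + tau \<eta> u w 0 1 = si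
        \<or> (\<forall>a. \<exists>e\<in>E. sing (umat \<eta> a t u w) e)"
    and bound: "card T * CARD('a) + CARD('a) + 1 + card E \<le> CARD('a)\<^sup>2"
  shows "\<exists>S :: ('a ^ 4) set set. maximal_partial_spread S \<and> card S \<le> card T * CARD('a) + CARD('a) + 1 + card E"
proof (rule spread_criterion[OF aniso sT EE ET Es _ bound])
  fix M
  obtain a t u w where M: "M = umat \<eta> a t u w" using umat_exhaust[OF aniso] .
  show "(\<exists>\<sigma>\<in>T. \<exists>x y. (x \<noteq> 0 \<or> y \<noteq> 0) \<and> qf M x y = \<sigma> * nrm \<eta> x y)
        \<or> (\<exists>y. qf M 1 y = s y) \<or> qf M 0 1 = si \<or> (\<exists>e\<in>E. sing M e)"
  proof (cases "u = 0 \<and> w = 0")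
    case True
    then have qM: "qf M x y = t * nrm \<eta> x y" for x y by (simp add: M qf_umat tau_def)
    show ?thesis
    proof (cases "t \<in> T")
      case True
      then show ?thesis by (intro disjI1 bexI[of _ t] exI[of _ 1]) (auto simp: qM)
    next
      case False
      then show ?thesis using surj[of t] by (auto simp: qM)
    qed
  next
    case False
    then have nz: "u \<noteq> 0 \<or> w \<noteq> 0" by simp
    from cov[OF nz, of t] show ?thesis
    proof (elim disjE bexE exE)
      fix \<sigma> z assume "\<sigma> \<in> T" "nrm \<eta> z (\<sigma> - t) = nrm \<eta> w u"
      then obtain x y where xy: "x \<noteq> 0 \<or> y \<noteq> 0" "tau \<eta> u w x y = (\<sigma> - t) * nrm \<eta> x y"
        using tau_eq[OF aniso nz] by blast
      then have "qf M x y = \<sigma> * nrm \<eta> x y" by (simp add: M qf_umat algebra_simps)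
      then show ?thesis using xy \<open>\<sigma> \<in> T\<close> by blast
    qed (auto simp: M qf_umat)
  qed
qed

corollary spread_criterion_cover:
  fixes \<eta> :: "'a::{field,finite}"
  assumes aniso: "\<And>x y. nrm \<eta> x y = 0 \<Longrightarrow> x = 0 \<and> y = 0"
    and cov: "\<And>t \<rho>. \<rho> \<noteq> 0 \<Longrightarrow> \<exists>\<sigma>\<in>T. \<exists>z. nrm \<eta> z (\<sigma> - t) = \<rho>"
    and bound: "card T * CARD('a) + CARD('a) + 1 \<le> CARD('a)\<^sup>2"
  shows "\<exists>S :: ('a ^ 4) set set. maximal_partial_spread S \<and> card S \<le> card T * CARD('a) + CARD('a) + 1"
proof -
  have "T \<noteq> UNIV" using bound by (auto simp: power2_eq_square)
  then obtain t0 where t0: "t0 \<notin> T" by auto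
  \<comment> \<open>Off \<open>T\<close> the map is the identity, so the point line for (1, t)
    blocks tN. On \<open>T\<close> the default t0 keeps the point line skew to all the
    graphs.\<close>
  define h where "h y = (if y \<in> T then t0 else y)" for y
  have hT: "h y \<notin> T" for y using t0 by (simp add: h_def)
  have n1: "nrm \<eta> 1 y \<noteq> 0" "nrm \<eta> 0 1 \<noteq> 0" for y using aniso[of 1 y] aniso[of 0 1] by auto
  have "\<exists>S :: ('a ^ 4) set set. maximal_partial_spread S \<and>
      card S \<le> card T * CARD('a) + CARD('a) + 1 + card ({} :: ('a \<times> 'a \<times> 'a \<times> 'a) set)"
  proof (rule spread_criterion_norm[where s = "\<lambda>y. h y * nrm \<eta> 1 y" and si = "t0 * nrm \<eta> 0 1", OF aniso])
    fix t \<sigma> y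
    show "h y * nrm \<eta> 1 y \<noteq> \<sigma> * nrm \<eta> 1 y" if "\<sigma> \<in> T" using that hT[of y] n1(1)[of y] by auto
    show "t0 * nrm \<eta> 0 1 \<noteq> \<sigma> * nrm \<eta> 0 1" if "\<sigma> \<in> T" using that t0 n1(2) by auto
    show "(\<exists>y. t * nrm \<eta> 1 y = h y * nrm \<eta> 1 y) \<or> t * nrm \<eta> 0 1 = t0 * nrm \<eta> 0 1" if "t \<notin> T"
      using that by (intro disjI1 exI[of _ t]) (simp add: h_def)
  next
    fix t u w :: 'a assume "u \<noteq> 0 \<or> w \<noteq> 0"
    then have "nrm \<eta> w u \<noteq> 0" using aniso by blast
    then show "(\<exists>\<sigma>\<in>T. \<exists>z. nrm \<eta> z (\<sigma> - t) = nrm \<eta> w u)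
        \<or> (\<exists>y. t * nrm \<eta> 1 y + tau \<eta> u w 1 y = h y * nrm \<eta> 1 y) \<or> t * nrm \<eta> 0 1 + tau \<eta> u w 0 1 = t0 * nrm \<eta> 0 1
        \<or> (\<forall>a. \<exists>e\<in>{}. sing (umat \<eta> a t u w) e)"
      using cov by simp
  qed (use bound in auto)
  then show ?thesis by simp
qed

section \<open>Arithmetic in finite fields\<close>

text \<open>Multiplication by a permutes the nonzero elements; cancel their product.\<close>

lemma finite_field_power_card_minus_1:
  fixes a :: "'a::{field,finite}"
  assumes "a \<noteq> 0"
  shows "a ^ (CARD('a) - 1) = 1"
proof -
  have b: "bij_betw ((*) a) (UNIV - {0}) (UNIV - {0})"
    using assms by (intro bij_betwI[of _ _ _ "\<lambda>x. x / a"]) auto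
  have "(\<Prod>x\<in>UNIV - {0}. a * x) = (\<Prod>x\<in>UNIV - {0}. x)"
    using prod.reindex_bij_betw[OF b, of "\<lambda>x. x"] by simp
  then have "a ^ (CARD('a) - 1) * (\<Prod>x\<in>UNIV - {0 :: 'a}. x) = (\<Prod>x\<in>UNIV - {0}. x)"
    by (simp add: prod.distrib card_Diff_singleton)
  moreover have "(\<Prod>x\<in>UNIV - {0 :: 'a}. x) \<noteq> 0" by (subst prod_zero_iff) auto
  ultimately show ?thesis by simp
qed

text \<open>Translation by 1 permutes the field; compare the sums of all elements.\<close>

lemma of_nat_card_eq_0: "of_nat (CARD('a::{field,finite})) = (0 :: 'a)"
proof -
  have "(\<Sum>x\<in>UNIV. x + 1) = (\<Sum>x\<in>UNIV. (x :: 'a))"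
    using sum.reindex_bij_betw[OF bij_plus_right[of 1], of "\<lambda>x. x"] by simp
  then show ?thesis by (simp add: sum.distrib)
qed

lemma char_of_card:
  assumes "CARD('a::{field,finite}) = p ^ n"
  shows "of_nat p = (0 :: 'a)"
  using of_nat_card_eq_0[where 'a = 'a] by (simp add: assms)

section \<open>Arithmetic on digit lists\<close>

text \<open>
  An element \<open>\<Sum>i<n. c\<^sub>i x\<^sup>i\<close> of the field with \<open>p\<^sup>n\<close> elements is coded by the digit list \<open>[c\<^sub>0, \<dots>, c\<^sub>n\<^sub>-\<^sub>1]\<close>;
  \<open>g\<close> is the code of \<open>x\<^sup>n\<close>, and \<open>x\<close> is primitive.
\<close>

fun madd :: "nat \<Rightarrow> nat \<Rightarrow> nat \<Rightarrow> nat" where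
  "madd p x y = (let s = x + y in if s < p then s else s - p)"

fun ladd :: "nat \<Rightarrow> nat list \<Rightarrow> nat list \<Rightarrow> nat list" where
  "ladd p (x # xs) (y # ys) = madd p x y # ladd p xs ys"
| "ladd p xs ys = []"

text \<open>For y = 0 the second summand is p itself, which a single conditional subtraction in
  \<open>madd\<close> still reduces correctly.\<close>

fun lsub :: "nat \<Rightarrow> nat list \<Rightarrow> nat list \<Rightarrow> nat list" where
  "lsub p (x # xs) (y # ys) = madd p x (p - y) # lsub p xs ys"
| "lsub p xs ys = []"

fun lscale :: "nat \<Rightarrow> nat \<Rightarrow> nat list \<Rightarrow> nat list" where
  "lscale p 0 xs = map (\<lambda>_. 0) xs"
| "lscale p (Suc c) xs = ladd p xs (lscale p c xs)"

text \<open>Multiplication by x: the digits move up one place, and the top digit re-enters as a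
  multiple of x^n, that is, of \<open>g\<close>.\<close>

definition lshift :: "nat \<Rightarrow> nat list \<Rightarrow> nat list \<Rightarrow> nat list" where
  "lshift p g xs = ladd p (0 # butlast xs) (lscale p (last xs) g)"

fun lmul :: "nat \<Rightarrow> nat list \<Rightarrow> nat list \<Rightarrow> nat list \<Rightarrow> nat list" where
  "lmul p g [] ys = map (\<lambda>_. 0) ys"
| "lmul p g (x # xs) ys = ladd p (lscale p x ys) (lshift p g (lmul p g xs ys))"

fun digits :: "nat \<Rightarrow> nat \<Rightarrow> nat list list" where
  "digits p 0 = [[]]"
| "digits p (Suc n) = concat (map (\<lambda>xs. map (\<lambda>d. d # xs) [0..<p]) (digits p n))"

fun orbit :: "nat \<Rightarrow> nat list \<Rightarrow> nat \<Rightarrow> nat list \<Rightarrow> nat list list" where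
  "orbit p g 0 xs = [xs]"
| "orbit p g (Suc k) xs = xs # orbit p g k (lshift p g xs)"

text \<open>Evaluation is defined over commutative rings because it is used both at a root in the
  field and at the indeterminate of the polynomial ring.\<close>

fun ev :: "'r::comm_ring_1 \<Rightarrow> nat list \<Rightarrow> 'r" where
  "ev x [] = 0"
| "ev x (d # ds) = of_nat d + x * ev x ds"

definition codes :: "nat \<Rightarrow> nat \<Rightarrow> nat list set" where
  "codes p n = {xs. length xs = n \<and> (\<forall>x\<in>set xs. x < p)}"

lemma set_digits: "set (digits p n) = codes p n"
proof (induction n)
  case (Suc n)
  have "codes p (Suc n) = (\<Union>xs\<in>codes p n. (\<lambda>d. d # xs) ` {0..<p})"
    by (auto simp: codes_def length_Suc_conv)
  then show ?case using Suc by simp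
qed (auto simp: codes_def)

lemma card_codes: "card (codes p n) = p ^ n"
proof -
  have "codes p n = {xs. set xs \<subseteq> {..<p} \<and> length xs = n}" by (auto simp: codes_def)
  then show ?thesis using card_lists_length_eq[of "{..<p}" n] by simp
qed

lemma length_digits: "length (digits p n) = p ^ n"
  by (induction n) (simp_all add: length_concat o_def sum_list_triv)

lemma distinct_digits: "distinct (digits p n)"
  by (rule card_distinct) (simp add: set_digits card_codes length_digits)

context
  fixes p :: nat and x :: "'r::comm_ring_1"
  assumes char: "of_nat p = (0 :: 'r)"
begin

lemma of_nat_madd: "of_nat (madd p a b) = of_nat a + (of_nat b :: 'r)"
proof (cases "a + b < p")
  case False
  then have "of_nat (madd p a b) + of_nat p = (of_nat (a + b) :: 'r)"
    by (simp add: Let_def flip: of_nat_add)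
  then show ?thesis by (simp add: char)
qed (simp add: Let_def)

lemma of_nat_madd_minus: "b \<le> p \<Longrightarrow> of_nat (madd p a (p - b)) = of_nat a - (of_nat b :: 'r)"
  by (simp add: of_nat_madd of_nat_diff char del: madd.simps)

lemma ev_ladd: "length xs = length ys \<Longrightarrow> ev x (ladd p xs ys) = ev x xs + ev x ys"
  by (induction xs ys rule: list_induct2) (simp_all add: of_nat_madd algebra_simps del: madd.simps)

lemma ev_lsub: "length xs = length ys \<Longrightarrow> \<forall>y\<in>set ys. y < p \<Longrightarrow> ev x (lsub p xs ys) = ev x xs - ev x ys"
  by (induction xs ys rule: list_induct2) (simp_all add: of_nat_madd_minus right_diff_distrib del: madd.simps)

lemma ev_zero: "ev x (map (\<lambda>_. 0) xs) = 0"
  by (induction xs) auto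

lemma length_ladd [simp]: "length (ladd p xs ys) = min (length xs) (length ys)"
  by (induction p xs ys rule: ladd.induct) auto

lemma length_lscale [simp]: "length (lscale p c xs) = length xs"
  by (induction c) auto

lemma ev_lscale: "ev x (lscale p c xs) = of_nat c * ev x xs"
  by (induction c) (simp_all add: ev_zero ev_ladd algebra_simps)

lemma ev_butlast_last: "xs \<noteq> [] \<Longrightarrow> ev x xs = ev x (butlast xs) + of_nat (last xs) * x ^ (length xs - 1)"
proof (induction xs)
  case (Cons a xs)
  show ?case
  proof (cases "xs = []")
    case False
    then have "x ^ length xs = x * x ^ (length xs - 1)" by (cases xs) auto
    then show ?thesis using Cons False by (simp add: algebra_simps)
  qed simp
qed simp

text \<open>The error term is kept explicit: it vanishes at a root of X^n - g and gives a congruence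
  modulo this polynomial when no root is known yet.\<close>

lemma ev_lshift:
  assumes "length xs = length g" "g \<noteq> []"
  shows "ev x (lshift p g xs) = x * ev x xs - of_nat (last xs) * (x ^ length g - ev x g)"
proof -
  have xs: "xs \<noteq> []" using assms by auto
  have "x ^ length g = x * x ^ (length xs - 1)"
    using assms by (cases g) auto
  then show ?thesis
    using assms ev_butlast_last[OF xs]
    by (simp add: lshift_def ev_ladd ev_lscale algebra_simps)
qed

end

lemma madd_less: "x < p \<Longrightarrow> y \<le> p \<Longrightarrow> madd p x y < p"
  by (auto simp: Let_def)

lemma codes_0: "xs \<in> codes p 0 \<longleftrightarrow> xs = []"
  by (auto simp: codes_def)

lemma codes_Suc: "xs \<in> codes p (Suc n) \<longleftrightarrow> (\<exists>y ys. xs = y # ys \<and> y < p \<and> ys \<in> codes p n)"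
  by (auto simp: codes_def length_Suc_conv)

lemma ladd_codes: "xs \<in> codes p n \<Longrightarrow> ys \<in> codes p n \<Longrightarrow> ladd p xs ys \<in> codes p n"
  by (induction n arbitrary: xs ys) (auto simp: codes_0 codes_Suc madd_less simp del: madd.simps)

lemma lsub_codes: "xs \<in> codes p n \<Longrightarrow> ys \<in> codes p n \<Longrightarrow> lsub p xs ys \<in> codes p n"
  by (induction n arbitrary: xs ys) (auto simp: codes_0 codes_Suc madd_less simp del: madd.simps)

lemma madd_eq_0: "x < p \<Longrightarrow> y < p \<Longrightarrow> madd p x (p - y) = 0 \<Longrightarrow> x = y"
  by (auto simp: Let_def split: if_splits)

lemma lsub_zero:
  "xs \<in> codes p n \<Longrightarrow> ys \<in> codes p n \<Longrightarrow> \<forall>z\<in>set (lsub p xs ys). z = 0 \<Longrightarrow> xs = ys"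
  by (induction n arbitrary: xs ys) (auto simp: codes_0 codes_Suc madd_eq_0 simp del: madd.simps)

lemma lzero_codes: "0 < p \<Longrightarrow> xs \<in> codes p n \<Longrightarrow> map (\<lambda>_. 0) xs \<in> codes p n"
  by (auto simp: codes_def)

lemma lscale_codes: "0 < p \<Longrightarrow> xs \<in> codes p n \<Longrightarrow> lscale p c xs \<in> codes p n"
  by (induction c) (simp_all add: lzero_codes ladd_codes)

lemma lshift_codes:
  assumes "0 < p" "g \<in> codes p n" "xs \<in> codes p n" "0 < n"
  shows "lshift p g xs \<in> codes p n"
proof -
  have "0 # butlast xs \<in> codes p n"
    using assms by (auto simp: codes_def dest: in_set_butlastD)
  then show ?thesis using assms by (simp add: lshift_def ladd_codes lscale_codes)
qed

lemma lmul_codes: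
  assumes "0 < p" "g \<in> codes p n" "0 < n" "ys \<in> codes p n"
  shows "lmul p g xs ys \<in> codes p n"
  using assms by (induction xs) (simp_all add: lzero_codes ladd_codes lscale_codes lshift_codes)

lemma ev_lmul:
  fixes x :: "'r::comm_ring_1"
  assumes char: "of_nat p = (0 :: 'r)" and root: "x ^ n = ev x g"
    and "0 < p" "g \<in> codes p n" "0 < n" "ys \<in> codes p n"
  shows "ev x (lmul p g xs ys) = ev x xs * ev x ys"
proof (induction xs)
  case (Cons a xs)
  have l: "length (lmul p g xs ys) = length g" "length ys = length g" "length g = n" "g \<noteq> []"
    using lmul_codes[OF assms(3-6), of xs] assms by (auto simp: codes_def)
  moreover have "length (lshift p g (lmul p g xs ys)) = length g"
    using lshift_codes[OF assms(3,4) lmul_codes[OF assms(3-6)] assms(5)] l by (auto simp: codes_def)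
  moreover have "ev x (lshift p g (lmul p g xs ys)) = x * ev x (lmul p g xs ys)"
    using ev_lshift[OF char l(1,4)] l root by simp
  ultimately show ?case using Cons
    by (simp add: ev_ladd[OF char] ev_lscale[OF char] length_lscale[OF char] algebra_simps)
qed (simp add: ev_zero[OF char])

definition lone :: "nat \<Rightarrow> nat list" where "lone n = 1 # replicate (n - 1) 0"

lemma lone_codes: "1 < p \<Longrightarrow> 0 < n \<Longrightarrow> lone n \<in> codes p n"
  by (auto simp: codes_def lone_def)

lemma ev_lone [simp]: "ev x (lone n) = 1"
proof -
  have "ev x (replicate k 0) = 0" for k by (induction k) auto
  then show ?thesis by (simp add: lone_def)
qed


lemma orbit_not_Nil: "orbit p g k xs \<noteq> []"
  by (cases k) auto

lemma ev_orbit: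
  fixes x :: "'r::comm_ring_1"
  assumes char: "of_nat p = (0 :: 'r)" and root: "x ^ n = ev x g"
    and "0 < p" "g \<in> codes p n" "0 < n"
  shows "xs \<in> codes p n \<Longrightarrow> c \<in> set (orbit p g k xs) \<Longrightarrow> \<exists>i. ev x c = x ^ i * ev x xs"
proof (induction k arbitrary: xs)
  case 0
  then show ?case by (auto intro: exI[of _ 0])
next
  case (Suc k)
  have l: "length xs = length g" "g \<noteq> []" "length g = n" using Suc.prems assms by (auto simp: codes_def)
  have s: "ev x (lshift p g xs) = x * ev x xs" using ev_lshift[OF char l(1,2)] l root by simp
  have "c = xs \<or> c \<in> set (orbit p g k (lshift p g xs))" using Suc.prems by auto
  then show ?case
  proof
    assume "c = xs"
    then show ?thesis by (auto intro: exI[of _ 0])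
  next
    assume "c \<in> set (orbit p g k (lshift p g xs))"
    then obtain i where "ev x c = x ^ i * ev x (lshift p g xs)"
      using Suc.IH[OF lshift_codes[OF assms(3,4) Suc.prems(1) assms(5)]] by blast
    then have "ev x c = x ^ Suc i * ev x xs" by (simp add: s)
    then show ?thesis by blast
  qed
qed

text \<open>Each shift is multiplication by x up to a multiple of x^n - g, so k shifts compute x^k
  times the start modulo x^n - g.\<close>

lemma ev_last_orbit:
  fixes x :: "'r::comm_ring_1"
  assumes char: "of_nat p = (0 :: 'r)"
    and "0 < p" "g \<in> codes p n" "0 < n"
  shows "xs \<in> codes p n \<Longrightarrow> (x ^ n - ev x g) dvd (x ^ k * ev x xs - ev x (last (orbit p g k xs)))"
proof (induction k arbitrary: xs)
  case (Suc k)
  have l: "length xs = length g" "g \<noteq> []" "length g = n" using Suc.prems assms by (auto simp: codes_def)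
  have s: "ev x (lshift p g xs) = x * ev x xs - of_nat (last xs) * (x ^ n - ev x g)"
    using ev_lshift[OF char l(1,2)] l by simp
  have "(x ^ n - ev x g) dvd (x ^ k * ev x (lshift p g xs) - ev x (last (orbit p g k (lshift p g xs))))"
    by (rule Suc.IH[OF lshift_codes[OF assms(2,3) Suc.prems assms(4)]])
  then have "(x ^ n - ev x g) dvd (x ^ k * ev x (lshift p g xs) - ev x (last (orbit p g k (lshift p g xs)))
      + x ^ k * of_nat (last xs) * (x ^ n - ev x g))"
    by (rule dvd_add) simp
  then show ?case by (simp add: s orbit_not_Nil algebra_simps)
qed simp

section \<open>A root of the chosen polynomial in an arbitrary field of the right size\<close>

lemma poly_ev: "poly (ev [:0, 1:] xs) a = ev (a :: 'a::comm_ring_1) xs"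
  by (induction xs) (auto simp: of_nat_poly)

lemma degree_ev: "xs \<noteq> [] \<Longrightarrow> degree (ev [:0, 1 :: 'a::comm_ring_1:] xs) < length xs"
proof (induction xs)
  case (Cons d xs)
  have e: "ev [:0, 1 :: 'a:] (d # xs) = pCons (of_nat d) (ev [:0, 1:] xs)"
    by (simp add: of_nat_poly)
  show ?case
  proof (cases "xs = []")
    case False
    then show ?thesis unfolding e using Cons by (auto intro: le_less_trans[OF degree_pCons_le])
  qed (simp add: e)
qed simp

text \<open>Because the orbit of 1 returns after q - 1 shifts, G = X^n - g divides X^(q-1) - 1, say
  with cofactor H. Every nonzero field element is a root of the product; if G had no root, H would
  have q - 1 roots, exceeding its degree q - 1 - n. Irreducibility of G never enters.\<close>

lemma primitive_root_exists:
  assumes card: "CARD('a::{field,finite}) = p ^ n" and "1 < p" "0 < n" and g: "g \<in> codes p n"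
    and last: "last (orbit p g (p ^ n - 1) (lone n)) = lone n"
  shows "\<exists>x :: 'a. x ^ n = ev x g"
proof -
  let ?X = "[:0, 1 :: 'a:]"
  define G where "G = ?X ^ n - ev ?X g"
  have char: "of_nat p = (0 :: 'a)" by (rule char_of_card[OF card])
  then have "of_nat p = (0 :: 'a poly)" by (simp add: of_nat_poly)
  then have "G dvd ?X ^ (p ^ n - 1) * ev ?X (lone n) - ev ?X (last (orbit p g (p ^ n - 1) (lone n)))"
    unfolding G_def using assms by (intro ev_last_orbit) (auto simp: lone_codes)
  then obtain H where H: "?X ^ (p ^ n - 1) - 1 = G * H" unfolding last by auto
  have pn: "1 < p ^ n" using assms by (intro one_less_power) auto
  have X: "?X ^ k = monom 1 k" for k by (simp add: monom_altdef)
  have dg: "degree (ev ?X g) < n" using degree_ev[of g] g \<open>0 < n\<close> by (auto simp: codes_def)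
  have dG: "degree G = n"
    unfolding G_def X diff_conv_add_uminus
    using dg by (subst degree_add_eq_left) (simp_all add: degree_monom_eq)
  have "degree (?X ^ (p ^ n - 1) - 1) = p ^ n - 1"
    unfolding X diff_conv_add_uminus using pn by (subst degree_add_eq_left) (simp_all add: degree_monom_eq)
  moreover have nz: "?X ^ (p ^ n - 1) - 1 \<noteq> 0" using calculation pn by force
  ultimately have dH: "n + degree H = p ^ n - 1"
    using H dG by (metis degree_mult_eq mult_eq_0_iff)
  have H0: "H \<noteq> 0" using nz H by auto
  show ?thesis
  proof (rule ccontr)
    assume no: "\<not> ?thesis"
    have "UNIV - {0} \<subseteq> {a. poly H a = 0}"
    proof
      fix a :: 'a assume "a \<in> UNIV - {0}"
      then have "poly (?X ^ (p ^ n - 1) - 1) a = 0"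
        using finite_field_power_card_minus_1[of a] by (simp add: card)
      moreover have "poly G a \<noteq> 0" using no by (auto simp: G_def poly_ev)
      ultimately show "a \<in> {a. poly H a = 0}" unfolding H by simp
    qed
    then have "card (UNIV - {0 :: 'a}) \<le> card {a. poly H a = 0}" by (intro card_mono) auto
    also have "\<dots> \<le> degree H" by (rule card_poly_roots_bound[OF H0])
    finally show False using dH \<open>0 < n\<close> pn by (simp add: card card_Diff_singleton)
  qed
qed

text \<open>The interface between computation and the abstract field. The operations on codes are
  constrained on \<open>C\<close> only.\<close>

locale coded_field =
  fixes \<phi> :: "'c \<Rightarrow> 'a::{field,finite}" and C :: "'c list" and add sub mul :: "'c \<Rightarrow> 'c \<Rightarrow> 'c" and zero one :: 'c
  assumes bij: "bij_betw \<phi> (set C) UNIV" and dist: "distinct C"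
    and zero: "zero \<in> set C" "\<phi> zero = 0" and one: "one \<in> set C" "\<phi> one = 1"
    and add: "\<And>a b. a \<in> set C \<Longrightarrow> b \<in> set C \<Longrightarrow> add a b \<in> set C \<and> \<phi> (add a b) = \<phi> a + \<phi> b"
    and sub: "\<And>a b. a \<in> set C \<Longrightarrow> b \<in> set C \<Longrightarrow> sub a b \<in> set C \<and> \<phi> (sub a b) = \<phi> a - \<phi> b"
    and mul: "\<And>a b. a \<in> set C \<Longrightarrow> b \<in> set C \<Longrightarrow> mul a b \<in> set C \<and> \<phi> (mul a b) = \<phi> a * \<phi> b"

text \<open>A nonzero code lies in the orbit of 1, so it evaluates to a power of x and hence not to
  0. Applied to differences this gives injectivity; counting p^n codes gives surjectivity.\<close>

lemma coded_field_lists: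
  assumes card: "CARD('a::{field,finite}) = p ^ n" and p: "1 < p" and n: "0 < n" and g: "g \<in> codes p n"
    and last: "last (orbit p g (p ^ n - 1) (lone n)) = lone n"
    and all: "set (digits p n) \<subseteq> insert (replicate n 0) (set (orbit p g (p ^ n - 1) (lone n)))"
  shows "\<exists>\<phi> :: nat list \<Rightarrow> 'a. coded_field \<phi> (digits p n) (ladd p) (lsub p) (lmul p g) (replicate n 0) (lone n)"
proof -
  obtain x :: 'a where x: "x ^ n = ev x g" using primitive_root_exists[OF card p n g last] by blast
  have char: "of_nat p = (0 :: 'a)" by (rule char_of_card[OF card])
  have p0: "0 < p" using p by simp
  have z: "ev x (replicate k 0) = 0" for k by (induction k) auto
  have zc: "replicate n 0 \<in> codes p n" using p by (auto simp: codes_def)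
  have C: "set (digits p n) = codes p n" by (rule set_digits)
  have "(x ^ n - ev x g) dvd (x ^ (p ^ n - 1) * ev x (lone n) - ev x (lone n))"
    using ev_last_orbit[OF char p0 g n lone_codes[OF p n], of x "p ^ n - 1"] unfolding last .
  then have "x ^ (p ^ n - 1) = 1" by (simp add: x)
  moreover have "p ^ n - 1 \<noteq> 0" using p n by (metis diff_is_0_eq linorder_not_le one_less_power)
  ultimately have x0: "x \<noteq> 0" by (metis power_0_left zero_neq_one)
  have inj: "a = b" if "a \<in> codes p n" "b \<in> codes p n" "ev x a = ev x b" for a b
  proof -
    have "ev x (lsub p a b) = 0" using that ev_lsub[OF char, of a b x] by (auto simp: codes_def)
    moreover have s: "lsub p a b \<in> codes p n" using that by (simp add: lsub_codes)
    ultimately have "lsub p a b \<notin> set (orbit p g (p ^ n - 1) (lone n))"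
      using ev_orbit[OF char x p0 g n lone_codes[OF p n]] x0 by fastforce
    then have "lsub p a b = replicate n 0" using all s C by auto
    then show ?thesis using lsub_zero[OF that(1,2)] by simp
  qed
  have "bij_betw (ev x) (codes p n) UNIV"
    unfolding bij_betw_def
  proof
    show i: "inj_on (ev x) (codes p n)" using inj by (auto simp: inj_on_def)
    have "card (ev x ` codes p n) = CARD('a)" using card_image[OF i] by (simp add: card card_codes)
    then show "ev x ` codes p n = UNIV" by (simp add: card_subset_eq)
  qed
  then show ?thesis
    using ev_ladd[OF char, of _ _ x] ev_lsub[OF char, of _ _ x] ev_lmul[OF char x p0 g n]
    by (intro exI[of _ "ev x"])
      (auto simp: coded_field_def C distinct_digits z zc lone_codes[OF p n] ladd_codes lsub_codes lmul_codes[OF p0 g n],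
        auto simp: codes_def)
qed


definition iadd :: "int \<Rightarrow> int \<Rightarrow> int \<Rightarrow> int" where "iadd p a b = (a + b) mod p"
definition isub :: "int \<Rightarrow> int \<Rightarrow> int \<Rightarrow> int" where "isub p a b = (a - b) mod p"
definition imul :: "int \<Rightarrow> int \<Rightarrow> int \<Rightarrow> int" where "imul p a b = (a * b) mod p"

text \<open>p vanishes in a field with p elements, so by Bezout an integer prime to p has nonzero
  image. Thus residues embed, and counting makes the embedding onto.\<close>

lemma coded_field_int:
  assumes card: "CARD('a::{field,finite}) = nat p" and p: "prime p"
  shows "coded_field (of_int :: int \<Rightarrow> 'a) [0..p - 1] (iadd p) (isub p) (imul p) 0 1"
proof -
  have p1: "1 < p" using p by (rule prime_gt_1_int)
  have char: "of_int p = (0 :: 'a)"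
    using of_nat_card_eq_0[where 'a = 'a] p1 card by (simp add: of_nat_nat)
  have m: "of_int (a mod p) = (of_int a :: 'a)" for a
  proof -
    have "of_int (p * (a div p) + a mod p) = (of_int a :: 'a)" by simp
    then show ?thesis by (simp only: of_int_add of_int_mult char) simp
  qed
  have nz: "of_int i \<noteq> (0 :: 'a)" if "\<not> p dvd i" for i
  proof
    assume i: "of_int i = (0 :: 'a)"
    have "coprime p i" using p that by (rule prime_imp_coprime)
    then obtain u v where "u * p + v * i = 1" using bezout_int[of p i] by auto
    then have "of_int (u * p + v * i) = (1 :: 'a)" by simp
    then show False by (simp add: char i)
  qed
  have inj: "inj_on (of_int :: int \<Rightarrow> 'a) {0..p - 1}"
  proof
    fix i j assume ij: "i \<in> {0..p - 1}" "j \<in> {0..p - 1}" "of_int i = (of_int j :: 'a)"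
    then have "p dvd i - j" using nz[of "i - j"] by auto
    then have "i mod p = j mod p" by (simp add: mod_eq_dvd_iff)
    then show "i = j" using ij by simp
  qed
  have "card ((of_int :: int \<Rightarrow> 'a) ` {0..p - 1}) = CARD('a)"
    using card_image[OF inj] by (simp add: card)
  then have "(of_int :: int \<Rightarrow> 'a) ` {0..p - 1} = UNIV" by (simp add: card_subset_eq)
  then show ?thesis using inj p1
    by (unfold_locales) (auto simp: bij_betw_def m pos_mod_bound pos_mod_sign iadd_def isub_def imul_def)
qed

section \<open>Executable criteria\<close>

text \<open>
  The auxiliary functions \<open>_if\<close> branch on an evaluated Boolean argument.  This gives short-circuit evaluation
  under \<open>code_simp\<close>; with \<open>if\<close> the simplifier would traverse the data in the branches again at every step.
\<close>

fun lmem :: "'c \<Rightarrow> 'c list \<Rightarrow> bool"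
  and lmem_if where
  "lmem x [] = False"
| "lmem x (y # ys) = lmem_if (x = y) x ys"
| "lmem_if True _ _ = True"
| "lmem_if False x ys = lmem x ys"

text \<open>For proofs the \<open>if\<close> form replaces the auxiliary function, which remains the
  form used in evaluation. The same pattern recurs for the later \<open>_if\<close>
  functions.\<close>

lemma lmem_Cons [simp]: "lmem x (y # ys) = (if x = y then True else lmem x ys)"
  by simp

declare lmem.simps(2) [simp del]

lemma lmem_iff: "lmem x xs \<longleftrightarrow> x \<in> set xs"
  by (induction xs) auto

fun lmem_any :: "'c \<Rightarrow> 'c list list \<Rightarrow> bool"
  and lmem_any_if where
  "lmem_any x [] = False"
| "lmem_any x (r # rs) = lmem_any_if (lmem x r) x rs"
| "lmem_any_if True _ _ = True"
| "lmem_any_if False x rs = lmem_any x rs"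

lemma lmem_any_Cons [simp]: "lmem_any x (r # rs) = (if lmem x r then True else lmem_any x rs)"
  by simp

declare lmem_any.simps(2) [simp del]

lemma lmem_any_iff: "lmem_any x rs \<longleftrightarrow> (\<exists>r\<in>set rs. x \<in> set r)"
  by (induction rs) (auto simp: lmem_iff)

fun covered :: "'c list \<Rightarrow> 'c list list \<Rightarrow> bool" where
"covered [] rs \<longleftrightarrow> True"
| "covered (x # xs) rs \<longleftrightarrow>
    lmem_any x rs \<and> covered xs rs"

lemma covered_iff: "covered xs rs \<longleftrightarrow> (\<forall>x\<in>set xs. \<exists>r\<in>set rs. x \<in> set r)"
  by (induction xs) (auto simp: lmem_any_iff)

fun subset_list :: "'c list \<Rightarrow> 'c list \<Rightarrow> bool" where
"subset_list [] ys \<longleftrightarrow> True"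
| "subset_list (x # xs) ys \<longleftrightarrow>
    lmem x ys \<and> subset_list xs ys"

lemma subset_list_iff: "subset_list xs ys \<longleftrightarrow> set xs \<subseteq> set ys"
  by (induction xs) (auto simp: lmem_iff)

context coded_field
begin

definition dec :: "'a \<Rightarrow> 'c" where "dec = inv_into (set C) \<phi>"

lemma dec: "dec x \<in> set C" "\<phi> (dec x) = x"
  using bij unfolding dec_def bij_betw_def by (metis UNIV_I inv_into_into, metis UNIV_I f_inv_into_f)

lemma phi_eq_iff: "a \<in> set C \<Longrightarrow> b \<in> set C \<Longrightarrow> \<phi> a = \<phi> b \<longleftrightarrow> a = b"
  using bij unfolding bij_betw_def by (meson inj_on_eq_iff)

lemmas ops = zero one add sub mul

end

definition nrmc :: "('c \<Rightarrow> 'c \<Rightarrow> 'c) \<Rightarrow> ('c \<Rightarrow> 'c \<Rightarrow> 'c) \<Rightarrow> 'c \<Rightarrow> 'c \<Rightarrow> 'c \<Rightarrow> 'c" where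
  "nrmc add mul \<eta> x y = add (mul x (add x y)) (mul \<eta> (mul y y))"

fun nonzeros :: "'c \<Rightarrow> 'c list \<Rightarrow> 'c list"
  and nonzeros_if where
  "nonzeros z [] = []"
| "nonzeros z (c # cs) = nonzeros_if (c = z) z c cs"
| "nonzeros_if True z _ cs = nonzeros z cs"
| "nonzeros_if False z c cs = c # nonzeros z cs"

lemma nonzeros_Cons [simp]: "nonzeros z (c # cs) = (if c = z then nonzeros z cs else c # nonzeros z cs)"
  by simp

declare nonzeros.simps(2) [simp del]

lemma set_nonzeros: "set (nonzeros z cs) = set cs - {z}"
  by (induction cs) auto

fun norms_with :: "('c \<Rightarrow> 'c \<Rightarrow> 'c) \<Rightarrow> ('c \<Rightarrow> 'c \<Rightarrow> 'c) \<Rightarrow> 'c \<Rightarrow> 'c \<Rightarrow> 'c list \<Rightarrow> 'c list" where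
  "norms_with add mul \<eta> d [] = []"
| "norms_with add mul \<eta> d (w # ws) = nrmc add mul \<eta> w d # norms_with add mul \<eta> d ws"

lemma norms_with_eq: "norms_with add mul \<eta> d ws = map (\<lambda>w. nrmc add mul \<eta> w d) ws"
  by (induction ws) auto

definition anisoc :: "('c \<Rightarrow> 'c \<Rightarrow> 'c) \<Rightarrow> ('c \<Rightarrow> 'c \<Rightarrow> 'c) \<Rightarrow> 'c \<Rightarrow> 'c \<Rightarrow> 'c \<Rightarrow> 'c list \<Rightarrow> bool" where
  "anisoc add mul zero one \<eta> C \<longleftrightarrow> lmem \<eta> C \<and> \<not> lmem zero (norms_with add mul \<eta> one C)"

lemma (in coded_field) nrmc:
  assumes "\<eta> \<in> set C" "x \<in> set C" "y \<in> set C"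
  shows "nrmc add mul \<eta> x y \<in> set C" "\<phi> (nrmc add mul \<eta> x y) = nrm (\<phi> \<eta>) (\<phi> x) (\<phi> y)"
  using assms by (simp_all add: nrmc_def nrm_def ops algebra_simps)

text \<open>By homogeneity N(x,y) = y^2 N(x/y, 1) for y \<noteq> 0, so only second coordinate 1 has
  to be tested.\<close>

lemma (in coded_field) anisoc:
  assumes "anisoc add mul zero one \<eta> C" "nrm (\<phi> \<eta>) x y = 0"
  shows "x = 0 \<and> y = 0"
proof (cases "y = 0")
  case True
  then show ?thesis using assms by (simp add: nrm_def)
next
  case False
  have \<eta>: "\<eta> \<in> set C" using assms by (simp add: anisoc_def lmem_iff)
  have "nrm (\<phi> \<eta>) x y = y * y * nrm (\<phi> \<eta>) (x / y) 1"
    using False by (simp add: nrm_def field_simps)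
  then have "nrm (\<phi> \<eta>) (x / y) 1 = 0" using assms False by simp
  then have "\<phi> (nrmc add mul \<eta> (dec (x / y)) one) = \<phi> zero"
    using \<eta> dec[of "x / y"] by (simp add: nrmc ops)
  then have "nrmc add mul \<eta> (dec (x / y)) one = zero"
    using \<eta> dec nrmc by (subst (asm) phi_eq_iff) (auto simp: ops)
  then show ?thesis using assms dec[of "x / y"] by (force simp: anisoc_def lmem_iff norms_with_eq)
qed

section \<open>Checking the norm conditions on \<open>T\<close> alone\<close>

fun images_sub :: "('c \<Rightarrow> 'c \<Rightarrow> 'c) \<Rightarrow> ('c \<Rightarrow> 'c list) \<Rightarrow> 'c \<Rightarrow> 'c list \<Rightarrow> 'c list list" where
  "images_sub sub R t [] = []"
| "images_sub sub R t (\<sigma> # T) = R (sub \<sigma> t) # images_sub sub R t T"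

lemma set_images_sub: "set (images_sub sub R t T) = (\<lambda>\<sigma>. R (sub \<sigma> t)) ` set T"
  by (induction T) auto

text \<open>\<open>R d\<close> is meant to list norms of elements with \<omega>-coordinate d;
  \<open>cs\<close> will be the nonzero \<rho>.\<close>

fun cover_all :: "('c \<Rightarrow> 'c \<Rightarrow> 'c) \<Rightarrow> ('c \<Rightarrow> 'c list) \<Rightarrow> 'c list \<Rightarrow> 'c list \<Rightarrow> 'c list \<Rightarrow> bool" where
"cover_all sub R T cs [] \<longleftrightarrow> True"
| "cover_all sub R T cs (t # ts) \<longleftrightarrow>
    covered cs (images_sub sub R t T) \<and> cover_all sub R T cs ts"

lemma cover_all_iff: "cover_all sub R T cs ts \<longleftrightarrow> (\<forall>t\<in>set ts. \<forall>x\<in>set cs. \<exists>\<sigma>\<in>set T. x \<in> set (R (sub \<sigma> t)))"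
  by (induction ts) (auto simp: covered_iff set_images_sub)

fun lsums :: "('c \<Rightarrow> 'c \<Rightarrow> 'c) \<Rightarrow> 'c list \<Rightarrow> 'c list \<Rightarrow> 'c list" where
  "lsums add xs [] = []"
| "lsums add xs (y # ys) = map (add y) xs @ lsums add xs ys"

lemma set_lsums: "set (lsums add xs ys) = (\<Union>y\<in>set ys. add y ` set xs)"
  by (induction ys) auto

text \<open>\<open>hs\<close> lists translations that preserve \<open>T\<close>, so only the representatives \<open>ts\<close> modulo \<open>hs\<close> need a check.\<close>

lemma (in coded_field) cover_all:
  assumes an: "anisoc add mul zero one \<eta> C"
    and R: "\<And>d r. d \<in> set C \<Longrightarrow> r \<in> set (R d) \<Longrightarrow> \<exists>w. nrm (\<phi> \<eta>) w (\<phi> d) = \<phi> r"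
    and T: "subset_list T C" and hs: "subset_list hs C" "subset_list (lsums add hs T) T"
    and ts: "subset_list ts C" "subset_list C (lsums add hs ts)"
    and cov: "cover_all sub R T (nonzeros zero C) ts"
    and bound: "length T * CARD('a) + CARD('a) + 1 \<le> CARD('a)\<^sup>2"
  shows "\<exists>S :: ('a ^ 4) set set. maximal_partial_spread S \<and> card S \<le> length T * CARD('a) + CARD('a) + 1"
proof -
  have T: "set T \<subseteq> set C" using T by (simp add: subset_list_iff)
  have cT: "card (\<phi> ` set T) \<le> length T"
    using card_image_le[of "set T" \<phi>] card_length[of T] by simp
  then have cT': "card (\<phi> ` set T) * CARD('a) + CARD('a) + 1 \<le> length T * CARD('a) + CARD('a) + 1" by simp
  have an': "\<And>x y. nrm (\<phi> \<eta>) x y = 0 \<Longrightarrow> x = 0 \<and> y = 0" using anisoc[OF an] by blast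
  have "\<exists>S :: ('a ^ 4) set set. maximal_partial_spread S \<and> card S \<le> card (\<phi> ` set T) * CARD('a) + CARD('a) + 1"
  proof (rule spread_criterion_cover[OF an'])
    fix t \<rho> :: 'a assume \<rho>: "\<rho> \<noteq> 0"
    then have \<rho>0: "dec \<rho> \<in> set (nonzeros zero C)" using dec[of \<rho>] zero by (auto simp: set_nonzeros)
    have "dec t \<in> set (lsums add hs ts)" using ts dec[of t] by (auto simp: subset_list_iff)
    then obtain t' h where th: "t' \<in> set ts" "h \<in> set hs" "dec t = add t' h"
      unfolding set_lsums by auto
    have C: "t' \<in> set C" "h \<in> set C" using th ts hs by (auto simp: subset_list_iff)
    obtain \<sigma> where \<sigma>: "\<sigma> \<in> set T" "dec \<rho> \<in> set (R (sub \<sigma> t'))"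
      using cov th \<rho>0 unfolding cover_all_iff by blast
    have \<sigma>C: "\<sigma> \<in> set C" using \<sigma> T by auto
    then obtain w where w: "nrm (\<phi> \<eta>) w (\<phi> (sub \<sigma> t')) = \<rho>"
      using R[OF _ \<sigma>(2)] C sub dec[of \<rho>] by metis
    have "\<phi> (add \<sigma> h) - t = \<phi> (sub \<sigma> t')"
      using th(3) C \<sigma>C dec[of t] by (metis add add_diff_cancel_right sub)
    moreover have "add \<sigma> h \<in> set T"
      using hs(2) \<sigma>(1) th(2) by (auto simp: subset_list_iff set_lsums)
    ultimately show "\<exists>\<sigma>\<in>\<phi> ` set T. \<exists>z. nrm (\<phi> \<eta>) z (\<sigma> - t) = \<rho>"
      using w by (metis imageI)
  qed (assumption | rule order_trans[OF cT' bound])+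
  then show ?thesis using cT' by (meson order_trans)
qed

section \<open>Listing the norms with a given \<omega>-coordinate, in odd and in even
  characteristic\<close>

fun squares :: "('c \<Rightarrow> 'c \<Rightarrow> 'c) \<Rightarrow> 'c list \<Rightarrow> 'c list" where
  "squares mul [] = []"
| "squares mul (w # ws) = mul w w # squares mul ws"

lemma squares_eq: "squares mul ws = map (\<lambda>w. mul w w) ws"
  by (induction ws) auto

fun dedup :: "'c list \<Rightarrow> 'c list \<Rightarrow> 'c list"
  and dedup_if where
  "dedup acc [] = acc"
| "dedup acc (x # xs) = dedup_if (lmem x acc) acc x xs"
| "dedup_if True acc _ xs = dedup acc xs"
| "dedup_if False acc x xs = dedup (x # acc) xs"

lemma dedup_Cons [simp]: "dedup acc (x # xs) = (if lmem x acc then dedup acc xs else dedup (x # acc) xs)"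
  by simp

declare dedup.simps(2) [simp del]

lemma set_dedup: "set (dedup acc xs) = set acc \<union> set xs"
  by (induction xs arbitrary: acc) (auto simp: lmem_iff)

text \<open>Completing the square: with d = 2h one has N(v - h, d) = v^2 + (4\<eta> - 1) h^2 and
  \<kappa> = \<eta> - 1/4. The hypothesis rules out characteristic 2, where it would read 1 =
  0.\<close>

lemma nrm_complete_square:
  assumes k: "4 * \<kappa> + 1 = 4 * (\<eta> :: 'a::field)"
  shows "\<exists>w. nrm \<eta> w d = \<kappa> * d * d + v * v"
proof -
  have "(2 :: 'a) \<noteq> 0"
  proof
    assume "(2 :: 'a) = 0"
    then have "(4 :: 'a) = 0" by (metis mult_2 mult_zero_left numeral_Bit0)
    then show False using k by simp
  qed
  then obtain h where h: "d = h + h" by (metis mult_2 nonzero_mult_div_cancel_left times_divide_eq_right)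
  have "4 * \<eta> * h * h = (4 * \<kappa> + 1) * h * h" using k by simp
  then have "nrm \<eta> (v - h) d = \<kappa> * d * d + v * v" unfolding nrm_def h by (simp add: algebra_simps)
  then show ?thesis by blast
qed

definition norms_odd :: "('c \<Rightarrow> 'c \<Rightarrow> 'c) \<Rightarrow> ('c \<Rightarrow> 'c \<Rightarrow> 'c) \<Rightarrow> 'c \<Rightarrow> 'c list \<Rightarrow> 'c \<Rightarrow> 'c list" where
  "norms_odd add mul \<kappa> sq d = map (add (mul \<kappa> (mul d d))) sq"

lemma (in coded_field) norms_odd:
  assumes "\<eta> \<in> set C" "\<kappa> \<in> set C" "add (add (add \<kappa> \<kappa>) (add \<kappa> \<kappa>)) one = add (add \<eta> \<eta>) (add \<eta> \<eta>)"
    and "d \<in> set C" "r \<in> set (norms_odd add mul \<kappa> (dedup [] (squares mul C)) d)"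
  shows "\<exists>w. nrm (\<phi> \<eta>) w (\<phi> d) = \<phi> r"
proof -
  have "\<phi> (add (add (add \<kappa> \<kappa>) (add \<kappa> \<kappa>)) one) = \<phi> (add (add \<eta> \<eta>) (add \<eta> \<eta>))" using assms by simp
  then have k: "4 * \<phi> \<kappa> + 1 = 4 * \<phi> \<eta>" using assms(1,2) by (simp add: ops)
  obtain v where v: "v \<in> set C" "r = add (mul \<kappa> (mul d d)) (mul v v)"
    using assms(5) by (auto simp: norms_odd_def set_dedup squares_eq)
  then have r: "\<phi> r = \<phi> \<kappa> * \<phi> d * \<phi> d + \<phi> v * \<phi> v" using assms by (simp add: ops)
  show ?thesis unfolding r by (rule nrm_complete_square[OF k])
qed

text \<open>\<open>r\<close> is kept as a coset of the span collected so far; a vector is skipped if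
  translating the first entry by it stays in \<open>r\<close>. In characteristic 2 a new vector
  doubles the coset.\<close>

fun lspan :: "('c \<Rightarrow> 'c \<Rightarrow> 'c) \<Rightarrow> 'c list \<Rightarrow> 'c list \<Rightarrow> 'c list"
  and lspan_if where
  "lspan add r [] = r"
| "lspan add r (v # vs) = lspan_if (lmem (add (hd r) v) r) add r v vs"
| "lspan_if True add r _ vs = lspan add r vs"
| "lspan_if False add r v vs = lspan add (r @ map (add v) r) vs"

lemma lspan_Cons [simp]: "lspan add r (v # vs) = (if lmem (add (hd r) v) r then lspan add r vs else lspan add (r @ map (add v) r) vs)"
  by simp

declare lspan.simps(2) [simp del]

text \<open>The values b^2 + bd. In characteristic 2 this expression is additive in b, so a basis
  \<open>bs\<close> determines all of them.\<close>

fun shifted :: "('c \<Rightarrow> 'c \<Rightarrow> 'c) \<Rightarrow> ('c \<Rightarrow> 'c \<Rightarrow> 'c) \<Rightarrow> 'c \<Rightarrow> 'c list \<Rightarrow> 'c list" where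
  "shifted add mul d [] = []"
| "shifted add mul d (b # bs) = mul b (add b d) # shifted add mul d bs"

definition norms_even :: "('c \<Rightarrow> 'c \<Rightarrow> 'c) \<Rightarrow> ('c \<Rightarrow> 'c \<Rightarrow> 'c) \<Rightarrow> 'c \<Rightarrow> 'c list \<Rightarrow> 'c \<Rightarrow> 'c list" where
  "norms_even add mul \<eta> bs d = lspan add [mul \<eta> (mul d d)] (shifted add mul d bs)"

text \<open>In characteristic 2, N(w + b, d) = N(w, d) + b(b + d). Starting from N(0, d) =
  \<eta>d^2, translations by the values b(b + d) therefore stay among the norms.\<close>

lemma (in coded_field) norms_even:
  assumes \<eta>: "\<eta> \<in> set C" and char: "add one one = zero" and bs: "subset_list bs C"
    and d: "d \<in> set C" and r: "r \<in> set (norms_even add mul \<eta> bs d)"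
  shows "\<exists>w. nrm (\<phi> \<eta>) w (\<phi> d) = \<phi> r"
proof -
  have "\<phi> (add one one) = \<phi> zero" using char by simp
  then have two: "(2 :: 'a) = 0" by (simp add: ops)
  have span: "set bs \<subseteq> set C \<Longrightarrow> \<forall>x\<in>set rs. x \<in> set C \<and> (\<exists>w. nrm (\<phi> \<eta>) w (\<phi> d) = \<phi> x) \<Longrightarrow>
      \<forall>x\<in>set (lspan add rs (shifted add mul d bs)). \<exists>w. nrm (\<phi> \<eta>) w (\<phi> d) = \<phi> x" for bs rs
  proof (induction bs arbitrary: rs)
    case (Cons b bs)
    define v where "v = mul b (add b d)"
    have b: "b \<in> set C" using Cons.prems by simp
    have vC: "v \<in> set C" "\<phi> v = \<phi> b * (\<phi> b + \<phi> d)"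
      using b d by (simp_all add: v_def ops)
    have shift: "add v x \<in> set C \<and> (\<exists>w. nrm (\<phi> \<eta>) w (\<phi> d) = \<phi> (add v x))" if x: "x \<in> set rs" for x
    proof -
      have xC: "x \<in> set C" using Cons.prems x by blast
      obtain w where w: "nrm (\<phi> \<eta>) w (\<phi> d) = \<phi> x" using Cons.prems x by blast
      have "nrm (\<phi> \<eta>) (w + \<phi> b) (\<phi> d) = \<phi> v + nrm (\<phi> \<eta>) w (\<phi> d) + 2 * w * \<phi> b"
        by (simp add: nrm_def vC algebra_simps)
      then have "nrm (\<phi> \<eta>) (w + \<phi> b) (\<phi> d) = \<phi> (add v x)"
        using vC xC w two by (simp add: ops)
      then show ?thesis using vC xC ops by blast
    qed
    have rs: "\<forall>x\<in>set rs. x \<in> set C \<and> (\<exists>w. nrm (\<phi> \<eta>) w (\<phi> d) = \<phi> x)" and bs: "set bs \<subseteq> set C"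
      using Cons.prems by simp_all
    then have "\<forall>x\<in>set (rs @ map (add v) rs). x \<in> set C \<and> (\<exists>w. nrm (\<phi> \<eta>) w (\<phi> d) = \<phi> x)"
      using shift by (simp add: ball_Un)
    from Cons.IH[OF bs this] Cons.IH[OF bs rs] show ?case
      by (simp add: v_def[symmetric])
  qed simp
  have "\<exists>w. nrm (\<phi> \<eta>) w (\<phi> d) = \<phi> (mul \<eta> (mul d d))"
    using \<eta> d by (intro exI[of _ 0]) (simp add: nrm_def ops)
  then show ?thesis
    using span[of bs "[mul \<eta> (mul d d)]"] r bs \<eta> d by (simp add: norms_even_def subset_list_iff ops)
qed

definition cover_ok :: "('c \<Rightarrow> 'c \<Rightarrow> 'c) \<Rightarrow> ('c \<Rightarrow> 'c \<Rightarrow> 'c) \<Rightarrow> ('c \<Rightarrow> 'c list) \<Rightarrow> 'c \<Rightarrow> 'c list \<Rightarrow> 'c list \<Rightarrow> 'c list \<Rightarrow> 'c list \<Rightarrow> bool" where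
  "cover_ok add sub R zero C T hs ts \<longleftrightarrow> subset_list T C \<and> subset_list hs C \<and> subset_list (lsums add hs T) T \<and>
    subset_list ts C \<and> subset_list C (lsums add hs ts) \<and> cover_all sub R T (nonzeros zero C) ts"

definition cover_ok_odd :: "('c \<Rightarrow> 'c \<Rightarrow> 'c) \<Rightarrow> ('c \<Rightarrow> 'c \<Rightarrow> 'c) \<Rightarrow> ('c \<Rightarrow> 'c \<Rightarrow> 'c) \<Rightarrow> 'c \<Rightarrow> 'c \<Rightarrow> 'c list \<Rightarrow> 'c \<Rightarrow> 'c \<Rightarrow> 'c list \<Rightarrow> 'c list \<Rightarrow> 'c list \<Rightarrow> bool" where
  "cover_ok_odd add sub mul zero one C \<eta> \<kappa> T hs ts \<longleftrightarrow>
    anisoc add mul zero one \<eta> C \<and> lmem \<kappa> C \<and>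
    add (add (add \<kappa> \<kappa>) (add \<kappa> \<kappa>)) one = add (add \<eta> \<eta>) (add \<eta> \<eta>) \<and>
    cover_ok add sub (norms_odd add mul \<kappa> (dedup [] (squares mul C))) zero C T hs ts"

definition cover_ok_even :: "('c \<Rightarrow> 'c \<Rightarrow> 'c) \<Rightarrow> ('c \<Rightarrow> 'c \<Rightarrow> 'c) \<Rightarrow> ('c \<Rightarrow> 'c \<Rightarrow> 'c) \<Rightarrow> 'c \<Rightarrow> 'c \<Rightarrow> 'c list \<Rightarrow> 'c \<Rightarrow> 'c list \<Rightarrow> 'c list \<Rightarrow> 'c list \<Rightarrow> 'c list \<Rightarrow> bool" where
  "cover_ok_even add sub mul zero one C \<eta> bs T hs ts \<longleftrightarrow>
    anisoc add mul zero one \<eta> C \<and> add one one = zero \<and> subset_list bs C \<and>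
    cover_ok add sub (norms_even add mul \<eta> bs) zero C T hs ts"

lemma (in coded_field) cover_ok_odd:
  assumes ok: "cover_ok_odd add sub mul zero one C \<eta> \<kappa> T hs ts"
    and bound: "length T * CARD('a) + CARD('a) + 1 \<le> CARD('a)\<^sup>2"
  shows "\<exists>S :: ('a ^ 4) set set. maximal_partial_spread S \<and> card S \<le> length T * CARD('a) + CARD('a) + 1"
proof (rule cover_all[where R = "norms_odd add mul \<kappa> (dedup [] (squares mul C))" and hs = hs and ts = ts])
  fix d r assume "d \<in> set C" "r \<in> set (norms_odd add mul \<kappa> (dedup [] (squares mul C)) d)"
  then show "\<exists>w. nrm (\<phi> \<eta>) w (\<phi> d) = \<phi> r"
    using ok by (intro norms_odd[of \<eta> \<kappa> d r]) (auto simp: cover_ok_odd_def anisoc_def lmem_iff)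
qed (use ok bound in \<open>auto simp: cover_ok_odd_def cover_ok_def\<close>)

lemma (in coded_field) cover_ok_even:
  assumes ok: "cover_ok_even add sub mul zero one C \<eta> bs T hs ts"
    and bound: "length T * CARD('a) + CARD('a) + 1 \<le> CARD('a)\<^sup>2"
  shows "\<exists>S :: ('a ^ 4) set set. maximal_partial_spread S \<and> card S \<le> length T * CARD('a) + CARD('a) + 1"
proof (rule cover_all[where R = "norms_even add mul \<eta> bs" and hs = hs and ts = ts])
  fix d r assume "d \<in> set C" "r \<in> set (norms_even add mul \<eta> bs d)"
  then show "\<exists>w. nrm (\<phi> \<eta>) w (\<phi> d) = \<phi> r"
    using ok by (intro norms_even[of \<eta> bs d r]) (auto simp: cover_ok_even_def anisoc_def lmem_iff)
qed (use ok bound in \<open>auto simp: cover_ok_even_def cover_ok_def\<close>)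

section \<open>Full check with prescribed point values and additional graphs\<close>

text \<open>
  A point entry \<open>(x, y, n, P, Q, s)\<close> consists of the coordinates, \<open>n = N(x,y)\<close>, the coefficients in
  \<open>\<tau>(b v\<^sup>2) = u P + (u + w) Q\<close>, and the value of the blocked forms.
\<close>

type_synonym 'c point = "'c \<times> 'c \<times> 'c \<times> 'c \<times> 'c \<times> 'c"
type_synonym 'c mat = "'c \<times> 'c \<times> 'c \<times> 'c"
type_synonym 'c norm_row = "('c \<times> 'c) list"

fun row_mem :: "'c \<Rightarrow> 'c norm_row \<Rightarrow> bool"
  and row_mem_if where
  "row_mem r [] = False"
| "row_mem r ((w, n) # rw) = row_mem_if (n = r) r rw"
| "row_mem_if True _ _ = True"
| "row_mem_if False r rw = row_mem r rw"

lemma row_mem_Cons [simp]: "row_mem r ((w, n) # rw) = (if n = r then True else row_mem r rw)"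
  by simp

declare row_mem.simps(2) [simp del]

fun rows_mem :: "'c \<Rightarrow> 'c norm_row list \<Rightarrow> bool"
  and rows_mem_if where
  "rows_mem r [] = False"
| "rows_mem r (rw # rws) = rows_mem_if (row_mem r rw) r rws"
| "rows_mem_if True _ _ = True"
| "rows_mem_if False r rws = rows_mem r rws"

lemma rows_mem_Cons [simp]: "rows_mem r (rw # rws) = (if row_mem r rw then True else rows_mem r rws)"
  by simp

declare rows_mem.simps(2) [simp del]

fun row_of :: "'c \<Rightarrow> ('c \<times> 'c norm_row) list \<Rightarrow> 'c norm_row"
  and row_of_if where
  "row_of d [] = []"
| "row_of d ((e, rw) # tab) = row_of_if (d = e) d rw tab"
| "row_of_if True _ rw _ = rw"
| "row_of_if False d _ tab = row_of d tab"

lemma row_of_Cons [simp]: "row_of d ((e, rw) # tab) = (if d = e then rw else row_of d tab)"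
  by simp

declare row_of.simps(2) [simp del]

fun rows_of :: "('c \<Rightarrow> 'c \<Rightarrow> 'c) \<Rightarrow> ('c \<times> 'c norm_row) list \<Rightarrow> 'c \<Rightarrow> 'c list \<Rightarrow> 'c norm_row list" where
  "rows_of sub tab t [] = []"
| "rows_of sub tab t (\<sigma> # T) = row_of (sub \<sigma> t) tab # rows_of sub tab t T"

fun norm_row :: "('c \<Rightarrow> 'c \<Rightarrow> 'c) \<Rightarrow> ('c \<Rightarrow> 'c \<Rightarrow> 'c) \<Rightarrow> 'c \<Rightarrow> 'c \<Rightarrow> 'c list \<Rightarrow> 'c norm_row" where
  "norm_row add mul \<eta> d [] = []"
| "norm_row add mul \<eta> d (w # ws) = (w, nrmc add mul \<eta> w d) # norm_row add mul \<eta> d ws"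

lemma norm_row_eq: "norm_row add mul \<eta> d ws = map (\<lambda>w. (w, nrmc add mul \<eta> w d)) ws"
  by (induction ws) auto

fun norm_rows :: "('c \<Rightarrow> 'c \<Rightarrow> 'c) \<Rightarrow> ('c \<Rightarrow> 'c \<Rightarrow> 'c) \<Rightarrow> 'c \<Rightarrow> 'c list \<Rightarrow> 'c list \<Rightarrow> ('c \<times> 'c norm_row) list" where
  "norm_rows add mul \<eta> C [] = []"
| "norm_rows add mul \<eta> C (d # ds) = (d, norm_row add mul \<eta> d C) # norm_rows add mul \<eta> C ds"

lemma norm_rows_eq: "norm_rows add mul \<eta> C ds = map (\<lambda>d. (d, map (\<lambda>w. (w, nrmc add mul \<eta> w d)) C)) ds"
  by (induction ds) (auto simp: norm_row_eq)

text \<open>Row d lists the pairs (w, N(w, d)). The table serves two purposes: its rows at \<sigma>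
  - t show which norms \<open>T\<close> covers, and all its rows together enumerate the b of a given
  norm.\<close>

definition norm_table :: "('c \<Rightarrow> 'c \<Rightarrow> 'c) \<Rightarrow> ('c \<Rightarrow> 'c \<Rightarrow> 'c) \<Rightarrow> 'c \<Rightarrow> 'c list \<Rightarrow> ('c \<times> 'c norm_row) list" where
  "norm_table add mul \<eta> C = norm_rows add mul \<eta> C C"

definition mk_point :: "('c \<Rightarrow> 'c \<Rightarrow> 'c) \<Rightarrow> ('c \<Rightarrow> 'c \<Rightarrow> 'c) \<Rightarrow> ('c \<Rightarrow> 'c \<Rightarrow> 'c) \<Rightarrow> 'c \<Rightarrow> 'c \<Rightarrow> 'c \<Rightarrow> 'c \<Rightarrow> 'c point" where
  "mk_point add sub mul \<eta> x y s =
    (x, y, nrmc add mul \<eta> x y, sub (mul x x) (mul \<eta> (mul y y)), add (mul y y) (mul x (add y y)), s)"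

definition points :: "('c \<Rightarrow> 'c \<Rightarrow> 'c) \<Rightarrow> ('c \<Rightarrow> 'c \<Rightarrow> 'c) \<Rightarrow> ('c \<Rightarrow> 'c \<Rightarrow> 'c) \<Rightarrow> 'c \<Rightarrow> 'c \<Rightarrow> 'c \<Rightarrow> 'c list \<Rightarrow> 'c list \<Rightarrow> 'c \<Rightarrow> 'c point list" where
  "points add sub mul zero one \<eta> C ss si =
    mk_point add sub mul \<eta> zero one si # map2 (mk_point add sub mul \<eta> one) C ss"

text \<open>The argument \<open>b\<close> is the sum u + w, not the extension element b = w + u
  \<omega>; likewise in the functions below.\<close>

fun hit :: "('c \<Rightarrow> 'c \<Rightarrow> 'c) \<Rightarrow> ('c \<Rightarrow> 'c \<Rightarrow> 'c) \<Rightarrow> 'c \<Rightarrow> 'c \<Rightarrow> 'c \<Rightarrow> 'c point list \<Rightarrow> bool"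
  and hit_if where
  "hit add mul t u b [] = False"
| "hit add mul t u b ((x, y, n, P, Q, s) # pts) = hit_if (add (mul t n) (add (mul u P) (mul b Q)) = s) add mul t u b pts"
| "hit_if True _ _ _ _ _ _ = True"
| "hit_if False add mul t u b pts = hit add mul t u b pts"

lemma hit_Cons [simp]: "hit add mul t u b ((x, y, n, P, Q, s) # pts) = (if add (mul t n) (add (mul u P) (mul b Q)) = s then True else hit add mul t u b pts)"
  by simp

declare hit.simps(2) [simp del]

definition umatc :: "('c \<Rightarrow> 'c \<Rightarrow> 'c) \<Rightarrow> ('c \<Rightarrow> 'c \<Rightarrow> 'c) \<Rightarrow> ('c \<Rightarrow> 'c \<Rightarrow> 'c) \<Rightarrow> 'c \<Rightarrow> 'c \<Rightarrow> 'c \<Rightarrow> 'c \<Rightarrow> 'c \<Rightarrow> 'c mat" where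
  "umatc add sub mul \<eta> a t u b =
    (a, sub (mul \<eta> u) (add (mul \<eta> t) b), add t u, add a (add t (add b b)))"

fun singc :: "('c \<Rightarrow> 'c \<Rightarrow> 'c) \<Rightarrow> ('c \<Rightarrow> 'c \<Rightarrow> 'c) \<Rightarrow> 'c mat \<Rightarrow> 'c mat \<Rightarrow> bool" where
  "singc sub mul (a, b, c, d) (a', b', c', d') \<longleftrightarrow> mul (sub a a') (sub d d') = mul (sub b b') (sub c c')"

fun sing_any :: "('c \<Rightarrow> 'c \<Rightarrow> 'c) \<Rightarrow> ('c \<Rightarrow> 'c \<Rightarrow> 'c) \<Rightarrow> 'c mat \<Rightarrow> 'c mat list \<Rightarrow> bool"
  and sing_any_if where
  "sing_any sub mul M [] = False"
| "sing_any sub mul M (e # E) = sing_any_if (singc sub mul M e) sub mul M E"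
| "sing_any_if True _ _ _ _ = True"
| "sing_any_if False sub mul M E = sing_any sub mul M E"

lemma sing_any_Cons [simp]: "sing_any sub mul M (e # E) = (if singc sub mul M e then True else sing_any sub mul M E)"
  by simp

declare sing_any.simps(2) [simp del]

fun sing_all :: "('c \<Rightarrow> 'c \<Rightarrow> 'c) \<Rightarrow> ('c \<Rightarrow> 'c \<Rightarrow> 'c) \<Rightarrow> ('c \<Rightarrow> 'c \<Rightarrow> 'c) \<Rightarrow> 'c \<Rightarrow> 'c mat list \<Rightarrow> 'c \<Rightarrow> 'c \<Rightarrow> 'c \<Rightarrow> 'c list \<Rightarrow> bool" where
"sing_all add sub mul \<eta> E t u b [] \<longleftrightarrow> True"
| "sing_all add sub mul \<eta> E t u b (a # as) \<longleftrightarrow>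
    sing_any sub mul (umatc add sub mul \<eta> a t u b) E \<and> sing_all add sub mul \<eta> E t u b as"

fun sing_unless where
  "sing_unless True _ _ _ _ _ _ _ _ _ = True"
| "sing_unless False add sub mul \<eta> E t u b C = sing_all add sub mul \<eta> E t u b C"

fun hit_or_sing where
  "hit_or_sing True add sub mul \<eta> C E pts t u b = sing_unless (hit add mul t u b pts) add sub mul \<eta> E t u b C"
| "hit_or_sing False _ _ _ _ _ _ _ _ _ _ = True"

lemma hit_or_sing_iff: "hit_or_sing P add sub mul \<eta> C E pts t u b \<longleftrightarrow>
    (P \<longrightarrow> hit add mul t u b pts \<or> sing_all add sub mul \<eta> E t u b C)"
  by (cases P; cases "hit add mul t u b pts") simp_all

text \<open>Handles the forms with parameter t whose b = w + u \<omega> has norm r, for the fixed u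
  of this row. Each must be blocked by a point line or, for every scalar shift, by a matrix of
  \<open>E\<close>.\<close>

fun row_extra :: "('c \<Rightarrow> 'c \<Rightarrow> 'c) \<Rightarrow> ('c \<Rightarrow> 'c \<Rightarrow> 'c) \<Rightarrow> ('c \<Rightarrow> 'c \<Rightarrow> 'c) \<Rightarrow> 'c \<Rightarrow> 'c list \<Rightarrow> 'c mat list \<Rightarrow> 'c point list \<Rightarrow>
    'c \<Rightarrow> 'c \<Rightarrow> 'c \<Rightarrow> 'c norm_row \<Rightarrow> bool" where
"row_extra add sub mul \<eta> C E pts t r u [] \<longleftrightarrow> True"
| "row_extra add sub mul \<eta> C E pts t r u ((w, n) # rw) \<longleftrightarrow>
    hit_or_sing (n = r) add sub mul \<eta> C E pts t u (add u w) \<and> row_extra add sub mul \<eta> C E pts t r u rw"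

fun tab_extra :: "('c \<Rightarrow> 'c \<Rightarrow> 'c) \<Rightarrow> ('c \<Rightarrow> 'c \<Rightarrow> 'c) \<Rightarrow> ('c \<Rightarrow> 'c \<Rightarrow> 'c) \<Rightarrow> 'c \<Rightarrow> 'c list \<Rightarrow> 'c mat list \<Rightarrow> 'c point list \<Rightarrow>
    'c \<Rightarrow> 'c \<Rightarrow> ('c \<times> 'c norm_row) list \<Rightarrow> bool" where
"tab_extra add sub mul \<eta> C E pts t r [] \<longleftrightarrow> True"
| "tab_extra add sub mul \<eta> C E pts t r ((u, rw) # tab) \<longleftrightarrow>
    row_extra add sub mul \<eta> C E pts t r u rw \<and> tab_extra add sub mul \<eta> C E pts t r tab"

fun extra_unless where
  "extra_unless True _ _ _ _ _ _ _ _ _ _ = True"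
| "extra_unless False add sub mul \<eta> C E pts t r tab = tab_extra add sub mul \<eta> C E pts t r tab"

lemma extra_unless_iff: "extra_unless P add sub mul \<eta> C E pts t r tab \<longleftrightarrow> P \<or> tab_extra add sub mul \<eta> C E pts t r tab"
  by (cases P) simp_all

text \<open>If \<open>T\<close> covers the norm r, all b of norm r are settled at once; only
  otherwise are they enumerated.\<close>

fun norms_check :: "('c \<Rightarrow> 'c \<Rightarrow> 'c) \<Rightarrow> ('c \<Rightarrow> 'c \<Rightarrow> 'c) \<Rightarrow> ('c \<Rightarrow> 'c \<Rightarrow> 'c) \<Rightarrow> 'c \<Rightarrow> 'c list \<Rightarrow> 'c mat list \<Rightarrow> 'c point list \<Rightarrow>
    ('c \<times> 'c norm_row) list \<Rightarrow> 'c norm_row list \<Rightarrow> 'c \<Rightarrow> 'c list \<Rightarrow> bool" where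
"norms_check add sub mul \<eta> C E pts tab rws t [] \<longleftrightarrow> True"
| "norms_check add sub mul \<eta> C E pts tab rws t (r # rs) \<longleftrightarrow>
    extra_unless (rows_mem r rws) add sub mul \<eta> C E pts t r tab \<and> norms_check add sub mul \<eta> C E pts tab rws t rs"

fun cover_check :: "('c \<Rightarrow> 'c \<Rightarrow> 'c) \<Rightarrow> ('c \<Rightarrow> 'c \<Rightarrow> 'c) \<Rightarrow> ('c \<Rightarrow> 'c \<Rightarrow> 'c) \<Rightarrow> 'c \<Rightarrow> 'c list \<Rightarrow> 'c mat list \<Rightarrow> 'c point list \<Rightarrow>
    ('c \<times> 'c norm_row) list \<Rightarrow> 'c list \<Rightarrow> 'c list \<Rightarrow> 'c list \<Rightarrow> bool" where
"cover_check add sub mul \<eta> C E pts tab T rs [] \<longleftrightarrow> True"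
| "cover_check add sub mul \<eta> C E pts tab T rs (t # ts) \<longleftrightarrow>
    norms_check add sub mul \<eta> C E pts tab (rows_of sub tab t T) t rs \<and> cover_check add sub mul \<eta> C E pts tab T rs ts"

fun qfc :: "('c \<Rightarrow> 'c \<Rightarrow> 'c) \<Rightarrow> ('c \<Rightarrow> 'c \<Rightarrow> 'c) \<Rightarrow> ('c \<Rightarrow> 'c \<Rightarrow> 'c) \<Rightarrow> 'c mat \<Rightarrow> 'c \<Rightarrow> 'c \<Rightarrow> 'c" where
  "qfc add sub mul (a, b, c, d) x y = sub (add (mul c (mul x x)) (mul (sub d a) (mul x y))) (mul b (mul y y))"

fun in4 :: "'c list \<Rightarrow> 'c mat \<Rightarrow> bool" where
  "in4 C (a, b, c, d) \<longleftrightarrow> lmem a C \<and> lmem b C \<and> lmem c C \<and> lmem d C"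

fun avoids :: "('c \<Rightarrow> 'c \<Rightarrow> 'c) \<Rightarrow> 'c list \<Rightarrow> 'c \<Rightarrow> 'c \<Rightarrow> bool" where
"avoids mul [] n s \<longleftrightarrow> True"
| "avoids mul (\<sigma> # T) n s \<longleftrightarrow>
    mul \<sigma> n \<noteq> s \<and> avoids mul T n s"

lemma avoids_iff: "avoids mul T n s \<longleftrightarrow> (\<forall>\<sigma>\<in>set T. mul \<sigma> n \<noteq> s)"
  by (induction T) auto

fun pts_avoid :: "('c \<Rightarrow> 'c \<Rightarrow> 'c) \<Rightarrow> 'c list \<Rightarrow> 'c point list \<Rightarrow> bool" where
"pts_avoid mul T [] \<longleftrightarrow> True"
| "pts_avoid mul T ((x, y, n, P, Q, s) # pts) \<longleftrightarrow>
    avoids mul T n s \<and> pts_avoid mul T pts"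

lemma pts_avoid_iff: "pts_avoid mul T pts \<longleftrightarrow> (\<forall>(x, y, n, P, Q, s)\<in>set pts. \<forall>\<sigma>\<in>set T. mul \<sigma> n \<noteq> s)"
  by (induction pts) (auto simp: avoids_iff split: if_splits)

fun mult_hit :: "('c \<Rightarrow> 'c \<Rightarrow> 'c) \<Rightarrow> 'c \<Rightarrow> 'c point list \<Rightarrow> bool"
  and mult_hit_if where
  "mult_hit mul t [] = False"
| "mult_hit mul t ((x, y, n, P, Q, s) # pts) = mult_hit_if (mul t n = s) mul t pts"
| "mult_hit_if True _ _ _ = True"
| "mult_hit_if False mul t pts = mult_hit mul t pts"

lemma mult_hit_Cons [simp]: "mult_hit mul t ((x, y, n, P, Q, s) # pts) = (if mul t n = s then True else mult_hit mul t pts)"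
  by simp

declare mult_hit.simps(2) [simp del]

lemma mult_hit_iff: "mult_hit mul t pts \<longleftrightarrow> (\<exists>(x, y, n, P, Q, s)\<in>set pts. mul t n = s)"
  by (induction pts) auto

fun mults_hit :: "('c \<Rightarrow> 'c \<Rightarrow> 'c) \<Rightarrow> 'c list \<Rightarrow> 'c point list \<Rightarrow> 'c list \<Rightarrow> bool" where
"mults_hit mul T pts [] \<longleftrightarrow> True"
| "mults_hit mul T pts (t # ts) \<longleftrightarrow>
    (if lmem t T then True else mult_hit mul t pts) \<and> mults_hit mul T pts ts"

lemma mults_hit_iff: "mults_hit mul T pts ts \<longleftrightarrow> (\<forall>t\<in>set ts. t \<notin> set T \<longrightarrow> mult_hit mul t pts)"
  by (induction ts) (auto simp: lmem_iff split: if_splits)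

text \<open>Evaluated at one representative per projective point (x : y); homogeneity extends the
  result to all nonzero (x, y).\<close>

fun mat_avoids :: "('c \<Rightarrow> 'c \<Rightarrow> 'c) \<Rightarrow> ('c \<Rightarrow> 'c \<Rightarrow> 'c) \<Rightarrow> ('c \<Rightarrow> 'c \<Rightarrow> 'c) \<Rightarrow> 'c list \<Rightarrow> 'c mat \<Rightarrow> 'c point list \<Rightarrow> bool" where
  "mat_avoids add sub mul T e [] = True"
| "mat_avoids add sub mul T e ((x, y, n, P, Q, s) # pts) =
    (if qfc add sub mul e x y = s then False
     else if avoids mul T n (qfc add sub mul e x y) then mat_avoids add sub mul T e pts else False)"

lemma mat_avoids_iff: "mat_avoids add sub mul T e pts \<longleftrightarrow>
    (\<forall>(x, y, n, P, Q, s)\<in>set pts. qfc add sub mul e x y \<noteq> s \<and> (\<forall>\<sigma>\<in>set T. mul \<sigma> n \<noteq> qfc add sub mul e x y))"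
  by (induction add sub mul T e pts rule: mat_avoids.induct) (auto simp: avoids_iff split: if_splits)

fun mats_avoid :: "('c \<Rightarrow> 'c \<Rightarrow> 'c) \<Rightarrow> ('c \<Rightarrow> 'c \<Rightarrow> 'c) \<Rightarrow> ('c \<Rightarrow> 'c \<Rightarrow> 'c) \<Rightarrow> 'c list \<Rightarrow> 'c list \<Rightarrow> 'c mat list \<Rightarrow> 'c point list \<Rightarrow> bool" where
"mats_avoid add sub mul C T [] pts \<longleftrightarrow> True"
| "mats_avoid add sub mul C T (e # E) pts \<longleftrightarrow>
    in4 C e \<and> \<not> sing_any sub mul e E \<and> mat_avoids add sub mul T e pts \<and> mats_avoid add sub mul C T E pts"

lemma sing_any_iff: "sing_any sub mul M E \<longleftrightarrow> (\<exists>e\<in>set E. singc sub mul M e)"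
  by (induction E) auto

lemma mats_avoid:
  "mats_avoid add sub mul C T E pts \<Longrightarrow> e \<in> set E \<Longrightarrow> in4 C e \<and> mat_avoids add sub mul T e pts"
  by (induction E) (auto split: if_splits)

text \<open>Each matrix is compared only with the later ones, so just one of the two orders is
  known. Symmetry of singularity supplies the other.\<close>

lemma mats_avoid_sing:
  "mats_avoid add sub mul C T E pts \<Longrightarrow> e \<in> set E \<Longrightarrow> e' \<in> set E \<Longrightarrow> e \<noteq> e' \<Longrightarrow>
    \<not> singc sub mul e e' \<or> \<not> singc sub mul e' e"
  by (induction E) (auto simp: sing_any_iff split: if_splits)

definition data_check :: "('c \<Rightarrow> 'c \<Rightarrow> 'c) \<Rightarrow> ('c \<Rightarrow> 'c \<Rightarrow> 'c) \<Rightarrow> ('c \<Rightarrow> 'c \<Rightarrow> 'c) \<Rightarrow> 'c list \<Rightarrow> 'c list \<Rightarrow> 'c mat list \<Rightarrow> 'c point list \<Rightarrow> bool" where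
  "data_check add sub mul C T E pts \<longleftrightarrow>
    pts_avoid mul T pts \<and> mults_hit mul T pts C \<and> mats_avoid add sub mul C T E pts"

text \<open>The point list and the norm table are parameters so that they are computed once and then
  shared by all tests.\<close>

definition spread_ok' :: "('c \<Rightarrow> 'c \<Rightarrow> 'c) \<Rightarrow> ('c \<Rightarrow> 'c \<Rightarrow> 'c) \<Rightarrow> ('c \<Rightarrow> 'c \<Rightarrow> 'c) \<Rightarrow> 'c \<Rightarrow> 'c \<Rightarrow> 'c list \<Rightarrow> 'c \<Rightarrow> 'c list \<Rightarrow> 'c list \<Rightarrow> 'c \<Rightarrow>
    'c mat list \<Rightarrow> 'c point list \<Rightarrow> ('c \<times> 'c norm_row) list \<Rightarrow> bool" where
  "spread_ok' add sub mul zero one C \<eta> T ss si E pts tab \<longleftrightarrow>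
    anisoc add mul zero one \<eta> C \<and> subset_list T C \<and> subset_list ss C \<and> length ss = length C \<and> lmem si C \<and>
    data_check add sub mul C T E pts \<and> cover_check add sub mul \<eta> C E pts tab T (nonzeros zero C) C"

definition spread_ok :: "('c \<Rightarrow> 'c \<Rightarrow> 'c) \<Rightarrow> ('c \<Rightarrow> 'c \<Rightarrow> 'c) \<Rightarrow> ('c \<Rightarrow> 'c \<Rightarrow> 'c) \<Rightarrow> 'c \<Rightarrow> 'c \<Rightarrow> 'c list \<Rightarrow> 'c \<Rightarrow> 'c list \<Rightarrow> 'c list \<Rightarrow> 'c \<Rightarrow>
    'c mat list \<Rightarrow> bool" where
  "spread_ok add sub mul zero one C \<eta> T ss si E \<longleftrightarrow>
    spread_ok' add sub mul zero one C \<eta> T ss si E (points add sub mul zero one \<eta> C ss si) (norm_table add mul \<eta> C)"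

context coded_field
begin

definition phi4 :: "'c mat \<Rightarrow> 'a \<times> 'a \<times> 'a \<times> 'a" where
  "phi4 = map_prod \<phi> (map_prod \<phi> (map_prod \<phi> \<phi>))"

text \<open>States that an entry's precomputed components are correct; \<open>S\<close> gives the
  blocked value as a function of the coordinates.\<close>

definition is_point :: "'a \<Rightarrow> ('a \<Rightarrow> 'a \<Rightarrow> 'a) \<Rightarrow> 'c point \<Rightarrow> bool" where
  "is_point \<eta> S = (\<lambda>(x, y, n, P, Q, s). {x, y, n, P, Q, s} \<subseteq> set C \<and> \<phi> n = nrm \<eta> (\<phi> x) (\<phi> y) \<and>
    \<phi> s = S (\<phi> x) (\<phi> y) \<and> (\<forall>u w. tau \<eta> u w (\<phi> x) (\<phi> y) = u * \<phi> P + (u + w) * \<phi> Q))"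

lemma is_point_mk_point:
  assumes "\<eta> \<in> set C" "x \<in> set C" "y \<in> set C" "s \<in> set C" "\<phi> s = S (\<phi> x) (\<phi> y)"
  shows "is_point (\<phi> \<eta>) S (mk_point add sub mul \<eta> x y s)"
  using assms by (simp add: is_point_def mk_point_def nrmc ops tau_def algebra_simps)

lemma in4: "in4 C e \<Longrightarrow> \<exists>a b c d. e = (a, b, c, d) \<and> a \<in> set C \<and> b \<in> set C \<and> c \<in> set C \<and> d \<in> set C"
  by (cases e) (auto simp: lmem_iff)

lemma singc: "in4 C e \<Longrightarrow> in4 C e' \<Longrightarrow> singc sub mul e e' \<longleftrightarrow> sing (phi4 e) (phi4 e')"
  by (elim in4[elim_format] exE conjE) (simp add: phi4_def ops flip: phi_eq_iff)

lemma qfc: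
  assumes "in4 C e" "x \<in> set C" "y \<in> set C"
  shows "qfc add sub mul e x y \<in> set C" "\<phi> (qfc add sub mul e x y) = qf (phi4 e) (\<phi> x) (\<phi> y)"
proof -
  obtain a b c d where "e = (a, b, c, d)" "a \<in> set C" "b \<in> set C" "c \<in> set C" "d \<in> set C"
    using in4[OF assms(1)] by blast
  then show "qfc add sub mul e x y \<in> set C" "\<phi> (qfc add sub mul e x y) = qf (phi4 e) (\<phi> x) (\<phi> y)"
    using assms by (simp_all add: phi4_def ops algebra_simps)
qed

lemma umatc:
  assumes "\<eta> \<in> set C" "a \<in> set C" "t \<in> set C" "u \<in> set C" "w \<in> set C"
  shows "in4 C (umatc add sub mul \<eta> a t u (add u w))"
    "phi4 (umatc add sub mul \<eta> a t u (add u w)) = umat (\<phi> \<eta>) (\<phi> a) (\<phi> t) (\<phi> u) (\<phi> w)"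
  using assms by (simp_all add: umatc_def umat_def phi4_def lmem_iff ops algebra_simps)

lemma hit:
  assumes "hit add mul t u (add u w) pts" "\<forall>p\<in>set pts. is_point \<eta> S p" "t \<in> set C" "u \<in> set C" "w \<in> set C"
  shows "\<exists>(x, y, n, P, Q, s)\<in>set pts. \<phi> t * nrm \<eta> (\<phi> x) (\<phi> y) + tau \<eta> (\<phi> u) (\<phi> w) (\<phi> x) (\<phi> y) = S (\<phi> x) (\<phi> y)"
  using assms
proof (induction pts)
  case (Cons p pts)
  obtain x y n P Q s where p: "p = (x, y, n, P, Q, s)" by (cases p)
  show ?case
  proof (cases "add (mul t n) (add (mul u P) (mul (add u w) Q)) = s")
    case True
    then have "\<phi> (add (mul t n) (add (mul u P) (mul (add u w) Q))) = \<phi> s" by simp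
    moreover have "is_point \<eta> S p" using Cons.prems by simp
    ultimately show ?thesis
      using Cons.prems by (simp add: p is_point_def ops add.assoc)
  next
    case False
    then show ?thesis using Cons by (auto simp: p)
  qed
qed simp

lemma sing_any:
  "sing_any sub mul M E \<Longrightarrow> in4 C M \<Longrightarrow> \<forall>e\<in>set E. in4 C e \<Longrightarrow> \<exists>e\<in>phi4 ` set E. sing (phi4 M) e"
  by (induction E) (auto simp: singc split: if_splits)

lemma sing_all:
  "sing_all add sub mul \<eta> E t u (add u w) as \<Longrightarrow> \<forall>e\<in>set E. in4 C e \<Longrightarrow> {\<eta>, t, u, w} \<union> set as \<subseteq> set C \<Longrightarrow>
    a \<in> set as \<Longrightarrow> \<exists>e\<in>phi4 ` set E. sing (umat (\<phi> \<eta>) (\<phi> a) (\<phi> t) (\<phi> u) (\<phi> w)) e"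
proof (induction as)
  case (Cons b as)
  have "sing_any sub mul (umatc add sub mul \<eta> b t u (add u w)) E"
    using Cons.prems by (auto split: if_splits)
  then have "\<exists>e\<in>phi4 ` set E. sing (umat (\<phi> \<eta>) (\<phi> b) (\<phi> t) (\<phi> u) (\<phi> w)) e"
    using sing_any[of "umatc add sub mul \<eta> b t u (add u w)" E] umatc[of \<eta> b t u w] Cons.prems by simp
  then show ?case using Cons by (auto split: if_splits)
qed simp

lemma row_mem_iff: "row_mem r rw \<longleftrightarrow> (\<exists>w. (w, r) \<in> set rw)"
  by (induction rw) (auto split: if_splits)

lemma rows_mem_iff: "rows_mem r rws \<longleftrightarrow> (\<exists>rw\<in>set rws. row_mem r rw)"
  by (induction rws) auto

lemma row_extra_iff: "row_extra add sub mul \<eta> C E pts t r u rw \<longleftrightarrow>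
    (\<forall>w. (w, r) \<in> set rw \<longrightarrow> hit add mul t u (add u w) pts \<or> sing_all add sub mul \<eta> E t u (add u w) C)"
  by (induction rw) (auto simp: hit_or_sing_iff)

lemma tab_extra_iff: "tab_extra add sub mul \<eta> C E pts t r tab \<longleftrightarrow>
    (\<forall>(u, rw)\<in>set tab. row_extra add sub mul \<eta> C E pts t r u rw)"
  by (induction tab) (auto split: if_splits)

lemma norms_check_iff: "norms_check add sub mul \<eta> C E pts tab rws t rs \<longleftrightarrow>
    (\<forall>r\<in>set rs. rows_mem r rws \<or> tab_extra add sub mul \<eta> C E pts t r tab)"
  by (induction rs) (auto simp: extra_unless_iff)

lemma cover_check_iff: "cover_check add sub mul \<eta> C E pts tab T rs ts \<longleftrightarrow>
    (\<forall>t\<in>set ts. norms_check add sub mul \<eta> C E pts tab (rows_of sub tab t T) t rs)"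
  by (induction ts) (auto split: if_splits)

lemma row_of_in: "row_of d tab = [] \<or> (d, row_of d tab) \<in> set tab"
  by (induction tab) (auto split: if_splits)

lemma set_rows_of: "set (rows_of sub tab t T) = (\<lambda>\<sigma>. row_of (sub \<sigma> t) tab) ` set T"
  by (induction T) auto

text \<open>Translates each computed test back to the field and feeds it to
  \<open>spread_criterion_norm\<close>. A form is located in the table through the codes of t, u, w
  and of the norm r = N(b).\<close>

theorem spread_check:
  assumes ok: "spread_ok add sub mul zero one C \<eta> T ss si E"
    and bound: "length T * CARD('a) + CARD('a) + 1 + length E \<le> CARD('a)\<^sup>2"
  shows "\<exists>S :: ('a ^ 4) set set. maximal_partial_spread S \<and> card S \<le> length T * CARD('a) + CARD('a) + 1 + length E"
proof -
  define pts where pts: "pts = points add sub mul zero one \<eta> C ss si"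
  have an: "anisoc add mul zero one \<eta> C" and T: "subset_list T C"
    and ss: "subset_list ss C" "length ss = length C" "lmem si C"
    and data: "data_check add sub mul C T E pts"
    and cov: "cover_check add sub mul \<eta> C E pts (norm_table add mul \<eta> C) T (nonzeros zero C) C"
    using ok unfolding spread_ok_def spread_ok'_def pts by blast+
  define s where "s x = \<phi> (the (map_of (zip C ss) (dec x)))" for x
  \<comment> \<open>Blocked values on the representatives (0, 1) and (1, y). The argument x only
    distinguishes the two kinds.\<close>
  define S :: "'a \<Rightarrow> 'a \<Rightarrow> 'a" where "S x y = (if x = 0 then \<phi> si else s y)" for x y
  have \<eta>: "\<eta> \<in> set C" using an by (simp add: anisoc_def lmem_iff)
  have TC: "set T \<subseteq> set C" and sC: "set ss \<subseteq> set C" "si \<in> set C"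
    using T ss by (simp_all add: subset_list_iff lmem_iff)
  have sz: "\<phi> v = S (\<phi> one) (\<phi> y)" if "(y, v) \<in> set (zip C ss)" for y v
  proof -
    have "y \<in> set C" using that by (rule set_zip_leftD)
    then have "dec (\<phi> y) = y" using dec phi_eq_iff by blast
    moreover have "map_of (zip C ss) y = Some v"
      using that dist ss(2) by (intro map_of_is_SomeI) simp_all
    ultimately show ?thesis by (simp add: S_def s_def ops)
  qed
  have pt: "is_point (\<phi> \<eta>) S p" if "p \<in> set pts" for p
  proof -
    from that have "p = mk_point add sub mul \<eta> zero one si \<or>
        (\<exists>y v. (y, v) \<in> set (zip C ss) \<and> p = mk_point add sub mul \<eta> one y v)"
      unfolding pts points_def by auto
    then show ?thesis
    proof (elim disjE exE conjE)
      assume "p = mk_point add sub mul \<eta> zero one si"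
      then show ?thesis using \<eta> sC by (auto intro!: is_point_mk_point simp: ops S_def)
    next
      fix y v assume yv: "(y, v) \<in> set (zip C ss)" "p = mk_point add sub mul \<eta> one y v"
      then have "y \<in> set C" "v \<in> set C" using sC by (auto dest: set_zip_leftD set_zip_rightD)
      then show ?thesis using \<eta> sz[OF yv(1)] ops unfolding yv(2) by (intro is_point_mk_point) auto
    qed
  qed
  have pt_ex: "\<exists>(x', y', n, P, Q, v)\<in>set pts. \<phi> x' = x \<and> \<phi> y' = y"
    if "(x, y) = (0, 1) \<or> x = 1" for x y
  proof (cases "(x, y) = (0, 1)")
    case True
    then show ?thesis unfolding pts points_def by (auto simp: mk_point_def ops)
  next
    case False
    then have x: "x = 1" using that by blast
    have "dec y \<in> set (map fst (zip C ss))" using dec ss(2) by simp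
    then obtain v where "(dec y, v) \<in> set (zip C ss)" by auto
    then have "mk_point add sub mul \<eta> one (dec y) v \<in> set pts" unfolding pts points_def by force
    then show ?thesis using dec[of y] x ops by (intro bexI) (auto simp: mk_point_def)
  qed
  have pt01: "(\<phi> x, \<phi> y) = (0, 1) \<or> \<phi> x = 1" if "(x, y, n, P, Q, v) \<in> set pts" for x y n P Q v
    using that unfolding pts points_def by (auto simp: mk_point_def ops)
  have S_ne: "S x y \<noteq> \<sigma> * nrm (\<phi> \<eta>) x y" if \<sigma>: "\<sigma> \<in> \<phi> ` set T" and xy: "(x, y) = (0, 1) \<or> x = 1" for \<sigma> x y
  proof -
    obtain x' y' n P Q v where p: "(x', y', n, P, Q, v) \<in> set pts" "\<phi> x' = x" "\<phi> y' = y"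
      using pt_ex[OF xy] by blast
    obtain \<sigma>' where s': "\<sigma>' \<in> set T" "\<sigma> = \<phi> \<sigma>'" using \<sigma> by auto
    have "v \<noteq> mul \<sigma>' n" using data p s' unfolding data_check_def pts_avoid_iff by fastforce
    moreover have "v \<in> set C" "n \<in> set C" "\<phi> n = nrm (\<phi> \<eta>) x y" "\<phi> v = S x y"
      using pt[OF p(1)] p by (auto simp: is_point_def)
    ultimately show ?thesis using s' TC mul phi_eq_iff by (metis subsetD)
  qed
  have E4: "\<forall>e\<in>set E. in4 C e" using data mats_avoid unfolding data_check_def by blast
  have E_pt: "qf e x y \<noteq> S x y \<and> (\<forall>\<sigma>\<in>\<phi> ` set T. qf e x y \<noteq> \<sigma> * nrm (\<phi> \<eta>) x y)"
    if e: "e \<in> phi4 ` set E" and xy: "(x, y) = (0, 1) \<or> x = 1" for e x y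
  proof -
    obtain x' y' n P Q v where p: "(x', y', n, P, Q, v) \<in> set pts" "\<phi> x' = x" "\<phi> y' = y"
      using pt_ex[OF xy] by blast
    obtain e' where e': "e' \<in> set E" "e = phi4 e'" using e by auto
    have "qfc add sub mul e' x' y' \<noteq> v" "\<forall>\<sigma>\<in>set T. qfc add sub mul e' x' y' \<noteq> mul \<sigma> n"
      using data p mats_avoid[OF _ e'(1)] unfolding data_check_def mat_avoids_iff by fastforce+
    moreover have C: "x' \<in> set C" "y' \<in> set C" "v \<in> set C" "n \<in> set C" "\<phi> n = nrm (\<phi> \<eta>) x y" "\<phi> v = S x y"
      using pt[OF p(1)] p by (auto simp: is_point_def)
    moreover have "qfc add sub mul e' x' y' \<in> set C" "\<phi> (qfc add sub mul e' x' y') = qf e x y"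
      using qfc[of e' x' y'] e' E4 C p by auto
    ultimately have q: "qf e x y \<noteq> S x y" "\<And>\<sigma>. \<sigma> \<in> set T \<Longrightarrow> qf e x y \<noteq> \<phi> (mul \<sigma> n)"
      using TC mul phi_eq_iff by (metis, metis subsetD)
    have "qf e x y \<noteq> \<phi> \<sigma> * nrm (\<phi> \<eta>) x y" if "\<sigma> \<in> set T" for \<sigma>
      using q(2)[OF that] that TC mul C(4,5) by (metis subsetD)
    with q(1) show ?thesis by blast
  qed
  have cT: "card (\<phi> ` set T) \<le> length T"
    using card_image_le[of "set T" \<phi>] card_length[of T] by simp
  have cE: "card (phi4 ` set E) \<le> length E"
    using card_image_le[of "set E" phi4] card_length[of E] by simp
  have le: "card (\<phi> ` set T) * CARD('a) + CARD('a) + 1 + card (phi4 ` set E) \<le> length T * CARD('a) + CARD('a) + 1 + length E"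
    using cT cE by (intro add_mono mult_right_mono) auto
  have an': "\<And>x y. nrm (\<phi> \<eta>) x y = 0 \<Longrightarrow> x = 0 \<and> y = 0" using anisoc[OF an] by blast
  have "\<exists>S :: ('a ^ 4) set set. maximal_partial_spread S \<and>
      card S \<le> card (\<phi> ` set T) * CARD('a) + CARD('a) + 1 + card (phi4 ` set E)"
  proof (rule spread_criterion_norm[where s = "S 1" and si = "S 0 1", OF an'])
    fix t \<sigma> y :: 'a
    show "S 1 y \<noteq> \<sigma> * nrm (\<phi> \<eta>) 1 y" if "\<sigma> \<in> \<phi> ` set T" using S_ne that by simp
    show "S 0 1 \<noteq> \<sigma> * nrm (\<phi> \<eta>) 0 1" if "\<sigma> \<in> \<phi> ` set T" using S_ne that by simp
    show "(\<exists>y. t * nrm (\<phi> \<eta>) 1 y = S 1 y) \<or> t * nrm (\<phi> \<eta>) 0 1 = S 0 1" if "t \<notin> \<phi> ` set T"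
    proof -
      have "dec t \<notin> set T" using that dec[of t] by force
      then obtain x' y' n P Q v where p: "(x', y', n, P, Q, v) \<in> set pts" "mul (dec t) n = v"
        using data dec[of t] unfolding data_check_def mults_hit_iff mult_hit_iff by fastforce
      have C: "n \<in> set C" "\<phi> n = nrm (\<phi> \<eta>) (\<phi> x') (\<phi> y')" "\<phi> v = S (\<phi> x') (\<phi> y')"
        using pt[OF p(1)] by (auto simp: is_point_def)
      have "t * nrm (\<phi> \<eta>) (\<phi> x') (\<phi> y') = S (\<phi> x') (\<phi> y')"
        using C p(2) mul dec[of t] by metis
      then show ?thesis using pt01[OF p(1)] by auto
    qed
  next
    fix e e' assume e: "e \<in> phi4 ` set E" "e' \<in> phi4 ` set E" "sing e e'"
    then obtain f f' where f: "f \<in> set E" "f' \<in> set E" "e = phi4 f" "e' = phi4 f'" by auto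
    then have "sing (phi4 f') (phi4 f)"
      using e f sing_sym by simp
    then have "singc sub mul f f'" "singc sub mul f' f" using e f singc E4 by simp_all
    then show "e = e'" using f data mats_avoid_sing unfolding data_check_def by blast
  next
    fix e \<sigma> x y assume e: "e \<in> phi4 ` set E" "\<sigma> \<in> \<phi> ` set T" "qf e x y = \<sigma> * nrm (\<phi> \<eta>) x y"
    obtain a b c d where abcd: "e = (a, b, c, d)" by (cases e)
    show "x = 0 \<and> y = 0"
    proof (rule ccontr)
      assume nz: "\<not> ?thesis"
      show False
      \<comment> \<open>Both sides are quadratic in (x, y), so an agreement scales to (0, 1) or (1,
        y/x), where \<open>E\<close> was tested.\<close>
      proof (cases "x = 0")
        case True
        then have y: "y \<noteq> 0" using nz by simp
        have "y * y * qf e 0 1 = y * y * (\<sigma> * nrm (\<phi> \<eta>) 0 1)"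
          using e(3) by (simp add: True abcd nrm_def algebra_simps)
        then have "qf e 0 1 = \<sigma> * nrm (\<phi> \<eta>) 0 1" using y by simp
        then show False using E_pt[OF e(1), of 0 1] e(2) by simp
      next
        case False
        have h: "x * x * qf e 1 (y / x) = qf e x y" "x * x * nrm (\<phi> \<eta>) 1 (y / x) = nrm (\<phi> \<eta>) x y"
          using False by (simp_all add: abcd nrm_def field_simps)
        then have "x * x * qf e 1 (y / x) = x * x * (\<sigma> * nrm (\<phi> \<eta>) 1 (y / x))"
          using e(3) by (simp add: mult.left_commute)
        then have "qf e 1 (y / x) = \<sigma> * nrm (\<phi> \<eta>) 1 (y / x)" using False by simp
        then show False using E_pt[OF e(1), of 1 "y / x"] e(2) by simp
      qed
    qed
  next
    fix e y assume "e \<in> phi4 ` set E"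
    then show "qf e 1 y \<noteq> S 1 y" "qf e 0 1 \<noteq> S 0 1" using E_pt by auto
  next
    fix t u w :: 'a assume uw: "u \<noteq> 0 \<or> w \<noteq> 0"
    define r where "r = nrmc add mul \<eta> (dec w) (dec u)"
    have r: "r \<in> set C" "\<phi> r = nrm (\<phi> \<eta>) w u"
      using nrmc[OF \<eta>, of "dec w" "dec u"] dec[of u] dec[of w] by (simp_all add: r_def)
    have "nrm (\<phi> \<eta>) w u \<noteq> 0" using anisoc[OF an] uw by blast
    then have "r \<noteq> zero" using r zero by auto
    then have "rows_mem r (rows_of sub (norm_table add mul \<eta> C) (dec t) T) \<or>
        tab_extra add sub mul \<eta> C E pts (dec t) r (norm_table add mul \<eta> C)"
      using cov r dec[of t] unfolding cover_check_iff norms_check_iff set_nonzeros by simp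
    then show "(\<exists>\<sigma>\<in>\<phi> ` set T. \<exists>z. nrm (\<phi> \<eta>) z (\<sigma> - t) = nrm (\<phi> \<eta>) w u)
        \<or> (\<exists>y. t * nrm (\<phi> \<eta>) 1 y + tau (\<phi> \<eta>) u w 1 y = S 1 y) \<or> t * nrm (\<phi> \<eta>) 0 1 + tau (\<phi> \<eta>) u w 0 1 = S 0 1
        \<or> (\<forall>a. \<exists>e\<in>phi4 ` set E. sing (umat (\<phi> \<eta>) a t u w) e)"
    proof
      assume "rows_mem r (rows_of sub (norm_table add mul \<eta> C) (dec t) T)"
      then obtain \<sigma> z where \<sigma>: "\<sigma> \<in> set T" "(z, r) \<in> set (row_of (sub \<sigma> (dec t)) (norm_table add mul \<eta> C))"
        unfolding rows_mem_iff row_mem_iff set_rows_of by auto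
      then have "(sub \<sigma> (dec t), row_of (sub \<sigma> (dec t)) (norm_table add mul \<eta> C)) \<in> set (norm_table add mul \<eta> C)"
        using row_of_in[of "sub \<sigma> (dec t)" "norm_table add mul \<eta> C"] by auto
      then have "z \<in> set C" "sub \<sigma> (dec t) \<in> set C" "r = nrmc add mul \<eta> z (sub \<sigma> (dec t))"
        using \<sigma>(2) unfolding norm_table_def norm_rows_eq by auto
      then have "nrm (\<phi> \<eta>) (\<phi> z) (\<phi> (sub \<sigma> (dec t))) = nrm (\<phi> \<eta>) w u"
        using r nrmc \<eta> by metis
      moreover have "\<phi> (sub \<sigma> (dec t)) = \<phi> \<sigma> - t" using \<sigma> TC sub dec[of t] by (metis subsetD)
      ultimately show ?thesis using \<sigma>(1) by auto
    next
      assume "tab_extra add sub mul \<eta> C E pts (dec t) r (norm_table add mul \<eta> C)"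
      moreover have "(dec u, map (\<lambda>w. (w, nrmc add mul \<eta> w (dec u))) C) \<in> set (norm_table add mul \<eta> C)"
        using dec[of u] by (auto simp: norm_table_def norm_rows_eq)
      ultimately have "row_extra add sub mul \<eta> C E pts (dec t) r (dec u) (map (\<lambda>w. (w, nrmc add mul \<eta> w (dec u))) C)"
        unfolding tab_extra_iff by auto
      moreover have "(dec w, r) \<in> set (map (\<lambda>w. (w, nrmc add mul \<eta> w (dec u))) C)"
        using dec[of w] by (auto simp: r_def)
      ultimately have "hit add mul (dec t) (dec u) (add (dec u) (dec w)) pts \<or>
          sing_all add sub mul \<eta> E (dec t) (dec u) (add (dec u) (dec w)) C"
        unfolding row_extra_iff by blast
      then show ?thesis
      proof
        assume "hit add mul (dec t) (dec u) (add (dec u) (dec w)) pts"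
        then have "\<exists>(x, y, n, P, Q, s)\<in>set pts.
            t * nrm (\<phi> \<eta>) (\<phi> x) (\<phi> y) + tau (\<phi> \<eta>) u w (\<phi> x) (\<phi> y) = S (\<phi> x) (\<phi> y)"
          using hit[of "dec t" "dec u" "dec w" pts "\<phi> \<eta>" S] pt dec by simp
        then obtain x y n P Q v where p: "(x, y, n, P, Q, v) \<in> set pts"
          "t * nrm (\<phi> \<eta>) (\<phi> x) (\<phi> y) + tau (\<phi> \<eta>) u w (\<phi> x) (\<phi> y) = S (\<phi> x) (\<phi> y)" by auto
        then show ?thesis using pt01[OF p(1)] by auto
      next
        assume a: "sing_all add sub mul \<eta> E (dec t) (dec u) (add (dec u) (dec w)) C"
        have "\<exists>e\<in>phi4 ` set E. sing (umat (\<phi> \<eta>) a t u w) e" for a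
          using sing_all[OF a E4, of "dec a"] \<eta> dec by simp
        then show ?thesis by blast
      qed
    qed
  qed (assumption | rule order_trans[OF le bound])+
  then show ?thesis using le by (meson order_trans)
qed

end


lemma spread_int:
  assumes card: "CARD('a::{field,finite}) = nat p" and p: "prime (p :: int)"
    and ok: "spread_ok (iadd p) (isub p) (imul p) 0 1 [0..p - 1] \<eta> T ss si E"
    and bound: "length T * CARD('a) + CARD('a) + 1 + length E \<le> CARD('a)\<^sup>2"
    and size: "length T * CARD('a) + CARD('a) + 1 + length E \<le> m"
  shows "\<exists>S :: ('a ^ 4) set set. maximal_partial_spread S \<and> card S \<le> m"
  using coded_field.spread_check[OF coded_field_int[OF card p] ok bound] size by (meson order_trans)

text \<open>The first test yields a root of the polynomial, the second makes evaluation at it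
  injective.\<close>

definition field_ok :: "nat \<Rightarrow> nat \<Rightarrow> nat list \<Rightarrow> bool" where
  "field_ok p n g \<longleftrightarrow> last (orbit p g (p ^ n - 1) (lone n)) = lone n \<and>
    subset_list (digits p n) (replicate n 0 # orbit p g (p ^ n - 1) (lone n))"

lemma coded_field_ok:
  assumes "CARD('a::{field,finite}) = p ^ n" "1 < p" "0 < n" "g \<in> codes p n" "field_ok p n g"
  shows "\<exists>\<phi> :: nat list \<Rightarrow> 'a. coded_field \<phi> (digits p n) (ladd p) (lsub p) (lmul p g) (replicate n 0) (lone n)"
  using assms by (intro coded_field_lists) (auto simp: field_ok_def subset_list_iff)

lemma spread_lists:
  assumes card: "CARD('a::{field,finite}) = p ^ n" and "1 < p" "0 < n" "g \<in> codes p n"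
    and ok: "field_ok p n g"
      "spread_ok (ladd p) (lsub p) (lmul p g) (replicate n 0) (lone n) (digits p n) \<eta> T ss si E"
    and bound: "length T * CARD('a) + CARD('a) + 1 + length E \<le> CARD('a)\<^sup>2"
    and size: "length T * CARD('a) + CARD('a) + 1 + length E \<le> m"
  shows "\<exists>S :: ('a ^ 4) set set. maximal_partial_spread S \<and> card S \<le> m"
proof -
  obtain \<phi> :: "nat list \<Rightarrow> 'a" where
    "coded_field \<phi> (digits p n) (ladd p) (lsub p) (lmul p g) (replicate n 0) (lone n)"
    using coded_field_ok[OF assms(1-5)] by blast
  from coded_field.spread_check[OF this ok(2) bound] size show ?thesis by (meson order_trans)
qed


lemma spread_lists_odd:
  assumes card: "CARD('a::{field,finite}) = p ^ n" and "1 < p" "0 < n" "g \<in> codes p n"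
    and ok: "field_ok p n g"
      "cover_ok_odd (ladd p) (lsub p) (lmul p g) (replicate n 0) (lone n) (digits p n) \<eta> \<kappa> T hs ts"
    and bound: "length T * CARD('a) + CARD('a) + 1 \<le> CARD('a)\<^sup>2"
    and size: "length T * CARD('a) + CARD('a) + 1 \<le> m"
  shows "\<exists>S :: ('a ^ 4) set set. maximal_partial_spread S \<and> card S \<le> m"
proof -
  obtain \<phi> :: "nat list \<Rightarrow> 'a" where
    "coded_field \<phi> (digits p n) (ladd p) (lsub p) (lmul p g) (replicate n 0) (lone n)"
    using coded_field_ok[OF assms(1-5)] by blast
  from coded_field.cover_ok_odd[OF this ok(2) bound] size show ?thesis by (meson order_trans)
qed

lemma spread_lists_even:
  assumes card: "CARD('a::{field,finite}) = p ^ n" and "1 < p" "0 < n" "g \<in> codes p n"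
    and ok: "field_ok p n g"
      "cover_ok_even (ladd p) (lsub p) (lmul p g) (replicate n 0) (lone n) (digits p n) \<eta> bs T hs ts"
    and bound: "length T * CARD('a) + CARD('a) + 1 \<le> CARD('a)\<^sup>2"
    and size: "length T * CARD('a) + CARD('a) + 1 \<le> m"
  shows "\<exists>S :: ('a ^ 4) set set. maximal_partial_spread S \<and> card S \<le> m"
proof -
  obtain \<phi> :: "nat list \<Rightarrow> 'a" where
    "coded_field \<phi> (digits p n) (ladd p) (lsub p) (lmul p g) (replicate n 0) (lone n)"
    using coded_field_ok[OF assms(1-5)] by blast
  from coded_field.cover_ok_even[OF this ok(2) bound] size show ?thesis by (meson order_trans)
qed

section \<open>Prime fields\<close>

fun orl :: "bool list \<Rightarrow> bool list \<Rightarrow> bool list" where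
  "orl (True # xs) (y # ys) = True # orl xs ys"
| "orl (False # xs) (y # ys) = y # orl xs ys"
| "orl xs ys = []"

lemma orl_eq: "orl xs ys = map2 (\<or>) xs ys"
  by (induction xs ys rule: orl.induct) auto

fun orls :: "bool list list \<Rightarrow> bool list list \<Rightarrow> bool list list" where
  "orls (x # xs) (y # ys) = orl x y # orls xs ys"
| "orls xs ys = []"

lemma orls_eq: "orls xs ys = map2 orl xs ys"
  by (induction xs ys rule: orls.induct) auto

definition rotl :: "nat \<Rightarrow> 'b list \<Rightarrow> 'b list" where
  "rotl e xs = drop e xs @ take e xs"

lemma rotl: "e < length xs \<Longrightarrow> rotl e xs = rotate e xs"
  by (simp add: rotl_def rotate_drop_take)

fun mask :: "'c list \<Rightarrow> 'c list \<Rightarrow> bool list" where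
  "mask S [] = []"
| "mask S (c # cs) = lmem c S # mask S cs"

lemma mask_eq: "mask S cs = map (\<lambda>c. c \<in> set S) cs"
  by (induction cs) (auto simp: lmem_iff)

text \<open>Row d marks the residues j for which j - \<kappa>d^2 is a square, that is, norms with
  \<omega>-coordinate d. It is the mask of squares, rotated.\<close>

fun rot_masks :: "int \<Rightarrow> int \<Rightarrow> bool list \<Rightarrow> int list \<Rightarrow> bool list list" where
  "rot_masks p \<kappa> m [] = []"
| "rot_masks p \<kappa> m (d # ds) = rotl (nat ((- (\<kappa> * d * d)) mod p)) m # rot_masks p \<kappa> m ds"

lemma rot_masks_eq: "rot_masks p \<kappa> m ds = map (\<lambda>d. rotl (nat ((- (\<kappa> * d * d)) mod p)) m) ds"
  by (induction ds) auto

text \<open>Rotating the list of rows by \<sigma> puts row t + \<sigma> in place t, so one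
  disjunction treats all t simultaneously.\<close>

fun union_rots :: "bool list list \<Rightarrow> nat list \<Rightarrow> bool list list" where
  "union_rots ms [] = []"
| "union_rots ms [\<sigma>] = rotl \<sigma> ms"
| "union_rots ms (\<sigma> # T) = orls (rotl \<sigma> ms) (union_rots ms T)"

fun full :: "bool list \<Rightarrow> bool" where
  "full [] \<longleftrightarrow> True"
| "full (b # bs) \<longleftrightarrow> b \<and> full bs"

text \<open>The dropped head is the entry for \<rho> = 0, on which there is no condition.\<close>

fun fulls_tl :: "bool list list \<Rightarrow> bool" where
  "fulls_tl [] \<longleftrightarrow> True"
| "fulls_tl (m # ms) \<longleftrightarrow> full (tl m) \<and> fulls_tl ms"

lemma full_iff: "full bs \<longleftrightarrow> (\<forall>i<length bs. bs ! i)"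
  by (induction bs) (auto simp: less_Suc_eq_0_disj nth_Cons split: nat.splits)

lemma fulls_tl_iff: "fulls_tl ms \<longleftrightarrow> (\<forall>m\<in>set ms. full (tl m))"
  by (induction ms) auto

definition masks_ok :: "int \<Rightarrow> int \<Rightarrow> int \<Rightarrow> nat list \<Rightarrow> bool" where
  "masks_ok p \<eta> \<kappa> T \<longleftrightarrow> (4 * \<kappa> + 1 - 4 * \<eta>) mod p = 0 \<and> anisoc (iadd p) (imul p) 0 1 \<eta> [0..p - 1] \<and>
    T \<noteq> [] \<and> list_all (\<lambda>\<sigma>. \<sigma> < nat p) T \<and>
    fulls_tl (union_rots (rot_masks p \<kappa> (mask (dedup [] (squares (imul p) [0..p - 1])) [0..p - 1]) [0..p - 1]) T)"

lemma union_rots_nth: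
  assumes "T \<noteq> []" "\<forall>\<sigma>\<in>set T. \<sigma> < length ms" "\<forall>m\<in>set ms. length m = n" "t < length ms" "j < n"
  shows "length (union_rots ms T) = length ms \<and> length (union_rots ms T ! t) = n \<and>
    (union_rots ms T ! t ! j \<longrightarrow> (\<exists>\<sigma>\<in>set T. ms ! ((t + \<sigma>) mod length ms) ! j))"
  using assms
proof (induction ms T rule: union_rots.induct)
  case (2 ms \<sigma>)
  then have "ms ! ((\<sigma> + t) mod length ms) \<in> set ms" by (intro nth_mem mod_less_divisor) auto
  then show ?case using 2 by (simp add: rotl nth_rotate add.commute)
next
  case (3 ms \<sigma> \<sigma>' T)
  have m: "ms ! ((\<sigma> + t) mod length ms) \<in> set ms" using 3 by (intro nth_mem mod_less_divisor) auto
  show ?case using 3 m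
    by (auto simp: rotl nth_rotate add.commute orls_eq orl_eq)
qed simp

text \<open>The masks show that each \<rho> \<noteq> 0 is a norm with \<omega>-coordinate t +
  \<sigma> for some \<sigma> in the list. This is the covering condition for the negated
  list.\<close>

theorem masks_ok_spread:
  assumes card: "CARD('a::{field,finite}) = nat p" and p: "prime (p :: int)" and ok: "masks_ok p \<eta> \<kappa> T"
    and bound: "length T * CARD('a) + CARD('a) + 1 \<le> CARD('a)\<^sup>2"
    and size: "length T * CARD('a) + CARD('a) + 1 \<le> m"
  shows "\<exists>S :: ('a ^ 4) set set. maximal_partial_spread S \<and> card S \<le> m"
proof -
  let ?C = "[0..p - 1]"
  interpret F: coded_field "of_int :: int \<Rightarrow> 'a" ?C "iadd p" "isub p" "imul p" 0 1
    by (rule coded_field_int[OF card p])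
  have p1: "1 < p" using p by (rule prime_gt_1_int)
  have char: "of_int p = (0 :: 'a)"
    using of_nat_card_eq_0[where 'a = 'a] p1 card by (simp add: of_nat_nat)
  have ofm: "of_int (a mod p) = (of_int a :: 'a)" for a
  proof -
    have "of_int (p * (a div p) + a mod p) = (of_int a :: 'a)" by simp
    then show ?thesis by (simp only: of_int_add of_int_mult char) simp
  qed
  have an: "anisoc (iadd p) (imul p) 0 1 \<eta> ?C" using ok by (simp add: masks_ok_def)
  have "of_int ((4 * \<kappa> + 1 - 4 * \<eta>) mod p) = (0 :: 'a)" using ok by (simp add: masks_ok_def)
  then have k: "4 * of_int \<kappa> + 1 = (4 * of_int \<eta> :: 'a)" by (simp add: ofm)
  define H where "H = mask (dedup [] (squares (imul p) ?C)) ?C"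
  define ms where "ms = rot_masks p \<kappa> H ?C"
  have lC: "length ?C = nat p" by simp
  have lH: "length H = nat p" by (simp add: H_def mask_eq)
  have H: "\<exists>v. of_int (int j) = (v * v :: 'a)" if "j < nat p" "H ! j" for j
  proof -
    have "int j \<in> set (squares (imul p) ?C)"
      using that by (simp add: H_def mask_eq set_dedup)
    then obtain w where "int j = imul p w w" by (auto simp: squares_eq)
    then have "of_int (int j) = (of_int w * of_int w :: 'a)" by (simp only: imul_def ofm of_int_mult)
    then show ?thesis by blast
  qed
  define r where "r d = nat ((- (\<kappa> * d * d)) mod p)" for d
  have r: "r d < length H" for d using p1 by (simp add: r_def lH nat_less_iff)
  have lms: "length ms = nat p" by (simp add: ms_def rot_masks_eq)
  have ms_nth: "ms ! i = rotate (r (int i)) H" if "i < nat p" for i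
    using that by (simp add: ms_def rot_masks_eq rotl[OF r] flip: r_def)
  have ms_len: "\<forall>m\<in>set ms. length m = nat p"
    using lms lH by (auto simp: in_set_conv_nth ms_nth)
  have hit: "\<exists>w. nrm (of_int \<eta>) w (of_int (int i)) = (of_int (int j) :: 'a)"
    if ij: "i < nat p" "j < nat p" "ms ! i ! j" for i j
  proof -
    have "H ! ((r (int i) + j) mod nat p)" using ij by (simp add: ms_nth nth_rotate lH)
    then obtain v where v: "of_int (int ((r (int i) + j) mod nat p)) = (v * v :: 'a)"
      using H[of "(r (int i) + j) mod nat p"] p1 by auto
    have "of_int (int ((r (int i) + j) mod nat p)) = (of_int (int (r (int i)) + int j) :: 'a)"
      using p1 by (simp add: zmod_int ofm)
    also have "\<dots> = - (of_int \<kappa> * of_int (int i) * of_int (int i)) + of_int (int j)"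
    proof -
      have "int (r (int i)) = (- (\<kappa> * int i * int i)) mod p" using p1 by (simp add: r_def)
      then show ?thesis by (simp only: of_int_add ofm of_int_minus of_int_mult)
    qed
    finally have j: "of_int (int j) = (of_int \<kappa> * of_int (int i) * of_int (int i) + v * v :: 'a)"
      using v by (simp add: algebra_simps)
    show ?thesis unfolding j by (rule nrm_complete_square[OF k])
  qed
  \<comment> \<open>Rotation produces t + \<sigma> where the criterion has \<sigma> - t. The signs
    are reconciled by negating the set and by N(-w, -d) = N(w, d).\<close>
  define T' where "T' = (\<lambda>\<sigma>. - of_nat \<sigma> :: 'a) ` set T"
  have cT: "card T' \<le> length T" unfolding T'_def
    using card_image_le[of "set T" "\<lambda>\<sigma>. - of_nat \<sigma> :: 'a"] card_length[of T] by simp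
  then have cT': "card T' * CARD('a) + CARD('a) + 1 \<le> length T * CARD('a) + CARD('a) + 1" by simp
  have an': "\<And>x y :: 'a. nrm (of_int \<eta>) x y = 0 \<Longrightarrow> x = 0 \<and> y = 0" using F.anisoc[OF an] by blast
  have "\<exists>S :: ('a ^ 4) set set. maximal_partial_spread S \<and> card S \<le> card T' * CARD('a) + CARD('a) + 1"
  proof (rule spread_criterion_cover[OF an'])
    fix t \<rho> :: 'a assume \<rho>: "\<rho> \<noteq> 0"
    define i j where "i = nat (F.dec t)" and "j = nat (F.dec \<rho>)"
    have i: "i < nat p" "of_int (int i) = t" using F.dec[of t] by (auto simp: i_def)
    have j: "j < nat p" "of_int (int j) = \<rho>" using F.dec[of \<rho>] by (auto simp: j_def)
    have j0: "0 < j" using j \<rho> by (cases j) auto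
    have T: "T \<noteq> []" "\<forall>\<sigma>\<in>set T. \<sigma> < length ms" using ok by (auto simp: masks_ok_def list_all_iff lms)
    note U = union_rots_nth[OF T ms_len, of i j]
    have "full (tl (union_rots ms T ! i))"
      using ok U i j lms unfolding masks_ok_def fulls_tl_iff H_def[symmetric] ms_def[symmetric] by simp
    then have "tl (union_rots ms T ! i) ! (j - 1)"
      using U i j j0 lms by (simp add: full_iff)
    then have "union_rots ms T ! i ! j"
      using U i j j0 lms by (simp add: nth_tl)
    then obtain \<sigma> where \<sigma>: "\<sigma> \<in> set T" "ms ! ((i + \<sigma>) mod nat p) ! j"
      using U i j lms by auto
    then obtain w where "nrm (of_int \<eta>) w (of_int (int ((i + \<sigma>) mod nat p))) = \<rho>"
      using hit[of "(i + \<sigma>) mod nat p" j] j p1 by auto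
    moreover have "of_int (int ((i + \<sigma>) mod nat p)) = t + of_nat \<sigma>"
      using p1 i by (simp add: zmod_int ofm)
    ultimately have "nrm (of_int \<eta>) (- w) (- of_nat \<sigma> - t) = \<rho>"
      by (simp add: nrm_def algebra_simps)
    then show "\<exists>\<sigma>\<in>T'. \<exists>z. nrm (of_int \<eta>) z (\<sigma> - t) = \<rho>"
      using \<sigma>(1) unfolding T'_def by blast
  qed (assumption | rule order_trans[OF cT' bound])+
  then show ?thesis using cT' size by (meson order_trans)
qed

section \<open>The individual fields\<close>

text \<open>One family of 5 graphs, 6 point lines and 4 = q - 1 additional graphs, the largest
  number that fits.\<close>

lemma spread_5:
  assumes "CARD('a::{field,finite}) = 5"
  shows "\<exists>S :: ('a ^ 4) set set. maximal_partial_spread S \<and> card S \<le> 15"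
  by (rule spread_int[where p = 5 and \<eta> = 1 and T = "[0]" and E = "[(1, 2, 4, 1), (3, 2, 4, 3), (4, 2, 4, 4), (1, 4, 2, 1)]" and si = 2 and
      ss = "[1, 1, 4, 4, 4]"])
    (use assms in simp, simp, code_simp, simp_all add: assms)

lemma spread_7:
  assumes "CARD('a::{field,finite}) = 7"
  shows "\<exists>S :: ('a ^ 4) set set. maximal_partial_spread S \<and> card S \<le> 28"
  by (rule spread_int[where p = 7 and \<eta> = 3 and T = "[0, 1]" and E = "[(1, 3, 4, 3), (2, 3, 4, 4), (6, 3, 4, 1), (0, 3, 4, 2), (4, 3, 4, 6), (3, 3, 2, 0)]" and si = 5 and
      ss = "[6, 2, 2, 2, 2, 5, 1]"])
    (use assms in simp, simp, code_simp, simp_all add: assms)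

lemma spread_8:
  assumes "CARD('a::{field,finite}) = 8"
  shows "\<exists>S :: ('a ^ 4) set set. maximal_partial_spread S \<and> card S \<le> 32"
  by (rule spread_lists[where p = 2 and n = 3 and g = "[1, 0, 1]" and \<eta> = "[0, 1, 0]" and
      T = "[[0, 0, 0], [1, 0, 0]]" and
      E = "[([1, 1, 1], [0, 0, 1], [1, 1, 1], [1, 0, 1]), ([1, 1, 0], [1, 1, 0], [0, 0, 1], [1, 0, 1]), ([1, 1, 1], [1, 1, 0], [0, 0, 1], [1, 0, 0]), ([0, 1, 1], [1, 1, 0], [0, 0, 1], [0, 0, 0]), ([1, 0, 0], [1, 1, 0], [0, 0, 1], [1, 1, 1]), ([1, 1, 0], [0, 0, 1], [0, 1, 1], [1, 1, 1]), ([1, 0, 1], [1, 1, 0], [0, 0, 1], [1, 1, 0])]" and si = "[1, 0, 0]" and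
      ss = "[[1, 1, 0], [1, 1, 1], [1, 0, 0], [1, 1, 0], [1, 0, 1], [0, 0, 1], [0, 1, 1], [0, 0, 1]]"])
    (simp add: assms, simp, simp, simp add: codes_def, code_simp, code_simp, simp_all add: assms)

lemma spread_9:
  assumes "CARD('a::{field,finite}) = 9"
  shows "\<exists>S :: ('a ^ 4) set set. maximal_partial_spread S \<and> card S \<le> 37"
  by (rule spread_lists[where p = 3 and n = 2 and g = "[1, 1]" and \<eta> = "[0, 1]" and
      T = "[[0, 0], [1, 0], [0, 1]]" and
      E = "[]" and si = "[1, 2]" and
      ss = "[[1, 2], [2, 2], [2, 0], [1, 2], [0, 1], [0, 1], [0, 2], [2, 0], [1, 0]]"])
    (simp add: assms, simp, simp, simp add: codes_def, code_simp, code_simp, simp_all add: assms)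

lemma spread_11:
  assumes "CARD('a::{field,finite}) = 11"
  shows "\<exists>S :: ('a ^ 4) set set. maximal_partial_spread S \<and> card S \<le> 45"
  by (rule spread_int[where p = 11 and \<eta> = 1 and T = "[0, 1, 6]" and E = "[]" and si = 5 and
      ss = "[5, 10, 1, 9, 2, 1, 8, 4, 6, 4, 7]"])
    (use assms in simp, simp, code_simp, simp_all add: assms)

lemma spread_13:
  assumes "CARD('a::{field,finite}) = 13"
  shows "\<exists>S :: ('a ^ 4) set set. maximal_partial_spread S \<and> card S \<le> 66"
  by (rule spread_int[where p = 13 and \<eta> = 2 and T = "[0, 1, 2, 3]" and E = "[]" and si = 9 and
      ss = "[10, 7, 12, 2, 2, 6, 10, 10, 2, 12, 2, 11, 1]"])
    (use assms in simp, simp, code_simp, simp_all add: assms)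

text \<open>\<open>T\<close> is the subfield with 4 elements, here {0, 1, x^10, x^5}. Being an
  additive group it serves as its own \<open>hs\<close>, leaving four coset representatives.\<close>

lemma spread_16:
  assumes "CARD('a::{field,finite}) = 16"
  shows "\<exists>S :: ('a ^ 4) set set. maximal_partial_spread S \<and> card S \<le> 81"
  by (rule spread_lists_even[where p = 2 and n = 4 and g = "[1, 0, 0, 1]" and \<eta> = "[0, 1, 0, 0]" and bs = "[[1, 0, 0, 0], [0, 1, 0, 0], [0, 0, 1, 0], [0, 0, 0, 1]]" and
      T = "[[0, 0, 0, 0], [1, 0, 0, 0], [0, 1, 0, 1], [1, 1, 0, 1]]" and
      hs = "[[0, 0, 0, 0], [1, 0, 0, 0], [0, 1, 0, 1], [1, 1, 0, 1]]" and
      ts = "[[0, 0, 0, 0], [0, 1, 0, 0], [0, 0, 1, 0], [0, 1, 1, 0]]"])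
    (simp add: assms, simp, simp, simp add: codes_def, code_simp, code_simp, simp_all add: assms)

lemma spread_17:
  assumes "CARD('a::{field,finite}) = 17"
  shows "\<exists>S :: ('a ^ 4) set set. maximal_partial_spread S \<and> card S \<le> 103"
  by (rule masks_ok_spread[where p = 17 and \<eta> = 1 and \<kappa> = 5 and T = "[0, 1, 8, 15, 16]"])
    (use assms in simp, simp, code_simp, simp_all add: assms)

lemma spread_19:
  assumes "CARD('a::{field,finite}) = 19"
  shows "\<exists>S :: ('a ^ 4) set set. maximal_partial_spread S \<and> card S \<le> 115"
  by (rule masks_ok_spread[where p = 19 and \<eta> = 2 and \<kappa> = 16 and T = "[0, 1, 8, 15, 17]"])
    (use assms in simp, simp, code_simp, simp_all add: assms)

lemma spread_23:
  assumes "CARD('a::{field,finite}) = 23"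
  shows "\<exists>S :: ('a ^ 4) set set. maximal_partial_spread S \<and> card S \<le> 162"
  by (rule masks_ok_spread[where p = 23 and \<eta> = 1 and \<kappa> = 18 and T = "[0, 1, 7, 13, 19, 22]"])
    (use assms in simp, simp, code_simp, simp_all add: assms)

lemma spread_25:
  assumes "CARD('a::{field,finite}) = 25"
  shows "\<exists>S :: ('a ^ 4) set set. maximal_partial_spread S \<and> card S \<le> 176"
  by (rule spread_lists[where p = 5 and n = 2 and g = "[2, 2]" and \<eta> = "[2, 1]" and
      T = "[[0, 0], [1, 0], [2, 0], [3, 0], [0, 1], [0, 2]]" and
      E = "[]" and si = "[3, 4]" and
      ss = "[[3, 3], [4, 0], [2, 1], [0, 1], [0, 2], [4, 4], [4, 3], [0, 1], [0, 3], [3, 0], [0, 4], [1, 2], [0, 4], [0, 3], [3, 3], [1, 0], [3, 2], [2, 4], [2, 0], [1, 3], [2, 0], [1, 2], [4, 4], [1, 0], [4, 1]]"])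
    (simp add: assms, simp, simp, simp add: codes_def, code_simp, code_simp, simp_all add: assms)

lemma spread_27:
  assumes "CARD('a::{field,finite}) = 27"
  shows "\<exists>S :: ('a ^ 4) set set. maximal_partial_spread S \<and> card S \<le> 190"
  by (rule spread_lists[where p = 3 and n = 3 and g = "[2, 0, 1]" and \<eta> = "[2, 0, 0]" and
      T = "[[0, 0, 0], [1, 0, 0], [2, 0, 0], [0, 1, 0], [1, 1, 0], [2, 2, 1]]" and
      E = "[]" and si = "[1, 1, 0]" and
      ss = "[[2, 0, 2], [1, 2, 1], [0, 2, 2], [1, 2, 0], [1, 0, 1], [1, 1, 0], [1, 1, 0], [0, 1, 2], [1, 1, 1], [0, 1, 1], [0, 2, 0], [2, 2, 1], [2, 1, 2], [2, 0, 1], [2, 1, 1], [0, 2, 1], [2, 2, 2], [2, 2, 2], [0, 2, 0], [0, 1, 0], [2, 1, 1], [0, 2, 1], [2, 2, 0], [2, 0, 0], [2, 0, 0], [2, 0, 0], [2, 1, 0]]"])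
    (simp add: assms, simp, simp, simp add: codes_def, code_simp, code_simp, simp_all add: assms)

lemma spread_29:
  assumes "CARD('a::{field,finite}) = 29"
  shows "\<exists>S :: ('a ^ 4) set set. maximal_partial_spread S \<and> card S \<le> 204"
  by (rule spread_int[where p = 29 and \<eta> = 1 and T = "[0, 1, 2, 3, 4, 6]" and E = "[]" and si = 11 and
      ss = "[7, 13, 17, 7, 17, 7, 17, 17, 27, 10, 7, 3, 26, 11, 2, 14, 27, 14, 15, 23, 22, 8, 10, 20, 14, 16, 16, 19, 23]"])
    (use assms in simp, simp, code_simp, simp_all add: assms)

lemma spread_31:
  assumes "CARD('a::{field,finite}) = 31"
  shows "\<exists>S :: ('a ^ 4) set set. maximal_partial_spread S \<and> card S \<le> 218"
  by (rule spread_int[where p = 31 and \<eta> = 2 and T = "[0, 1, 2, 3, 5, 16]" and E = "[]" and si = 30 and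
      ss = "[8, 24, 14, 25, 2, 29, 22, 21, 17, 1, 18, 22, 5, 19, 5, 30, 20, 6, 24, 15, 6, 4, 20, 26, 2, 27, 27, 2, 11, 16, 21]"])
    (use assms in simp, simp, code_simp, simp_all add: assms)

lemma spread_32:
  assumes "CARD('a::{field,finite}) = 32"
  shows "\<exists>S :: ('a ^ 4) set set. maximal_partial_spread S \<and> card S \<le> 225"
  by (rule spread_lists[where p = 2 and n = 5 and g = "[1, 0, 0, 1, 0]" and \<eta> = "[1, 1, 0, 0, 0]" and
      T = "[[0, 0, 0, 0, 0], [1, 0, 0, 0, 0], [0, 1, 0, 0, 0], [1, 1, 0, 0, 0], [0, 0, 1, 0, 0], [0, 0, 1, 1, 0]]" and
      E = "[]" and si = "[1, 1, 0, 1, 1]" and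
      ss = "[[1, 1, 0, 1, 1], [0, 1, 0, 1, 1], [1, 0, 1, 1, 1], [1, 1, 0, 0, 0], [0, 0, 0, 1, 0], [0, 0, 0, 1, 0], [1, 1, 0, 1, 1], [0, 0, 1, 1, 1], [0, 0, 1, 0, 1], [1, 0, 0, 1, 1], [0, 0, 0, 1, 0], [1, 1, 0, 1, 0], [0, 1, 0, 0, 1], [0, 0, 0, 1, 1], [0, 0, 0, 1, 0], [1, 1, 0, 1, 0], [1, 0, 0, 1, 1], [1, 1, 1, 1, 1], [1, 0, 1, 1, 1], [0, 0, 1, 1, 0], [0, 0, 0, 0, 1], [1, 0, 0, 0, 0], [0, 1, 1, 1, 1], [0, 0, 1, 1, 0], [0, 1, 1, 0, 1], [1, 0, 1, 1, 0], [0, 1, 0, 1, 1], [0, 1, 0, 0, 0], [1, 0, 1, 0, 1], [0, 0, 1, 1, 1], [1, 1, 0, 1, 1], [0, 0, 0, 1, 0]]"])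
    (simp add: assms, simp, simp, simp add: codes_def, code_simp, code_simp, simp_all add: assms)

lemma spread_37:
  assumes "CARD('a::{field,finite}) = 37"
  shows "\<exists>S :: ('a ^ 4) set set. maximal_partial_spread S \<and> card S \<le> 297"
  by (rule masks_ok_spread[where p = 37 and \<eta> = 4 and \<kappa> = 13 and T = "[0, 1, 4, 12, 13, 26, 28]"])
    (use assms in simp, simp, code_simp, simp_all add: assms)

lemma spread_41:
  assumes "CARD('a::{field,finite}) = 41"
  shows "\<exists>S :: ('a ^ 4) set set. maximal_partial_spread S \<and> card S \<le> 329"
  by (rule masks_ok_spread[where p = 41 and \<eta> = 1 and \<kappa> = 11 and T = "[0, 1, 3, 21, 30, 33, 34]"])
    (use assms in simp, simp, code_simp, simp_all add: assms)

lemma spread_43: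
  assumes "CARD('a::{field,finite}) = 43"
  shows "\<exists>S :: ('a ^ 4) set set. maximal_partial_spread S \<and> card S \<le> 345"
  by (rule masks_ok_spread[where p = 43 and \<eta> = 3 and \<kappa> = 35 and T = "[0, 1, 5, 7, 26, 28, 36]"])
    (use assms in simp, simp, code_simp, simp_all add: assms)

lemma spread_47:
  assumes "CARD('a::{field,finite}) = 47"
  shows "\<exists>S :: ('a ^ 4) set set. maximal_partial_spread S \<and> card S \<le> 424"
  by (rule masks_ok_spread[where p = 47 and \<eta> = 1 and \<kappa> = 36 and T = "[0, 1, 12, 17, 20, 23, 26, 38]"])
    (use assms in simp, simp, code_simp, simp_all add: assms)

text \<open>No nontrivial translations are used here, so every t is checked.\<close>

lemma spread_49:
  assumes "CARD('a::{field,finite}) = 49"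
  shows "\<exists>S :: ('a ^ 4) set set. maximal_partial_spread S \<and> card S \<le> 442"
  by (rule spread_lists_odd[where p = 7 and n = 2 and g = "[2, 2]" and \<eta> = "[0, 1]" and \<kappa> = "[5, 1]" and
      T = "[[0, 0], [1, 0], [5, 0], [4, 2], [5, 2], [4, 3], [5, 4], [1, 5]]" and
      hs = "[[0, 0]]" and
      ts = "digits 7 2"])
    (simp add: assms, simp, simp, simp add: codes_def, code_simp, code_simp, simp_all add: assms)

lemma spread_53:
  assumes "CARD('a::{field,finite}) = 53"
  shows "\<exists>S :: ('a ^ 4) set set. maximal_partial_spread S \<and> card S \<le> 478"
  by (rule masks_ok_spread[where p = 53 and \<eta> = 1 and \<kappa> = 14 and T = "[0, 1, 13, 18, 20, 23, 31, 46]"])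
    (use assms in simp, simp, code_simp, simp_all add: assms)

lemma spread_59:
  assumes "CARD('a::{field,finite}) = 59"
  shows "\<exists>S :: ('a ^ 4) set set. maximal_partial_spread S \<and> card S \<le> 532"
  by (rule masks_ok_spread[where p = 59 and \<eta> = 1 and \<kappa> = 45 and T = "[0, 1, 22, 30, 32, 43, 46, 58]"])
    (use assms in simp, simp, code_simp, simp_all add: assms)

lemma spread_61:
  assumes "CARD('a::{field,finite}) = 61"
  shows "\<exists>S :: ('a ^ 4) set set. maximal_partial_spread S \<and> card S \<le> 550"
  by (rule masks_ok_spread[where p = 61 and \<eta> = 2 and \<kappa> = 17 and T = "[0, 1, 5, 6, 7, 8, 20, 27]"])
    (use assms in simp, simp, code_simp, simp_all add: assms)

text \<open>\<open>T\<close> is the additive group spanned by 1, x, x^2, and \<open>ts\<close> is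
  the complement spanned by x^3, x^4, x^5.\<close>

lemma spread_64:
  assumes "CARD('a::{field,finite}) = 64"
  shows "\<exists>S :: ('a ^ 4) set set. maximal_partial_spread S \<and> card S \<le> 577"
  by (rule spread_lists_even[where p = 2 and n = 6 and g = "[1, 0, 0, 0, 0, 1]" and \<eta> = "[0, 1, 0, 0, 0, 0]" and bs = "[[1, 0, 0, 0, 0, 0], [0, 1, 0, 0, 0, 0], [0, 0, 1, 0, 0, 0], [0, 0, 0, 1, 0, 0], [0, 0, 0, 0, 1, 0], [0, 0, 0, 0, 0, 1]]" and
      T = "[[0, 0, 0, 0, 0, 0], [1, 0, 0, 0, 0, 0], [0, 1, 0, 0, 0, 0], [1, 1, 0, 0, 0, 0], [0, 0, 1, 0, 0, 0], [1, 0, 1, 0, 0, 0], [0, 1, 1, 0, 0, 0], [1, 1, 1, 0, 0, 0]]" and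
      hs = "[[0, 0, 0, 0, 0, 0], [1, 0, 0, 0, 0, 0], [0, 1, 0, 0, 0, 0], [1, 1, 0, 0, 0, 0], [0, 0, 1, 0, 0, 0], [1, 0, 1, 0, 0, 0], [0, 1, 1, 0, 0, 0], [1, 1, 1, 0, 0, 0]]" and
      ts = "[[0, 0, 0, 0, 0, 0], [0, 0, 0, 1, 0, 0], [0, 0, 0, 0, 1, 0], [0, 0, 0, 1, 1, 0], [0, 0, 0, 0, 0, 1], [0, 0, 0, 1, 0, 1], [0, 0, 0, 0, 1, 1], [0, 0, 0, 1, 1, 1]]"])
    (simp add: assms, simp, simp, simp add: codes_def, code_simp, code_simp, simp_all add: assms)

lemma spread_67:
  assumes "CARD('a::{field,finite}) = 67"
  shows "\<exists>S :: ('a ^ 4) set set. maximal_partial_spread S \<and> card S \<le> 671"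
  by (rule masks_ok_spread[where p = 67 and \<eta> = 4 and \<kappa> = 54 and T = "[0, 1, 5, 18, 20, 38, 39, 52, 65]"])
    (use assms in simp, simp, code_simp, simp_all add: assms)

lemma spread_71:
  assumes "CARD('a::{field,finite}) = 71"
  shows "\<exists>S :: ('a ^ 4) set set. maximal_partial_spread S \<and> card S \<le> 711"
  by (rule masks_ok_spread[where p = 71 and \<eta> = 1 and \<kappa> = 54 and T = "[0, 1, 19, 35, 45, 50, 52, 58, 67]"])
    (use assms in simp, simp, code_simp, simp_all add: assms)

lemma spread_73:
  assumes "CARD('a::{field,finite}) = 73"
  shows "\<exists>S :: ('a ^ 4) set set. maximal_partial_spread S \<and> card S \<le> 731"
  by (rule masks_ok_spread[where p = 73 and \<eta> = 2 and \<kappa> = 20 and T = "[0, 1, 23, 25, 26, 30, 42, 54, 60]"])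
    (use assms in simp, simp, code_simp, simp_all add: assms)

lemma spread_79:
  assumes "CARD('a::{field,finite}) = 79"
  shows "\<exists>S :: ('a ^ 4) set set. maximal_partial_spread S \<and> card S \<le> 791"
  by (rule masks_ok_spread[where p = 79 and \<eta> = 3 and \<kappa> = 62 and T = "[0, 1, 3, 15, 33, 37, 50, 58, 76]"])
    (use assms in simp, simp, code_simp, simp_all add: assms)

text \<open>\<open>T\<close> is the additive group spanned by 1 and x, and \<open>ts\<close> is the
  complement spanned by x^2 and x^3.\<close>

lemma spread_81:
  assumes "CARD('a::{field,finite}) = 81"
  shows "\<exists>S :: ('a ^ 4) set set. maximal_partial_spread S \<and> card S \<le> 811"
  by (rule spread_lists_odd[where p = 3 and n = 4 and g = "[1, 0, 0, 1]" and \<eta> = "[0, 1, 0, 0]" and \<kappa> = "[2, 1, 0, 0]" and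
      T = "[[0, 0, 0, 0], [1, 0, 0, 0], [2, 0, 0, 0], [0, 1, 0, 0], [1, 1, 0, 0], [2, 1, 0, 0], [0, 2, 0, 0], [1, 2, 0, 0], [2, 2, 0, 0]]" and
      hs = "[[0, 0, 0, 0], [1, 0, 0, 0], [2, 0, 0, 0], [0, 1, 0, 0], [1, 1, 0, 0], [2, 1, 0, 0], [0, 2, 0, 0], [1, 2, 0, 0], [2, 2, 0, 0]]" and
      ts = "[[0, 0, 0, 0], [0, 0, 1, 0], [0, 0, 2, 0], [0, 0, 0, 1], [0, 0, 1, 1], [0, 0, 2, 1], [0, 0, 0, 2], [0, 0, 1, 2], [0, 0, 2, 2]]"])
    (simp add: assms, simp, simp, simp add: codes_def, code_simp, code_simp, simp_all add: assms)

lemma spread_83: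
  assumes "CARD('a::{field,finite}) = 83"
  shows "\<exists>S :: ('a ^ 4) set set. maximal_partial_spread S \<and> card S \<le> 831"
  by (rule masks_ok_spread[where p = 83 and \<eta> = 1 and \<kappa> = 63 and T = "[0, 1, 26, 44, 45, 59, 65, 67, 76]"])
    (use assms in simp, simp, code_simp, simp_all add: assms)

lemma spread_89:
  assumes "CARD('a::{field,finite}) = 89"
  shows "\<exists>S :: ('a ^ 4) set set. maximal_partial_spread S \<and> card S \<le> 891"
  by (rule masks_ok_spread[where p = 89 and \<eta> = 1 and \<kappa> = 23 and T = "[0, 1, 17, 54, 57, 63, 70, 79, 82]"])
    (use assms in simp, simp, code_simp, simp_all add: assms)

lemma spread_97:
  assumes "CARD('a::{field,finite}) = 97"
  shows "\<exists>S :: ('a ^ 4) set set. maximal_partial_spread S \<and> card S \<le> 1068"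
  by (rule masks_ok_spread[where p = 97 and \<eta> = 2 and \<kappa> = 26 and T = "[0, 1, 6, 7, 30, 38, 55, 64, 77, 88]"])
    (use assms in simp, simp, code_simp, simp_all add: assms)

lemma spread_101:
  assumes "CARD('a::{field,finite}) = 101"
  shows "\<exists>S :: ('a ^ 4) set set. maximal_partial_spread S \<and> card S \<le> 1112"
  by (rule masks_ok_spread[where p = 101 and \<eta> = 1 and \<kappa> = 26 and T = "[0, 1, 28, 30, 50, 56, 61, 63, 76, 86]"])
    (use assms in simp, simp, code_simp, simp_all add: assms)

section \<open>The prime powers in the range, and the logarithmic bound\<close>

lemma primepow_cases:
  assumes "primepow (q :: nat)" "5 \<le> q" "q \<le> 101"
  shows "q \<in> {5, 7, 8, 9, 11, 13, 16, 17, 19, 23, 25, 27, 29, 31, 32, 37, 41, 43, 47, 49, 53, 59, 61, 64, 67, 71, 73, 79, 81, 83, 89, 97, 101}"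
proof -
  obtain p k where pk: "prime p" "k > 0" "q = p ^ k" using assms(1) by (auto simp: primepow_def)
  have p2: "2 \<le> p" using pk(1) by (rule prime_ge_2_nat)
  show ?thesis
  proof (cases "k = 1")
    case True
    then have "prime q" using pk by simp
    then have d: "d dvd q \<Longrightarrow> d = 1 \<or> d = q" for d by (simp add: prime_nat_iff)
    \<comment> \<open>A composite number up to 101 has a prime factor below 11, so 2, 3, 5 and 7
      suffice for trial division.\<close>
    have "list_all (\<lambda>n :: nat. n \<in> {5, 7, 11, 13, 17, 19, 23, 29, 31, 37, 41, 43, 47, 53, 59, 61, 67, 71, 73, 79, 83, 89, 97, 101} \<or> 2 dvd n \<or> 3 dvd n \<or> 5 dvd n \<or> 7 dvd n) [5..<102]"
      by (simp add: upt_rec_numeral)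
    then have "q \<in> {5, 7, 11, 13, 17, 19, 23, 29, 31, 37, 41, 43, 47, 53, 59, 61, 67, 71, 73, 79, 83, 89, 97, 101} \<or> 2 dvd q \<or> 3 dvd q \<or> 5 dvd q \<or> 7 dvd q"
      unfolding list_all_iff set_upt using assms(2,3) by simp
    then show ?thesis using d[of 2] d[of 3] d[of 5] d[of 7] assms(2) by auto
  next
    case False
    have "p < 11"
    proof (rule ccontr)
      assume "\<not> p < 11"
      then have "11 ^ 2 \<le> p ^ 2" by (intro power_mono) auto
      also have "\<dots> \<le> p ^ k" using False pk p2 by (intro power_increasing) auto
      finally show False using assms pk by simp
    qed
    moreover have "k < 7"
    proof (rule ccontr)
      assume "\<not> k < 7"
      then have "2 ^ 7 \<le> (2 :: nat) ^ k" by (intro power_increasing) auto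
      also have "\<dots> \<le> p ^ k" using p2 by (intro power_mono) auto
      finally show False using assms pk by simp
    qed
    ultimately have "p \<in> {2, 3, 4, 5, 6, 7, 8, 9, 10}" "k \<in> {2, 3, 4, 5, 6}"
      using p2 False pk(2) by (simp_all only: insert_iff empty_iff) presburger+
    then show ?thesis using pk(1) assms(2,3) unfolding pk(3)
      by (simp only: insert_iff empty_iff) (elim disjE; simp)
  qed
qed

text \<open>From 2^c < q^2 the ceiling is at least c + 1, so a size of at most (c - 1) q suffices.
  In each application c is the largest such exponent; as the inequality is strict, c = 2 log_2 q - 1
  for powers of 2.\<close>

lemma less_bound:
  fixes c N :: nat
  assumes S: "\<exists>S :: ('a::{field,finite} ^ 4) set set. maximal_partial_spread S \<and> card S \<le> N"
    and c: "2 ^ c < q ^ 2" and N: "N + 3 * q < (c + 2) * q + 1"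
  shows "\<exists>S :: ('a ^ 4) set set. maximal_partial_spread S \<and>
           int (card S) < (\<lceil>2 * log 2 (real q)\<rceil> + 1) * int q + 1 - 3 * int q"
proof -
  have q: "q > 0" using c by (cases q) auto
  have "real (2 ^ c) < real (q ^ 2)" using c by (simp only: of_nat_less_iff)
  then have "log 2 (2 ^ c) < log 2 (real q ^ 2)" using q by (subst log_less_cancel_iff) auto
  then have "real c < 2 * log 2 (real q)" using q by (simp add: log_nat_power)
  then have "int c + 1 \<le> \<lceil>2 * log 2 (real q)\<rceil>" by linarith
  then have "(int c + 2) * int q \<le> (\<lceil>2 * log 2 (real q)\<rceil> + 1) * int q" by (intro mult_right_mono) auto
  moreover have "int (N + 3 * q) < int ((c + 2) * q + 1)" using N by (simp only: of_nat_less_iff)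
  then have "int N + 3 * int q < (int c + 2) * int q + 1" by (simp add: distrib_right)
  ultimately have "int N < (\<lceil>2 * log 2 (real q)\<rceil> + 1) * int q + 1 - 3 * int q" by linarith
  then show ?thesis using S by force
qed

theorem theorem1:
  fixes q :: nat
  assumes "primepow q" and "5 \<le> q" and "q \<le> 101"
    and "CARD('a::{field,finite}) = q"
  shows "\<exists>S :: ('a ^ 4) set set. maximal_partial_spread S \<and>
           int (card S) < (\<lceil>2 * log 2 (real q)\<rceil> + 1) * int q + 1 - 3 * int q"
proof -
  note card = assms(4)
  have "q \<in> {5, 7, 8, 9, 11, 13, 16, 17, 19, 23, 25, 27, 29, 31, 32, 37, 41, 43, 47, 49, 53, 59, 61, 64, 67, 71, 73, 79, 81, 83, 89, 97, 101}" using assms(1-3) by (rule primepow_cases)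
  then consider "q = 5" | "q = 7" | "q = 8" | "q = 9" | "q = 11" | "q = 13" | "q = 16" | "q = 17" | "q = 19" | "q = 23" | "q = 25" | "q = 27" | "q = 29" | "q = 31" | "q = 32" | "q = 37" | "q = 41" | "q = 43" | "q = 47" | "q = 49" | "q = 53" | "q = 59" | "q = 61" | "q = 64" | "q = 67" | "q = 71" | "q = 73" | "q = 79" | "q = 81" | "q = 83" | "q = 89" | "q = 97" | "q = 101" by auto
  then show ?thesis
  proof cases
    case 1
    show ?thesis by (rule less_bound[OF spread_5, of 4]) (use card 1 in simp_all)
  next
    case 2
    show ?thesis by (rule less_bound[OF spread_7, of 5]) (use card 2 in simp_all)
  next
    case 3
    show ?thesis by (rule less_bound[OF spread_8, of 5]) (use card 3 in simp_all)
  next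
    case 4
    show ?thesis by (rule less_bound[OF spread_9, of 6]) (use card 4 in simp_all)
  next
    case 5
    show ?thesis by (rule less_bound[OF spread_11, of 6]) (use card 5 in simp_all)
  next
    case 6
    show ?thesis by (rule less_bound[OF spread_13, of 7]) (use card 6 in simp_all)
  next
    case 7
    show ?thesis by (rule less_bound[OF spread_16, of 7]) (use card 7 in simp_all)
  next
    case 8
    show ?thesis by (rule less_bound[OF spread_17, of 8]) (use card 8 in simp_all)
  next
    case 9
    show ?thesis by (rule less_bound[OF spread_19, of 8]) (use card 9 in simp_all)
  next
    case 10
    show ?thesis by (rule less_bound[OF spread_23, of 9]) (use card 10 in simp_all)
  next
    case 11
    show ?thesis by (rule less_bound[OF spread_25, of 9]) (use card 11 in simp_all)
  next
    case 12
    show ?thesis by (rule less_bound[OF spread_27, of 9]) (use card 12 in simp_all)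
  next
    case 13
    show ?thesis by (rule less_bound[OF spread_29, of 9]) (use card 13 in simp_all)
  next
    case 14
    show ?thesis by (rule less_bound[OF spread_31, of 9]) (use card 14 in simp_all)
  next
    case 15
    show ?thesis by (rule less_bound[OF spread_32, of 9]) (use card 15 in simp_all)
  next
    case 16
    show ?thesis by (rule less_bound[OF spread_37, of 10]) (use card 16 in simp_all)
  next
    case 17
    show ?thesis by (rule less_bound[OF spread_41, of 10]) (use card 17 in simp_all)
  next
    case 18
    show ?thesis by (rule less_bound[OF spread_43, of 10]) (use card 18 in simp_all)
  next
    case 19
    show ?thesis by (rule less_bound[OF spread_47, of 11]) (use card 19 in simp_all)
  next
    case 20
    show ?thesis by (rule less_bound[OF spread_49, of 11]) (use card 20 in simp_all)
  next
    case 21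
    show ?thesis by (rule less_bound[OF spread_53, of 11]) (use card 21 in simp_all)
  next
    case 22
    show ?thesis by (rule less_bound[OF spread_59, of 11]) (use card 22 in simp_all)
  next
    case 23
    show ?thesis by (rule less_bound[OF spread_61, of 11]) (use card 23 in simp_all)
  next
    case 24
    show ?thesis by (rule less_bound[OF spread_64, of 11]) (use card 24 in simp_all)
  next
    case 25
    show ?thesis by (rule less_bound[OF spread_67, of 12]) (use card 25 in simp_all)
  next
    case 26
    show ?thesis by (rule less_bound[OF spread_71, of 12]) (use card 26 in simp_all)
  next
    case 27
    show ?thesis by (rule less_bound[OF spread_73, of 12]) (use card 27 in simp_all)
  next
    case 28
    show ?thesis by (rule less_bound[OF spread_79, of 12]) (use card 28 in simp_all)
  next
    case 29
    show ?thesis by (rule less_bound[OF spread_81, of 12]) (use card 29 in simp_all)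
  next
    case 30
    show ?thesis by (rule less_bound[OF spread_83, of 12]) (use card 30 in simp_all)
  next
    case 31
    show ?thesis by (rule less_bound[OF spread_89, of 12]) (use card 31 in simp_all)
  next
    case 32
    show ?thesis by (rule less_bound[OF spread_97, of 13]) (use card 32 in simp_all)
  next
    case 33
    show ?thesis by (rule less_bound[OF spread_101, of 13]) (use card 33 in simp_all)
  qed
qed

end
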